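(* Let $k>0$ and let $u^{\mathrm{in}}$ be an incident wave with wave number $k$. Assume the following. (1) $\Gamma$ is a simple closed curve parametrized counterclockwise by $x(t)=(x_1(t),x_2(t))$ for $t\in[-\pi,\pi]$, where $x'$ vanishes at no more than finitely many points of $[-\pi,\pi]$, and $x_1,x_2$ extend to complex analytic functions in an open set $\mathcal T\subset\mathbb C$ which contains the interval $[-\pi,\pi]$. (2) $D$, the domain enclosed by $\Gamma$, has a constant refractive index $0<q\neq1$. (3) $g(t)=x_1(t)+ix_2(t)$ has a simple critical point at $t_0\in\mathcal T$, i.e. $g'$ has a simple zero at $t_0$, and $t_0\neq\pm\pi$. (4) There exists a contour $\mathcal C$ in $\mathcal T$ joining $-\pi$ to $\pi$ (and containing both these endpoints) that passes through $t_0$, such that $\Re g(t)<\Re g(t_0)$ for all $t\in\mathcal C\setminus\{t_0\}$. (5) $u^{\mathrm{in}}(x_1,x_2)$ extends to an analytic function of two complex variables in some open subset of $\mathbb C^2$ containing $\{(x_1(t),x_2(t)):t\in\mathcal T\}$. Let $$I(\lambda)=\int_{-\pi}^{\pi}\left[(x_2',-x_1')\cdot V+i\lambda g'v+i\tilde\lambda x_1'v\right]e^{\lambda g+i\tilde\lambda x_2}\,dt .$$ Then, as $\lambda\to\infty$, $$I(\lambda)=\frac{1}{\lambda^{3/2}}e^{\lambda g(t_0)}\left[C_1+O\left(\tfrac1\lambda\right)\right],\qquad C_1=k^2(q-1)\sqrt{\frac{-2\pi}{g''(t_0)}}\;u^{\mathrm{in}}(x(t_0))\,x_2'(t_0).$$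 In particular, under the nondegeneracy condition $(q-1)\,u^{\mathrm{in}}(x(t_0))\,x_2'(t_0)\neq0$, the incident wave $u^{\mathrm{in}}$ is scattered by $D$.
   Context: An incident wave with wave number $k>0$ is a non-trivial solution $u^{\mathrm{in}}$ of $\Delta u^{\mathrm{in}}+k^2u^{\mathrm{in}}=0$ in $\mathbb R^2$. For a bounded simply connected planar domain $D$ with constant refractive index $q$ (the index is $1$ outside $D$), $u^{\mathrm{in}}$ is called nonscattering for $D$ if there is $u\in H^2_{\mathrm{loc}}(\mathbb R^2)$ with $u=0$ in $\mathbb R^2\setminus D$ and $\Delta u+k^2qu=k^2(1-q)u^{\mathrm{in}}\chi_D$ in $\mathbb R^2$, where $\chi_D$ is the indicator function of $D$ (here $u$ is the total field minus $u^{\mathrm{in}}$). Otherwise $u^{\mathrm{in}}$ is said to be scattered by $D$. Notation: $\tilde\lambda=\sqrt{\lambda^2+k^2q}-\lambda$ for $\lambda\ge 0$; $v(t)=u^{\mathrm{in}}(x(t))$ and $V(t)=\nabla u^{\mathrm{in}}(x(t))$; primes are derivatives in $t$; $a\cdot b=a_1b_1+a_2b_2$ (no complex conjugation). Values at complex $t$, such as $u^{\mathrm{in}}(x(t_0))$, refer to the analytic extensions. Branch of the square root: $\sqrt{-2\pi/g''(t_0)}=\sqrt{2\pi}/(-g''(t_0))^{1/2}$, where the power is formed using the value $\omega_0=\arg(-g''(t_0))$ that satisfies $|\omega_0+2\omega|\le\pi/2$, with $\omega$ the limiting value of $\arg(t-t_0)$ as $t\to t_0$ along the part of $\mathcal C$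 joining $t_0$ to $\pi$.
   Formalization: The contour C is also assumed homotopic in T, with fixed endpoints, to [-π,π] (the claim can fail if C goes round a singularity of x), and "passes through t0" means C meets t0 once, with limiting directions on both sides, crossing from one valley of Re g to the opposite one. *)

theory Defs
  imports "HOL-Complex_Analysis.Complex_Analysis" "HOL-Library.Landau_Symbols"
begin

section \<open>Classical derivatives, test functions and \<open>H\<^sup>2\<^sub>l\<^sub>o\<^sub>c\<close>\<close>

definition partial :: "'a::euclidean_space \<Rightarrow> ('a \<Rightarrow> complex) \<Rightarrow> 'a \<Rightarrow> complex" where
  "partial b f z = frechet_derivative f (at z) b"

definition laplacian :: "('a::euclidean_space \<Rightarrow> complex) \<Rightarrow> 'a \<Rightarrow> complex" where
  "laplacian f z = (\<Sum>b\<in>Basis. partial b (partial b f) z)"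

primrec Ck :: "nat \<Rightarrow> ('a::euclidean_space \<Rightarrow> complex) \<Rightarrow> bool" where
  "Ck 0 f \<longleftrightarrow> continuous_on UNIV f"
| "Ck (Suc n) f \<longleftrightarrow> (\<forall>z. f differentiable (at z)) \<and> (\<forall>b\<in>Basis. Ck n (partial b f))"

definition test_function :: "('a::euclidean_space \<Rightarrow> complex) \<Rightarrow> bool" where
  "test_function \<phi> \<longleftrightarrow> (\<forall>n. Ck n \<phi>) \<and> compact (closure {z. \<phi> z \<noteq> 0})"

definition locally_L2 :: "('a::euclidean_space \<Rightarrow> complex) \<Rightarrow> bool" where
  "locally_L2 u \<longleftrightarrow> u \<in> borel_measurable lebesgue \<and>
     (\<forall>K. compact K \<longrightarrow> set_integrable lebesgue K (\<lambda>z. (norm (u z))\<^sup>2))"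

definition weak_partial ::
    "'a::euclidean_space \<Rightarrow> ('a \<Rightarrow> complex) \<Rightarrow> ('a \<Rightarrow> complex) \<Rightarrow> bool" where
  "weak_partial b u w \<longleftrightarrow> (\<forall>\<phi>. test_function \<phi> \<longrightarrow>
     (LINT z|lebesgue. u z * partial b \<phi> z) = - (LINT z|lebesgue. w z * \<phi> z))"

definition H2_loc :: "('a::euclidean_space \<Rightarrow> complex) \<Rightarrow> bool" where
  "H2_loc u \<longleftrightarrow> locally_L2 u \<and>
     (\<forall>b\<in>Basis. \<exists>w. locally_L2 w \<and> weak_partial b u w \<and>
        (\<forall>c\<in>Basis. \<exists>w'. locally_L2 w' \<and> weak_partial c w w'))"

text \<open>Weak derivatives are unique only up to null sets, so the weak Laplacian is a relation.\<close>

definition weak_laplacian :: "('a::euclidean_space \<Rightarrow> complex) \<Rightarrow> ('a \<Rightarrow> complex) \<Rightarrow> bool" where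
  "weak_laplacian u L \<longleftrightarrow> (\<exists>w w'.
     (\<forall>b\<in>Basis. locally_L2 (w b) \<and> weak_partial b u (w b) \<and>
                 locally_L2 (w' b) \<and> weak_partial b (w b) (w' b)) \<and>
     L = (\<lambda>z. \<Sum>b\<in>Basis. w' b z))"


section \<open>Incident waves and scattering in the plane\<close>

text \<open>The plane is \<^typ>\<open>real \<times> real\<close>, with standard basis \<open>(1,0), (0,1)\<close>.\<close>

definition incident_wave :: "real \<Rightarrow> (real \<times> real \<Rightarrow> complex) \<Rightarrow> bool" where
  "incident_wave k u \<longleftrightarrow> Ck 2 u \<and> (\<forall>z. laplacian u z + of_real (k\<^sup>2) * u z = 0) \<and> (\<exists>z. u z \<noteq> 0)"

definition nonscattering ::
    "real \<Rightarrow> real \<Rightarrow> (real \<times> real) set \<Rightarrow> (real \<times> real \<Rightarrow> complex) \<Rightarrow> bool" where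
  "nonscattering k q D uin \<longleftrightarrow> (\<exists>u L. H2_loc u \<and> weak_laplacian u L \<and>
     (AE z in lebesgue. z \<notin> D \<longrightarrow> u z = 0) \<and>
     (AE z in lebesgue. L z + of_real (k\<^sup>2 * q) * u z
                       = of_real (k\<^sup>2 * (1 - q)) * uin z * indicator D z))"

abbreviation scattered ::
    "real \<Rightarrow> real \<Rightarrow> (real \<times> real) set \<Rightarrow> (real \<times> real \<Rightarrow> complex) \<Rightarrow> bool" where
  "scattered k q D uin \<equiv> \<not> nonscattering k q D uin"


section \<open>Analytic functions of two complex variables\<close>

text \<open>Local expansion in a double power series. On an open set \<open>\<Omega>\<close> the radius can be shrunk so that
  the polydisc lies in \<open>\<Omega>\<close>, so values of \<open>F\<close> outside \<open>\<Omega>\<close> do not matter.\<close>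

definition analytic2_on :: "(complex \<times> complex \<Rightarrow> complex) \<Rightarrow> (complex \<times> complex) set \<Rightarrow> bool" where
  "analytic2_on F \<Omega> \<longleftrightarrow> (\<forall>(a, b)\<in>\<Omega>. \<exists>c r. r > 0 \<and>
     (\<forall>z w. norm (z - a) < r \<and> norm (w - b) < r \<longrightarrow>
        ((\<lambda>(m::nat, n::nat). c m n * (z - a) ^ m * (w - b) ^ n) has_sum F (z, w)) UNIV))"


section \<open>The boundary curve and the boundary integral\<close>

text \<open>A single pair \<open>x1 x2 :: complex \<Rightarrow> complex\<close> denotes the analytic extensions of the real coordinate
  functions, which are recovered as the (real) values on \<open>[-\<pi>, \<pi>]\<close>; likewise the derivatives
  \<open>x1', x2'\<close> at real parameters are those of the extensions.\<close>

definition curve_pt :: "(complex \<Rightarrow> complex) \<Rightarrow> (complex \<Rightarrow> complex) \<Rightarrow> real \<Rightarrow> real \<times> real" where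
  "curve_pt x1 x2 t = (Re (x1 (of_real t)), Re (x2 (of_real t)))"

text \<open>Reparametrization from \<open>[-\<pi>, \<pi>]\<close> to the interval \<open>[0, 1]\<close> used for paths in the library.\<close>

definition curve_path :: "(complex \<Rightarrow> complex) \<Rightarrow> (complex \<Rightarrow> complex) \<Rightarrow> real \<Rightarrow> real \<times> real" where
  "curve_path x1 x2 s = curve_pt x1 x2 (2 * pi * s - pi)"

definition counterclockwise :: "(real \<Rightarrow> real \<times> real) \<Rightarrow> bool" where
  "counterclockwise p \<longleftrightarrow> (\<forall>(a, b) \<in> inside (path_image p).
     winding_number (\<lambda>s. Complex (fst (p s)) (snd (p s))) (Complex a b) = 1)"

definition lam_tilde :: "real \<Rightarrow> real \<Rightarrow> real \<Rightarrow> real" where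
  "lam_tilde k q l = sqrt (l\<^sup>2 + k\<^sup>2 * q) - l"

definition gfun :: "(complex \<Rightarrow> complex) \<Rightarrow> (complex \<Rightarrow> complex) \<Rightarrow> complex \<Rightarrow> complex" where
  "gfun x1 x2 t = x1 t + \<i> * x2 t"

definition bdry_integral ::
    "real \<Rightarrow> real \<Rightarrow> (real \<times> real \<Rightarrow> complex) \<Rightarrow> (complex \<Rightarrow> complex) \<Rightarrow> (complex \<Rightarrow> complex)
     \<Rightarrow> real \<Rightarrow> complex" where
  "bdry_integral k q uin x1 x2 l = integral {-pi..pi} (\<lambda>t.
     let lt = complex_of_real (lam_tilde k q l);
         dx1 = deriv x1 (of_real t); dx2 = deriv x2 (of_real t);
         dg = deriv (gfun x1 x2) (of_real t);
         v = uin (curve_pt x1 x2 t);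
         V1 = partial (1, 0) uin (curve_pt x1 x2 t);
         V2 = partial (0, 1) uin (curve_pt x1 x2 t)
     in ((dx2 * V1 - dx1 * V2) + \<i> * of_real l * dg * v + \<i> * lt * dx1 * v)
        * exp (of_real l * gfun x1 x2 (of_real t) + \<i> * lt * x2 (of_real t)))"

text \<open>Square root of \<open>-2\<pi>/w\<close> determined by the chosen value \<open>\<omega>0\<close> of \<open>arg (-w)\<close>:
  \<open>\<surd>(2\<pi>) / (-w)\<^sup>1\<^sup>/\<^sup>2\<close> with \<open>(-w)\<^sup>1\<^sup>/\<^sup>2 = \<surd>\<bar>w\<bar> exp (i \<omega>0/2)\<close>.\<close>

definition branch_sqrt :: "complex \<Rightarrow> real \<Rightarrow> complex" where
  "branch_sqrt w \<omega>0 = of_real (sqrt (2 * pi)) / (of_real (sqrt (norm w)) * cis (\<omega>0 / 2))"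


section \<open>The contour through the saddle point\<close>

text \<open>\<open>c\<close> reaches \<open>t0\<close> exactly once, at an interior parameter \<open>s0\<close>, so that the part of the contour
  joining \<open>t0\<close> to its end point is well defined. \<open>\<omega>\<close> is the limiting value of \<open>arg (t - t0)\<close>
  along that outgoing part, and \<open>\<omega>0\<close> is the value of \<open>arg (-g''(t0))\<close> with
  \<open>\<bar>\<omega>0 + 2 \<omega>\<bar> \<le> \<pi>/2\<close>. Passing through \<open>t0\<close> means that the contour crosses the saddle, from one
  valley of \<open>Re g\<close> into the opposite one: the limiting direction of travel
  \<open>\<omega>' = lim arg (t0 - t)\<close> along the incoming part obeys the same bound. (If the contour is smooth at
  \<open>t0\<close> then \<open>\<omega>' = \<omega>\<close>; corners are allowed.) A contour that enters and leaves through the same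
  valley is thereby excluded.\<close>

definition passes_through ::
    "(real \<Rightarrow> complex) \<Rightarrow> complex \<Rightarrow> complex \<Rightarrow> real \<Rightarrow> real \<Rightarrow> bool" where
  "passes_through c t0 g2 \<omega> \<omega>0 \<longleftrightarrow>
     is_Arg (- g2) \<omega>0 \<and> \<bar>\<omega>0 + 2 * \<omega>\<bar> \<le> pi / 2 \<and>
     (\<exists>s0. 0 < s0 \<and> s0 < 1 \<and> (\<forall>s\<in>{0..1}. c s = t0 \<longleftrightarrow> s = s0) \<and>
        ((\<lambda>s. sgn (c s - t0)) \<longlongrightarrow> cis \<omega>) (at_right s0) \<and>
        (\<exists>\<omega>'. ((\<lambda>s. sgn (t0 - c s)) \<longlongrightarrow> cis \<omega>') (at_left s0) \<and> \<bar>\<omega>0 + 2 * \<omega>'\<bar> \<le> pi / 2))"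

end

theory Submission
  imports Defs "HOL-Probability.Distributions" "HOL-Real_Asymp.Real_Asymp"
begin

text \<open>Two integrations by parts turn \<open>I(\<lambda>)\<close> into \<open>\<lambda>\<^sup>-\<^sup>1 \<integral> h\<^sub>\<lambda> e\<^bsup>\<lambda>g\<^esup>\<close> up to endpoint terms, which are
  exponentially small against \<open>e\<^bsup>\<lambda>g(t0)\<^esup>\<close>. Near the saddle the contour is replaced, in a coordinate with
  \<open>g = g(t0) - z\<^sup>2\<close>, by a path running along the real axis, and the Laplace method applies; the Helmholtz
  equation, propagated from the real curve to \<open>t0\<close>, evaluates \<open>h\<^sub>\<lambda>(t0)\<close>.

  If the wave is nonscattering, testing the weak equation with \<open>\<phi> = exp (\<lambda> x\<^sub>1 + i (\<lambda> + \<mu>) x\<^sub>2)\<close>, where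
  \<open>\<mu> = lam_tilde k q \<lambda>\<close>, a solution of
  \<open>\<Delta>\<phi> + k\<^sup>2 q \<phi> = 0\<close>, gives \<open>\<integral>\<^sub>D u\<^sup>i\<^sup>n \<phi> = 0\<close>. By Green's theorem \<open>I(\<lambda>)\<close> is a multiple of this integral, so it vanishes
  for every \<open>\<lambda>\<close> and the leading coefficient must be \<open>0\<close>. Green's theorem on the inside of the curve comes from the
  Cauchy--Pompeiu formula: integrating it along the curve and exchanging the integrals produces winding numbers.\<close>

section \<open>Analytic functions of two variables\<close>

text \<open>The rate \<open>l powr (-3/2)\<close>, one power better than a generic saddle, comes
  from a double cancellation. The terms of size \<open>l\<close> in the integrand carry the factor
  \<open>g'\<close>, which vanishes at \<open>t0\<close>. Removing them by parts leaves
  \<open>-i g' W\<close> with \<open>W = d1 F - i d2 F\<close>, and this vanishes at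
  \<open>t0\<close> once more; only the second integration by parts produces an amplitude that is in
  general nonzero at the saddle. That amplitude still depends on the large parameter through
  \<open>lam_tilde\<close>, so the Laplace estimate has to be uniform over a family of amplitudes,
  and the limit \<open>lam_tilde = 0\<close> is taken only in the value at \<open>t0\<close>.

  For the scattering statement the obstacle is the boundary: \<open>x'\<close> may have zeros and
  the curve may have a corner where it closes, so \<open>D\<close> need not be a smooth domain. The
  Cauchy--Pompeiu route needs no more than a C1 parametrization and the winding number, and the
  curve itself is a null set. The link to the saddle integral is that on the real curve the exponent
  of the test solution equals \<open>l g + i lam_tilde x2\<close>.\<close>

definition power_series2 ::
    "(nat \<Rightarrow> nat \<Rightarrow> complex) \<Rightarrow> complex \<Rightarrow> complex \<Rightarrow> real \<Rightarrow> (complex \<times> complex \<Rightarrow> complex) \<Rightarrow> bool" where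
  "power_series2 c a b r F \<longleftrightarrow> r > 0 \<and> (\<forall>z w. norm (z - a) < r \<and> norm (w - b) < r \<longrightarrow>
     ((\<lambda>(m::nat, n::nat). c m n * (z - a) ^ m * (w - b) ^ n) has_sum F (z, w)) UNIV)"

definition d1 :: "(complex \<times> complex \<Rightarrow> complex) \<Rightarrow> complex \<times> complex \<Rightarrow> complex" where
  "d1 F p = deriv (\<lambda>z. F (z, snd p)) (fst p)"

definition d2 :: "(complex \<times> complex \<Rightarrow> complex) \<Rightarrow> complex \<times> complex \<Rightarrow> complex" where
  "d2 F p = deriv (\<lambda>w. F (fst p, w)) (snd p)"

lemma analytic2_on_altdef:
  "analytic2_on F \<Omega> \<longleftrightarrow> (\<forall>(a, b)\<in>\<Omega>. \<exists>c r. power_series2 c a b r F)"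
  unfolding analytic2_on_def power_series2_def by blast

lemma power_series2D:
  assumes "power_series2 c a b r F" "norm (z - a) < r" "norm (w - b) < r"
  shows "((\<lambda>(m::nat, n::nat). c m n * (z - a) ^ m * (w - b) ^ n) has_sum F (z, w)) UNIV"
  using assms unfolding power_series2_def by blast

lemma power_series2_summable:
  assumes "power_series2 c a b r F" "0 < \<rho>" "\<rho> < r"
  shows "(\<lambda>(m, n). norm (c m n) * \<rho> ^ m * \<rho> ^ n) summable_on UNIV"
proof -
  have "((\<lambda>(m::nat, n::nat). c m n * ((a + of_real \<rho>) - a) ^ m * ((b + of_real \<rho>) - b) ^ n)
          has_sum F (a + of_real \<rho>, b + of_real \<rho>)) UNIV"
    using assms by (intro power_series2D[OF assms(1)]) auto
  then have "(\<lambda>(m::nat, n::nat). c m n * of_real \<rho> ^ m * of_real \<rho> ^ n) summable_on UNIV"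
    by (auto simp: summable_on_def)
  then have "(\<lambda>x. norm ((\<lambda>(m::nat, n::nat). c m n * of_real \<rho> ^ m * of_real \<rho> ^ n) x)) summable_on UNIV"
    by (simp only: summable_on_iff_abs_summable_on_complex)
  moreover have "(\<lambda>x. norm ((\<lambda>(m::nat, n::nat). c m n * of_real \<rho> ^ m * of_real \<rho> ^ n) x))
      = (\<lambda>(m, n). norm (c m n) * \<rho> ^ m * \<rho> ^ n)"
    using assms(2) by (auto simp: fun_eq_iff norm_mult norm_power)
  ultimately show ?thesis by simp
qed

text \<open>Termwise differentiation costs a factor \<open>m\<close>. Enlarging the radius from
  \<open>\<sigma>\<close> to \<open>\<rho>\<close> pays for it, because
  \<open>m (\<sigma> / \<rho>)^m\<close> tends to 0 and is therefore bounded.\<close>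

lemma nat_times_power_bound:
  fixes \<sigma> \<rho> :: real
  assumes "0 < \<sigma>" "\<sigma> < \<rho>"
  obtains K where "\<And>m::nat. real m * \<sigma> ^ (m - 1) \<le> K * \<rho> ^ m"
proof -
  have "(\<lambda>n. of_nat n * (\<sigma> / \<rho>) ^ n) \<longlonglongrightarrow> 0"
    by (rule powser_times_n_limit_0) (use assms in auto)
  then have "Bseq (\<lambda>n. of_nat n * (\<sigma> / \<rho>) ^ n)"
    by (intro convergent_imp_Bseq) (auto simp: convergent_def)
  then obtain K where K: "\<And>n. norm (of_nat n * (\<sigma> / \<rho>) ^ n) \<le> K"
    unfolding Bseq_def by auto
  have "real m * \<sigma> ^ (m - 1) \<le> (K / \<sigma>) * \<rho> ^ m" for m
  proof (cases m)
    case 0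
    have "0 \<le> K" using K[of 0] by simp
    then show ?thesis using 0 assms by simp
  next
    case (Suc k)
    have "real m * (\<sigma> / \<rho>) ^ m \<le> K" using K[of m] assms by simp
    then have "real m * \<sigma> ^ m \<le> K * \<rho> ^ m" using assms by (simp add: field_simps)
    then show ?thesis using assms Suc by (simp add: field_simps)
  qed
  then show ?thesis using that by blast
qed

text \<open>The partial sums converge uniformly by the M-test and are holomorphic in the curve
  parameter, so their derivatives converge as well. Working along a holomorphic curve covers two
  uses at once: coordinate lines give the partial derivatives, general curves give the chain
  rule.\<close>

lemma power_series2_chain:
  assumes ps: "power_series2 c a b r F"
    and N: "open N" "x holomorphic_on N" "y holomorphic_on N" "s \<in> N"
    and small: "norm (x s - a) < r" "norm (y s - b) < r"
  obtains S1 S2 where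
    "((\<lambda>(m, n). of_nat m * c m n * (x s - a) ^ (m - 1) * (y s - b) ^ n) has_sum S1) UNIV"
    "((\<lambda>(m, n). of_nat n * c m n * (x s - a) ^ m * (y s - b) ^ (n - 1)) has_sum S2) UNIV"
    "((\<lambda>s. F (x s, y s)) has_field_derivative S1 * deriv x s + S2 * deriv y s) (at s)"
proof -
  \<comment> \<open>Two nested radii: the curve stays within \<open>\<sigma>\<close> of the centre,
    and the gap up to \<open>\<rho>\<close> absorbs the factors \<open>m\<close> and
    \<open>n\<close> of the differentiated terms.\<close>
  obtain \<sigma> where \<sigma>: "norm (x s - a) < \<sigma>" "norm (y s - b) < \<sigma>" "\<sigma> < r"
    using small dense[of "max (norm (x s - a)) (norm (y s - b))" r] by auto
  obtain \<rho> where \<rho>: "\<sigma> < \<rho>" "\<rho> < r" using \<sigma> dense by blast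
  have \<sigma>0: "0 < \<sigma>" using \<sigma>(1) norm_ge_zero[of "x s - a"] by linarith
  obtain K where K: "\<And>m::nat. real m * \<sigma> ^ (m - 1) \<le> K * \<rho> ^ m"
    using nat_times_power_bound[OF \<sigma>0 \<rho>(1)] by blast
  have K0: "0 \<le> K" using K[of 0] by simp
  let ?M = "\<lambda>(m, n). norm (c m n) * \<rho> ^ m * \<rho> ^ n"
  have M: "?M summable_on UNIV"
    using power_series2_summable[OF ps] \<rho> \<sigma>0 by auto
  have le1: "real m * \<sigma> ^ (m - 1) * \<sigma> ^ n \<le> K * \<rho> ^ m * \<rho> ^ n" for m n
    by (rule mult_mono[OF K power_mono]) (use \<sigma>0 \<rho> K0 in auto)
  define N' where "N' = N \<inter> (\<lambda>s. x s - a) -` ball 0 \<sigma> \<inter> (N \<inter> (\<lambda>s. y s - b) -` ball 0 \<sigma>)"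
  have oN': "open N'"
    unfolding N'_def using N
    by (intro open_Int continuous_open_preimage continuous_intros holomorphic_on_imp_continuous_on) auto
  have sN': "s \<in> N'" using N \<sigma> by (auto simp: N'_def)
  have xyN: "norm (x t - a) < \<sigma>" "norm (y t - b) < \<sigma>" "t \<in> N" if "t \<in> N'" for t
    using that by (auto simp: N'_def)
  have xh: "x holomorphic_on N'" "y holomorphic_on N'"
    using N by (auto intro: holomorphic_on_subset simp: N'_def)
  let ?f = "\<lambda>(m, n) t. c m n * (x t - a) ^ m * (y t - b) ^ n"
  let ?f1 = "\<lambda>(m, n). of_nat m * c m n * (x s - a) ^ (m - 1) * (y s - b) ^ n"
  let ?f2 = "\<lambda>(m, n). of_nat n * c m n * (x s - a) ^ m * (y s - b) ^ (n - 1)"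
  have ul: "uniform_limit N' (\<lambda>X t. \<Sum>p\<in>X. ?f p t) (\<lambda>t. F (x t, y t)) (finite_subsets_at_top UNIV)"
  proof (rule Weierstrass_m_test_general'[OF _ _ M])
    fix p :: "nat \<times> nat" and t assume t: "t \<in> N'"
    obtain m n where p: "p = (m, n)" by force
    show "norm (?f p t) \<le> ?M p"
      using xyN[OF t] \<rho> \<sigma>0 unfolding p
      by (auto simp: norm_mult norm_power intro!: mult_mono power_mono)
  next
    fix t assume t: "t \<in> N'"
    have "((\<lambda>(m::nat, n::nat). c m n * (x t - a) ^ m * (y t - b) ^ n) has_sum F (x t, y t)) UNIV"
      using ps xyN[OF t] \<rho> unfolding power_series2_def by auto
    then show "((\<lambda>p. ?f p t) has_sum F (x t, y t)) UNIV"
      by (simp add: case_prod_unfold)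
  qed
  have fh: "(\<lambda>t. \<Sum>p\<in>X. ?f p t) holomorphic_on N'" for X
    using xh by (auto intro!: holomorphic_intros simp: case_prod_unfold)
  \<comment> \<open>Differentiation commutes with locally uniform limits of holomorphic functions.
    The limit runs over finite index sets because \<open>has_sum\<close> is unordered.\<close>
  have lim: "((\<lambda>X. (deriv ^^ 1) (\<lambda>t. \<Sum>p\<in>X. ?f p t) s) \<longlongrightarrow> (deriv ^^ 1) (\<lambda>t. F (x t, y t)) s) (finite_subsets_at_top UNIV)"
    by (rule higher_deriv_complex_uniform_limit[OF ul _ _ oN' sN'])
       (use fh in auto)
  obtain e where e: "e > 0" "cball s e \<subseteq> N'" using oN' sN' by (meson open_contains_cball)
  have "(\<lambda>t. F (x t, y t)) holomorphic_on ball s e"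
  proof (rule holomorphic_uniform_limit)
    show "uniform_limit (cball s e) (\<lambda>X t. \<Sum>p\<in>X. ?f p t) (\<lambda>t. F (x t, y t)) (finite_subsets_at_top UNIV)"
      using ul e uniform_limit_on_subset by blast
    have "continuous_on (cball s e) (\<lambda>t. \<Sum>p\<in>X. ?f p t)" "(\<lambda>t. \<Sum>p\<in>X. ?f p t) holomorphic_on ball s e" for X
      using holomorphic_on_subset[OF fh, of _ X] e ball_subset_cball[of s e]
      by (blast intro: holomorphic_on_imp_continuous_on)+
    then show "\<forall>\<^sub>F X in finite_subsets_at_top UNIV. continuous_on (cball s e) (\<lambda>t. \<Sum>p\<in>X. ?f p t) \<and>
       (\<lambda>t. \<Sum>p\<in>X. ?f p t) holomorphic_on ball s e" by simp
  qed auto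
  then have D: "((\<lambda>t. F (x t, y t)) has_field_derivative deriv (\<lambda>t. F (x t, y t)) s) (at s)"
    using e by (intro holomorphic_derivI[of _ "ball s e"]) auto
  have dx: "(x has_field_derivative deriv x s) (at s)" "(y has_field_derivative deriv y s) (at s)"
    using N by (auto intro: holomorphic_derivI)
  have dsum: "deriv (\<lambda>t. \<Sum>p\<in>X. ?f p t) s = (\<Sum>p\<in>X. ?f1 p) * deriv x s + (\<Sum>p\<in>X. ?f2 p) * deriv y s" for X
    by (rule DERIV_imp_deriv)
       (auto intro!: derivative_eq_intros dx sum.cong
             simp: case_prod_unfold sum_distrib_left sum.distrib[symmetric] algebra_simps)
  have b1: "norm (?f1 p) \<le> K * ?M p" "norm (?f2 p) \<le> K * ?M p" for p
  proof -
    obtain m n where p: "p = (m, n)" by force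
    have "norm (?f1 p) = norm (c m n) * (real m * norm (x s - a) ^ (m - 1) * norm (y s - b) ^ n)"
      by (simp add: p norm_mult norm_power)
    also have "\<dots> \<le> norm (c m n) * (real m * \<sigma> ^ (m - 1) * \<sigma> ^ n)"
      using \<sigma> \<sigma>0 by (intro mult_mono power_mono) auto
    also have "\<dots> \<le> norm (c m n) * (K * \<rho> ^ m * \<rho> ^ n)"
      by (intro mult_left_mono le1) auto
    finally show "norm (?f1 p) \<le> K * ?M p" by (simp add: p algebra_simps)
    have "norm (?f2 p) = norm (c m n) * (real n * norm (y s - b) ^ (n - 1) * norm (x s - a) ^ m)"
      by (simp add: p norm_mult norm_power)
    also have "\<dots> \<le> norm (c m n) * (real n * \<sigma> ^ (n - 1) * \<sigma> ^ m)"
      using \<sigma> \<sigma>0 by (intro mult_mono power_mono) auto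
    also have "\<dots> \<le> norm (c m n) * (K * \<rho> ^ n * \<rho> ^ m)"
      by (intro mult_left_mono le1) auto
    finally show "norm (?f2 p) \<le> K * ?M p" by (simp add: p algebra_simps)
  qed
  have KM: "(\<lambda>p. K * ?M p) summable_on UNIV" by (rule summable_on_cmult_right[OF M])
  have "?f1 summable_on UNIV" "?f2 summable_on UNIV"
    using b1 by (auto intro!: abs_summable_summable Infinite_Sum.abs_summable_on_comparison_test'[OF KM])
  then obtain S1 S2 where S: "(?f1 has_sum S1) UNIV" "(?f2 has_sum S2) UNIV"
    by (auto simp: summable_on_def)
  have "((\<lambda>X. (\<Sum>p\<in>X. ?f1 p) * deriv x s + (\<Sum>p\<in>X. ?f2 p) * deriv y s) \<longlongrightarrow> S1 * deriv x s + S2 * deriv y s) (finite_subsets_at_top UNIV)"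
    using S unfolding has_sum_def by (intro tendsto_intros)
  with lim have "deriv (\<lambda>t. F (x t, y t)) s = S1 * deriv x s + S2 * deriv y s"
    unfolding dsum[symmetric] by (auto intro: tendsto_unique[OF finite_subsets_at_top_neq_bot])
  with D show ?thesis using that[OF S] by simp
qed

text \<open>The differentiated series has a vanishing row \<open>m = 0\<close>. Dropping it shifts
  the index and turns the sum back into a power series.\<close>

lemma has_sum_Suc_fst:
  assumes "(f has_sum S) UNIV" "\<And>n. f (0::nat, n) = 0"
  shows "((\<lambda>(m, n). f (Suc m, n)) has_sum S) (UNIV :: (nat \<times> nat) set)"
proof -
  let ?h = "\<lambda>(m::nat, n::nat). (Suc m, n)"
  have "(f has_sum S) (range ?h) \<longleftrightarrow> (f has_sum S) UNIV"
  proof (rule has_sum_cong_neutral)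
    fix p :: "nat \<times> nat" assume "p \<in> UNIV - range ?h"
    then show "f p = 0" using assms(2) by (cases p; cases "fst p") (force simp: image_iff)+
  qed auto
  then have "((f \<circ> ?h) has_sum S) UNIV"
    using assms(1) has_sum_reindex[of ?h UNIV f S] by (auto simp: inj_on_def)
  then show ?thesis by (simp add: comp_def case_prod_unfold)
qed

lemma has_sum_Suc_snd:
  assumes "(f has_sum S) UNIV" "\<And>m. f (m, 0::nat) = 0"
  shows "((\<lambda>(m, n). f (m, Suc n)) has_sum S) (UNIV :: (nat \<times> nat) set)"
proof -
  let ?h = "\<lambda>(m::nat, n::nat). (m, Suc n)"
  have "(f has_sum S) (range ?h) \<longleftrightarrow> (f has_sum S) UNIV"
  proof (rule has_sum_cong_neutral)
    fix p :: "nat \<times> nat" assume "p \<in> UNIV - range ?h"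
    then show "f p = 0" using assms(2) by (cases p; cases "snd p") (force simp: image_iff)+
  qed auto
  then have "((f \<circ> ?h) has_sum S) UNIV"
    using assms(1) has_sum_reindex[of ?h UNIV f S] by (auto simp: inj_on_def)
  then show ?thesis by (simp add: comp_def case_prod_unfold)
qed

text \<open>This is the chain rule along the line \<open>s \<mapsto> (s, w)\<close>. Centre and
  radius are unchanged, so differentiation can be iterated freely.\<close>

lemma power_series2_d1:
  assumes ps: "power_series2 c a b r F"
  shows "power_series2 (\<lambda>m n. of_nat (Suc m) * c (Suc m) n) a b r (d1 F)"
  unfolding power_series2_def
proof (intro conjI allI impI)
  show "r > 0" using ps by (simp add: power_series2_def)
  fix z w assume zw: "norm (z - a) < r \<and> norm (w - b) < r"
  obtain S1 S2 where S: "((\<lambda>(m, n). of_nat m * c m n * (z - a) ^ (m - 1) * (w - b) ^ n) has_sum S1) UNIV"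
    "((\<lambda>s. F (s, w)) has_field_derivative S1 * deriv (\<lambda>s. s) z + S2 * deriv (\<lambda>s. w) z) (at z)"
    using power_series2_chain[OF ps, of UNIV "\<lambda>s. s" "\<lambda>s. w" z] zw by auto
  have "d1 F (z, w) = S1"
    using DERIV_imp_deriv[OF S(2)] by (simp add: d1_def)
  then show "((\<lambda>(m, n). of_nat (Suc m) * c (Suc m) n * (z - a) ^ m * (w - b) ^ n) has_sum d1 F (z, w)) UNIV"
    using has_sum_Suc_fst[OF S(1)] by simp
qed

lemma power_series2_d2:
  assumes ps: "power_series2 c a b r F"
  shows "power_series2 (\<lambda>m n. of_nat (Suc n) * c m (Suc n)) a b r (d2 F)"
  unfolding power_series2_def
proof (intro conjI allI impI)
  show "r > 0" using ps by (simp add: power_series2_def)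
  fix z w assume zw: "norm (z - a) < r \<and> norm (w - b) < r"
  obtain S1 S2 where S: "((\<lambda>(m, n). of_nat n * c m n * (z - a) ^ m * (w - b) ^ (n - 1)) has_sum S2) UNIV"
    "((\<lambda>s. F (z, s)) has_field_derivative S1 * deriv (\<lambda>s. z) w + S2 * deriv (\<lambda>s. s) w) (at w)"
    using power_series2_chain[OF ps, of UNIV "\<lambda>s. z" "\<lambda>s. s" w] zw by auto
  have "d2 F (z, w) = S2"
    using DERIV_imp_deriv[OF S(2)] by (simp add: d2_def)
  then show "((\<lambda>(m, n). of_nat (Suc n) * c m (Suc n) * (z - a) ^ m * (w - b) ^ n) has_sum d2 F (z, w)) UNIV"
    using has_sum_Suc_snd[OF S(1)] by simp
qed

lemma power_series2_center:
  assumes "power_series2 c a b r F"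
  shows "F (a, b) = c 0 0"
proof -
  have "((\<lambda>(m::nat, n::nat). c m n * (a - a) ^ m * (b - b) ^ n) has_sum F (a, b)) UNIV"
    by (rule power_series2D[OF assms]; use assms in \<open>simp add: power_series2_def\<close>)
  moreover have "((\<lambda>(m::nat, n::nat). c m n * (a - a) ^ m * (b - b) ^ n) has_sum c 0 0) UNIV"
    by (rule has_sum_finite_neutralI[where B = "{(0, 0)}"]) (auto simp: power_0_left split: if_splits)
  ultimately show ?thesis by (rule has_sum_unique)
qed

lemma analytic2_on_d1: "analytic2_on F \<Omega> \<Longrightarrow> analytic2_on (d1 F) \<Omega>"
  unfolding analytic2_on_altdef using power_series2_d1 by blast

lemma analytic2_on_d2: "analytic2_on F \<Omega> \<Longrightarrow> analytic2_on (d2 F) \<Omega>"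
  unfolding analytic2_on_altdef using power_series2_d2 by blast

text \<open>With the expansion centred at \<open>p\<close>, both mixed derivatives are the
  coefficient \<open>c 1 1\<close>.\<close>

lemma d1_d2_commute:
  assumes "analytic2_on F \<Omega>" "p \<in> \<Omega>"
  shows "d1 (d2 F) p = d2 (d1 F) p"
proof -
  obtain a b where p: "p = (a, b)" by force
  with assms obtain c r where ps: "power_series2 c a b r F"
    unfolding analytic2_on_altdef by blast
  show ?thesis
    using power_series2_center[OF power_series2_d1[OF power_series2_d2[OF ps]]]
      power_series2_center[OF power_series2_d2[OF power_series2_d1[OF ps]]] by (simp add: p)
qed

text \<open>The series is expanded around the point \<open>(x s, y s)\<close> itself. The two sums
  delivered by \<open>power_series2_chain\<close> are then, after the index shift, the series of
  \<open>d1 F\<close> and \<open>d2 F\<close> at their centre, and uniqueness of sums identifies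
  them.\<close>

lemma analytic2_on_chain:
  assumes "analytic2_on F \<Omega>" "open N" "x holomorphic_on N" "y holomorphic_on N" "s \<in> N" "(x s, y s) \<in> \<Omega>"
  shows "((\<lambda>s. F (x s, y s)) has_field_derivative
           d1 F (x s, y s) * deriv x s + d2 F (x s, y s) * deriv y s) (at s)"
proof -
  obtain c r where ps: "power_series2 c (x s) (y s) r F"
    using assms(1,6) unfolding analytic2_on_altdef by blast
  then have r: "r > 0" by (simp add: power_series2_def)
  obtain S1 S2 where S:
    "((\<lambda>(m, n). of_nat m * c m n * (x s - x s) ^ (m - 1) * (y s - y s) ^ n) has_sum S1) UNIV"
    "((\<lambda>(m, n). of_nat n * c m n * (x s - x s) ^ m * (y s - y s) ^ (n - 1)) has_sum S2) UNIV"
    "((\<lambda>s. F (x s, y s)) has_field_derivative S1 * deriv x s + S2 * deriv y s) (at s)"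
    by (rule power_series2_chain[OF ps assms(2-5)]) (use r in auto)
  have "(\<lambda>(m, n). of_nat (Suc m) * c (Suc m) n * (x s - x s) ^ m * (y s - y s) ^ n) =
        (\<lambda>(m, n). (\<lambda>(m, n). of_nat m * c m n * (x s - x s) ^ (m - 1) * (y s - y s) ^ n) (Suc m, n))"
    by simp
  then have "((\<lambda>(m, n). of_nat (Suc m) * c (Suc m) n * (x s - x s) ^ m * (y s - y s) ^ n) has_sum S1) UNIV"
    using has_sum_Suc_fst[OF S(1)] by simp
  moreover have "((\<lambda>(m, n). of_nat (Suc n) * c m (Suc n) * (x s - x s) ^ m * (y s - y s) ^ n) has_sum S2) UNIV"
    using has_sum_Suc_snd[OF S(2)] by simp
  moreover have "((\<lambda>(m, n). of_nat (Suc m) * c (Suc m) n * (x s - x s) ^ m * (y s - y s) ^ n) has_sum d1 F (x s, y s)) UNIV"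
    "((\<lambda>(m, n). of_nat (Suc n) * c m (Suc n) * (x s - x s) ^ m * (y s - y s) ^ n) has_sum d2 F (x s, y s)) UNIV"
    by (rule power_series2D[OF power_series2_d1[OF ps]] power_series2D[OF power_series2_d2[OF ps]]; use r in simp)+
  ultimately have "d1 F (x s, y s) = S1" "d2 F (x s, y s) = S2"
    by (blast intro: has_sum_unique)+
  then show ?thesis using S(3) by simp
qed

section \<open>The Laplace method at a saddle point\<close>

text \<open>For variance \<open>1 / (2 * l)\<close> the normal density is
  \<open>exp (- l * x^2)\<close> up to the factor \<open>sqrt (pi / l)\<close>, so the moments of
  the normal distribution apply.\<close>

lemma gaussian_moments:
  assumes "(l::real) > 0"
  shows "has_bochner_integral lborel (\<lambda>x. exp (- l * x\<^sup>2)) (sqrt (pi / l))"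
    and "has_bochner_integral lborel (\<lambda>x. x\<^sup>2 * exp (- l * x\<^sup>2)) (sqrt (pi / l) / (2 * l))"
proof -
  define \<sigma> where "\<sigma> = sqrt (1 / (2 * l))"
  have \<sigma>: "\<sigma> > 0" "\<sigma>\<^sup>2 = 1 / (2 * l)" using assms by (auto simp: \<sigma>_def)
  have nd: "normal_density 0 \<sigma> x = exp (- l * x\<^sup>2) / sqrt (pi / l)" for x
    using assms by (simp add: normal_density_def \<sigma> field_simps)
  have p: "sqrt (pi / l) > 0" using assms by simp
  have "has_bochner_integral lborel (\<lambda>x. sqrt (pi / l) * (normal_density 0 \<sigma> x * (x - 0) ^ (2 * 0)))
          (sqrt (pi / l) * (fact (2 * 0) / ((2 / \<sigma>\<^sup>2) ^ 0 * fact 0)))"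
    by (rule has_bochner_integral_mult_right) (rule normal_moment_even[OF \<sigma>(1)])
  then show "has_bochner_integral lborel (\<lambda>x. exp (- l * x\<^sup>2)) (sqrt (pi / l))"
    unfolding nd using p assms by simp
  have "has_bochner_integral lborel (\<lambda>x. sqrt (pi / l) * (normal_density 0 \<sigma> x * (x - 0) ^ (2 * 1)))
          (sqrt (pi / l) * (fact (2 * 1) / ((2 / \<sigma>\<^sup>2) ^ 1 * fact 1)))"
    by (rule has_bochner_integral_mult_right) (rule normal_moment_even[OF \<sigma>(1)])
  moreover have "sqrt (pi / l) * (fact (2 * 1) / ((2 / \<sigma>\<^sup>2) ^ 1 * fact 1)) = sqrt (pi / l) / (2 * l)"
    by (simp add: \<sigma>(2))
  moreover have "(\<lambda>x. sqrt (pi / l) * (normal_density 0 \<sigma> x * (x - 0) ^ (2 * 1))) = (\<lambda>x. x\<^sup>2 * exp (- l * x\<^sup>2))"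
    unfolding nd using p by (auto simp: fun_eq_iff)
  ultimately show "has_bochner_integral lborel (\<lambda>x. x\<^sup>2 * exp (- l * x\<^sup>2)) (sqrt (pi / l) / (2 * l))"
    by simp
qed

text \<open>The linear part of \<open>H\<close> integrates to zero by oddness on the symmetric
  interval. Both remaining errors are compared with the second moment: inside the interval through
  the quadratic remainder \<open>C\<close>, outside through \<open>1 \<le> x^2 / a^2\<close>, which
  accounts for the missing tails of the full Gaussian.\<close>

lemma laplace_real:
  fixes H :: "real \<Rightarrow> complex" and a l C :: real
  assumes a: "a > 0" and l: "l > 0" and cH: "continuous_on {-a..a} H"
    and H: "\<And>x. x \<in> {-a..a} \<Longrightarrow> norm (H x - H0 - H1 * of_real x) \<le> C * x\<^sup>2"
  shows "norm (integral {-a..a} (\<lambda>x. of_real (exp (- l * x\<^sup>2)) * H x) - H0 * of_real (sqrt (pi / l)))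
          \<le> (C + norm H0 / a\<^sup>2) * (sqrt (pi / l) / (2 * l))"
proof -
  let ?e = "\<lambda>x::real. exp (- l * x\<^sup>2)"
  have C0: "0 \<le> C" using order_trans[OF norm_ge_zero H[of a]] a by (simp add: zero_le_mult_iff)
  have odd: "((\<lambda>x. of_real (x * ?e x) :: complex) has_integral 0) {-a..a}"
  proof -
    have "((\<lambda>x. x * ?e x) has_integral (- ?e a / (2 * l) - (- ?e (-a) / (2 * l)))) {-a..a}"
      using a l
      by (intro fundamental_theorem_of_calculus)
         (auto intro!: derivative_eq_intros simp: has_real_derivative_iff_has_vector_derivative[symmetric] field_simps)
    then have "((\<lambda>x. x * ?e x) has_integral 0) {-a..a}" by simp
    from has_integral_of_real[OF this] show ?thesis by simp
  qed
  let ?f = "\<lambda>x. of_real (?e x) * (H x - H1 * of_real x)"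
  have cf: "continuous_on {-a..a} ?f" by (intro continuous_intros cH)
  have i1: "integral {-a..a} (\<lambda>x. of_real (?e x) * H x) = integral {-a..a} ?f"
  proof -
    have "(\<lambda>x. of_real (?e x) * H x) = (\<lambda>x. ?f x + H1 * of_real (x * ?e x))"
      by (auto simp: algebra_simps)
    moreover have "integral {-a..a} (\<lambda>x. ?f x + H1 * of_real (x * ?e x)) =
        integral {-a..a} ?f + integral {-a..a} (\<lambda>x. H1 * of_real (x * ?e x))"
      by (intro integral_add integrable_continuous_interval cf continuous_intros)
    moreover have "integral {-a..a} (\<lambda>x. H1 * of_real (x * ?e x)) = 0"
      using integral_unique[OF has_integral_mult_right[OF odd, of H1]] by (simp only: mult_zero_right)
    ultimately show ?thesis by simp
  qed
  have "set_integrable lborel {-a..a} ?f"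
    by (rule borel_integrable_atLeastAtMost'[OF cf])
  note si = this
  have i2: "integral {-a..a} ?f = (LINT x|lborel. indicator {-a..a} x *\<^sub>R ?f x)"
    using set_borel_integral_eq_integral(2)[OF si] by (simp add: set_lebesgue_integral_def)
  have hb: "has_bochner_integral lborel (\<lambda>x. H0 * complex_of_real (?e x)) (H0 * of_real (sqrt (pi / l)))"
    by (intro has_bochner_integral_mult_right has_bochner_integral_of_real gaussian_moments l)
  then have i3: "H0 * of_real (sqrt (pi / l)) = (LINT x|lborel. H0 * of_real (?e x))"
    and ig: "integrable lborel (\<lambda>x. H0 * of_real (?e x))"
    by (simp_all only: has_bochner_integral_iff)
  have ig2: "integrable lborel (\<lambda>x. (C + norm H0 / a\<^sup>2) * (x\<^sup>2 * ?e x))"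
    using gaussian_moments(2)[OF l] by (intro integrable_mult_right) (auto simp: has_bochner_integral_iff)
  have ii: "integrable lborel (\<lambda>x. indicator {-a..a} x *\<^sub>R ?f x - H0 * of_real (?e x))"
    using si ig unfolding set_integrable_def by (rule Bochner_Integration.integrable_diff)
  have eq: "integral {-a..a} ?f - H0 * of_real (sqrt (pi / l))
      = (LINT x|lborel. indicator {-a..a} x *\<^sub>R ?f x - H0 * of_real (?e x))"
    unfolding i2 i3 using si ig unfolding set_integrable_def by (rule Bochner_Integration.integral_diff[symmetric])
  have le: "norm (LINT x|lborel. indicator {-a..a} x *\<^sub>R ?f x - H0 * of_real (?e x)) \<le> (LINT x|lborel. (C + norm H0 / a\<^sup>2) * (x\<^sup>2 * ?e x))"
  proof (rule Bochner_Integration.integral_norm_bound_integral[OF ii ig2])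
    fix x :: real
    show "norm (indicator {-a..a} x *\<^sub>R ?f x - H0 * of_real (?e x)) \<le> (C + norm H0 / a\<^sup>2) * (x\<^sup>2 * ?e x)"
    proof (cases "x \<in> {-a..a}")
      case True
      have "norm (indicator {-a..a} x *\<^sub>R ?f x - H0 * of_real (?e x)) = norm (of_real (?e x) * (H x - H0 - H1 * of_real x))"
        using True by (simp add: algebra_simps)
      also have "\<dots> = ?e x * norm (H x - H0 - H1 * of_real x)"
        by (simp only: norm_mult norm_of_real) simp
      also have "\<dots> \<le> ?e x * (C * x\<^sup>2)"
        by (intro mult_left_mono H True) auto
      also have "\<dots> \<le> ?e x * ((C + norm H0 / a\<^sup>2) * x\<^sup>2)"
        by (intro mult_left_mono mult_right_mono) auto
      finally show ?thesis by (simp add: mult_ac)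
    next
      case False
      then have "a\<^sup>2 \<le> x\<^sup>2" using a abs_le_square_iff[of a x] by auto
      then have 1: "1 \<le> x\<^sup>2 / a\<^sup>2" using a by simp
      have "norm (indicator {-a..a} x *\<^sub>R ?f x - H0 * of_real (?e x)) = ?e x * norm H0"
        using False by (simp add: norm_mult)
      also have "\<dots> \<le> ?e x * (norm H0 * (x\<^sup>2 / a\<^sup>2))"
        using mult_left_mono[OF 1, of "norm H0"] by (intro mult_left_mono) auto
      also have "\<dots> \<le> ?e x * ((C + norm H0 / a\<^sup>2) * x\<^sup>2)"
        using C0 by (intro mult_left_mono) (auto simp: algebra_simps)
      finally show ?thesis by (simp add: mult_ac)
    qed
  qed
  have "(LINT x|lborel. (C + norm H0 / a\<^sup>2) * (x\<^sup>2 * ?e x)) = (C + norm H0 / a\<^sup>2) * (sqrt (pi / l) / (2 * l))"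
    by (intro has_bochner_integral_integral_eq has_bochner_integral_mult_right gaussian_moments l)
  then show ?thesis using le unfolding i1 eq by simp
qed

text \<open>From \<open>y^2 / 2 \<le> exp y\<close> and \<open>l * sqrt l \<le> l^2\<close>.
  Exponentially small contributions are put in the same form as the Laplace remainder so that they
  can simply be added to it.\<close>

lemma exp_le_inverse_3_2:
  assumes "\<delta> > 0" "l \<ge> 1"
  shows "exp (- l * \<delta>) \<le> (2 / \<delta>\<^sup>2) / (l * sqrt l)"
proof -
  have "(l * \<delta>)\<^sup>2 / 2 \<le> exp (l * \<delta>)"
    using exp_lower_Taylor_quadratic[of "l * \<delta>"] assms by (smt (verit) mult_pos_pos)
  then have "exp (- l * \<delta>) \<le> 2 / (l * \<delta>)\<^sup>2"
    using assms by (simp add: exp_minus field_simps)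
  also have "\<dots> = (2 / \<delta>\<^sup>2) / (l * l)" by (simp add: power_mult_distrib power2_eq_square)
  also have "\<dots> \<le> (2 / \<delta>\<^sup>2) / (l * sqrt l)"
    using assms sqrt_le_D real_sqrt_le_mono[of l "l\<^sup>2"] self_le_power[of l 2]
    by (intro divide_left_mono mult_left_mono mult_pos_pos) auto
  finally show ?thesis .
qed

text \<open>The sector between the rays of argument \<open>-pi/4\<close> and \<open>pi/4\<close>,
  that is, the right-hand component of \<open>Re (z^2) > 0\<close>. It is convex, so segments
  between its points stay inside.\<close>

definition valley :: "complex set" where
  "valley = {z. \<bar>Im z\<bar> < Re z}"

lemma convex_valley: "convex valley"
proof -
  have "valley = {z. Complex (-1) 1 \<bullet> z < 0} \<inter> {z. Complex (-1) (-1) \<bullet> z < 0}"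
    by (auto simp: valley_def inner_complex_def)
  then show ?thesis
    by (metis convex_Int convex_halfspace_lt)
qed

lemma valley_iff: "z \<in> valley \<longleftrightarrow> Re z > 0 \<and> Re (z\<^sup>2) > 0"
proof -
  have "Re (z\<^sup>2) = (Re z)\<^sup>2 - \<bar>Im z\<bar>\<^sup>2" by (simp add: power2_eq_square)
  moreover have "\<bar>Im z\<bar>\<^sup>2 < (Re z)\<^sup>2" if "\<bar>Im z\<bar> < Re z"
    using that by (intro power_strict_mono) auto
  moreover have "\<bar>Im z\<bar> < Re z" if "\<bar>Im z\<bar>\<^sup>2 < (Re z)\<^sup>2" "Re z > 0"
    by (rule power2_less_imp_less) (use that in auto)
  ultimately show ?thesis unfolding valley_def by auto
qed

text \<open>The Laplace method on the path \<open>zm \<rightarrow> -a \<rightarrow> a \<rightarrow> zp\<close>, whose outer legs stay in the valleys of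
  \<open>exp (-l z\<^sup>2)\<close>.\<close>

lemma laplace_local:
  assumes a: "0 < a" "a < r" and r: "r < R" and z: "norm zm < r" "norm zp < r" "zp \<in> valley" "- zm \<in> valley"
  obtains C where "\<forall>H l M. H holomorphic_on ball 0 R \<longrightarrow> (\<forall>z\<in>cball 0 r. norm (H z) \<le> M) \<longrightarrow> l \<ge> 1 \<longrightarrow>
     norm (contour_integral (linepath zm (- of_real a)) (\<lambda>z. exp (- of_real l * z\<^sup>2) * H z)
         + contour_integral (linepath (- of_real a) (of_real a)) (\<lambda>z. exp (- of_real l * z\<^sup>2) * H z)
         + contour_integral (linepath (of_real a) zp) (\<lambda>z. exp (- of_real l * z\<^sup>2) * H z)
         - H 0 * of_real (sqrt (pi / l))) \<le> C * M / (l * sqrt l)"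
proof -
  \<comment> \<open>\<open>Re (z^2)\<close> is positive on the sector and attains its minimum on a
    compact segment.\<close>
  have leg: "\<exists>\<delta>>0. \<forall>z\<in>closed_segment u v. Re (z\<^sup>2) \<ge> \<delta>" if "u \<in> valley" "v \<in> valley" for u v
  proof -
    have sub: "closed_segment u v \<subseteq> valley"
      using that convex_valley by (rule closed_segment_subset)
    have "continuous_on (closed_segment u v) (\<lambda>z. Re (z\<^sup>2))" by (intro continuous_intros)
    from continuous_attains_inf[OF compact_segment _ this]
    obtain w where "w \<in> closed_segment u v" "\<And>z. z \<in> closed_segment u v \<Longrightarrow> Re (w\<^sup>2) \<le> Re (z\<^sup>2)" by auto
    then show ?thesis using sub valley_iff by (intro exI[of _ "Re (w\<^sup>2)"]) auto
  qed
  have av: "of_real a \<in> valley" using a by (simp add: valley_def)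
  obtain \<delta>1 where \<delta>1: "\<delta>1 > 0" "\<And>z. z \<in> closed_segment (of_real a) zp \<Longrightarrow> Re (z\<^sup>2) \<ge> \<delta>1"
    using leg[OF av z(3)] by blast
  obtain \<delta>2 where \<delta>2: "\<delta>2 > 0" "\<And>z. z \<in> closed_segment (- zm) (of_real a) \<Longrightarrow> Re (z\<^sup>2) \<ge> \<delta>2"
    using leg[OF z(4) av] by blast
  \<comment> \<open>\<open>z^2\<close> is even, so the leg in the left valley is the reflection of
    one in the right valley.\<close>
  have \<delta>2': "Re (z\<^sup>2) \<ge> \<delta>2" if "z \<in> closed_segment zm (- of_real a)" for z
  proof -
    have "- z \<in> closed_segment (- zm) (of_real a)"
      using that by (auto simp: closed_segment_def algebra_simps) (metis add_diff_cancel_right' minus_diff_eq)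
    from \<delta>2(2)[OF this] show ?thesis by simp
  qed
  \<comment> \<open>Bounds for left leg, middle segment and right leg, each divided by
    \<open>M\<close>. In the middle summand, \<open>8 / (r - a)^2\<close> generously covers the
    bound \<open>2 / (r - a)^2\<close> that Cauchy's inequality gives for the second derivative, and
    \<open>1 / a^2\<close> belongs to the cut-off Gaussian tails.\<close>
  define C where "C = (2 / \<delta>2\<^sup>2) * norm (- of_real a - zm) + (4 / (r - a)\<^sup>2 * 2 + 1 / a\<^sup>2) * (sqrt pi / 2)
      + (2 / \<delta>1\<^sup>2) * norm (zp - of_real a)"
  show ?thesis
  proof (rule that[of C], intro allI impI)
    fix H :: "complex \<Rightarrow> complex" and l M :: real
    assume hol: "H holomorphic_on ball 0 R" and M': "\<forall>z\<in>cball 0 r. norm (H z) \<le> M" and l: "l \<ge> 1"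
    have M: "norm (H z) \<le> M" if "z \<in> cball 0 r" for z using M' that by blast
    let ?f = "\<lambda>z. exp (- of_real l * z\<^sup>2) * H z"
    have M0: "0 \<le> M" using order_trans[OF norm_ge_zero M[of 0]] a by simp
    have rR: "cball 0 r \<subseteq> ball 0 R" using r by auto
    have contH: "continuous_on (cball 0 r) H"
      using hol rR holomorphic_on_imp_continuous_on holomorphic_on_subset by blast
    have legb: "norm (contour_integral (linepath u v) ?f) \<le> (2 / \<delta>\<^sup>2) * norm (v - u) * M / (l * sqrt l)"
      if uv: "norm u < r" "norm v < r" and d: "\<delta> > 0" "\<And>z. z \<in> closed_segment u v \<Longrightarrow> Re (z\<^sup>2) \<ge> \<delta>" for u v \<delta>
    proof -
      have seg: "closed_segment u v \<subseteq> cball 0 r"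
        by (rule closed_segment_subset) (use uv in auto)
      have "norm (contour_integral (linepath u v) ?f) \<le> (exp (- l * \<delta>) * M) * norm (v - u)"
      proof (rule contour_integral_bound_linepath)
        show "?f contour_integrable_on linepath u v"
          by (intro contour_integrable_continuous_linepath continuous_intros continuous_on_subset[OF contH seg])
        show "0 \<le> exp (- l * \<delta>) * M" using M0 by simp
        fix z assume zz: "z \<in> closed_segment u v"
        have "norm (?f z) = exp (- l * Re (z\<^sup>2)) * norm (H z)"
          by (simp add: norm_mult)
        also have "\<dots> \<le> exp (- l * \<delta>) * M"
          using d(2)[OF zz] l M seg zz by (intro mult_mono) auto
        finally show "norm (?f z) \<le> exp (- l * \<delta>) * M" .
      qed
      also have "\<dots> \<le> ((2 / \<delta>\<^sup>2) / (l * sqrt l) * M) * norm (v - u)"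
        using exp_le_inverse_3_2[OF d(1) l] M0 by (intro mult_right_mono) auto
      finally show ?thesis by (simp add: mult_ac)
    qed
    have b1: "norm (contour_integral (linepath (of_real a) zp) ?f) \<le> (2 / \<delta>1\<^sup>2) * norm (zp - of_real a) * M / (l * sqrt l)"
      by (rule legb) (use a z \<delta>1 in auto)
    have b2: "norm (contour_integral (linepath zm (- of_real a)) ?f) \<le> (2 / \<delta>2\<^sup>2) * norm (- of_real a - zm) * M / (l * sqrt l)"
      by (rule legb) (use a z \<delta>2 \<delta>2' in auto)
    \<comment> \<open>Discs of radius \<open>r - a\<close> around points of \<open>cball 0 a\<close>
      remain in \<open>cball 0 r\<close>, where \<open>H\<close> is bounded by
      \<open>M\<close>.\<close>
    have d2: "norm (deriv (deriv H) w) \<le> 2 * M / (r - a)\<^sup>2" if w: "w \<in> cball 0 a" for w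
    proof -
      have sub: "cball w (r - a) \<subseteq> cball 0 r"
        using w by (auto simp: dist_norm) (smt (verit) norm_minus_commute norm_triangle_sub)
      have "norm ((deriv ^^ 2) H w) \<le> fact 2 * M / (r - a) ^ 2"
      proof (rule Cauchy_inequality)
        show "H holomorphic_on ball w (r - a)"
          using hol sub rR ball_subset_cball by (meson holomorphic_on_subset subset_trans)
        show "continuous_on (cball w (r - a)) H" using contH sub continuous_on_subset by blast
        show "\<And>x. norm (w - x) = r - a \<Longrightarrow> norm (H x) \<le> M"
          using M sub by (force simp: dist_norm)
      qed (use a in auto)
      then show ?thesis by (simp add: numeral_2_eq_2)
    qed
    have hR: "H holomorphic_on ball 0 R" "deriv H holomorphic_on ball 0 R"
      using hol by (auto intro: holomorphic_deriv)
    have taylor: "norm (H (of_real x) - H 0 - deriv H 0 * of_real x) \<le> (2 * M / (r - a)\<^sup>2) * x\<^sup>2" if x: "x \<in> {-a..a}" for x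
    proof -
      let ?d = "\<lambda>i::nat. if i = 0 then H else if i = 1 then deriv H else deriv (deriv H)"
      have "norm (?d 0 (of_real x) - (\<Sum>i\<le>1. ?d i 0 * (of_real x - 0) ^ i / fact i))
          \<le> (2 * M / (r - a)\<^sup>2) * norm (of_real x - 0 :: complex) ^ Suc 1 / fact 1"
      proof (rule complex_Taylor[where S = "cball 0 a"])
        fix i and w :: complex assume w: "w \<in> cball 0 a" and i: "i \<le> (1::nat)"
        have "w \<in> ball 0 R" using w a r by auto
        then have "(H has_field_derivative deriv H w) (at w)" "(deriv H has_field_derivative deriv (deriv H) w) (at w)"
          using hR by (auto intro: holomorphic_derivI)
        then show "(?d i has_field_derivative ?d (Suc i) w) (at w within cball 0 a)"
          using i by (cases "i = 0") (auto intro: has_field_derivative_at_within)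
      qed (use d2 x a in \<open>auto simp: abs_le_iff\<close>)
      then show ?thesis by (simp add: power2_eq_square diff_diff_eq)
    qed
    have b3: "norm (contour_integral (linepath (- of_real a) (of_real a)) ?f - H 0 * of_real (sqrt (pi / l)))
        \<le> (2 * M / (r - a)\<^sup>2 + norm (H 0) / a\<^sup>2) * (sqrt (pi / l) / (2 * l))"
    proof -
      have "contour_integral (linepath (- of_real a) (of_real a)) ?f = integral {-a..a} (\<lambda>x. ?f (of_real x))"
        using a by (subst contour_integral_linepath_Reals_eq) auto
      also have "(\<lambda>x. ?f (of_real x)) = (\<lambda>x. of_real (exp (- l * x\<^sup>2)) * H (of_real x))"
        by (auto simp: exp_of_real[symmetric])
      moreover have "continuous_on {-a..a} (\<lambda>x. H (complex_of_real x))"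
        by (rule continuous_on_compose2[OF contH]) (use a in \<open>auto intro!: continuous_intros\<close>)
      ultimately show ?thesis
        using laplace_real[where H="\<lambda>x. H (of_real x)" and a=a and l=l, OF a(1) _ _ taylor] l by simp
    qed
    also have "(2 * M / (r - a)\<^sup>2 + norm (H 0) / a\<^sup>2) * (sqrt (pi / l) / (2 * l))
        \<le> (4 / (r - a)\<^sup>2 * 2 * M + M / a\<^sup>2) * (sqrt (pi / l) / (2 * l))"
      using M[of 0] a M0 l
      by (intro mult_right_mono add_mono divide_right_mono) (auto simp: field_simps)
    also have "\<dots> = (4 / (r - a)\<^sup>2 * 2 + 1 / a\<^sup>2) * (sqrt pi / 2) * M / (l * sqrt l)"
      using l by (simp add: real_sqrt_divide field_simps)
    finally have b3: "norm (contour_integral (linepath (- of_real a) (of_real a)) ?f - H 0 * of_real (sqrt (pi / l)))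
        \<le> (4 / (r - a)\<^sup>2 * 2 + 1 / a\<^sup>2) * (sqrt pi / 2) * M / (l * sqrt l)" .
    let ?A = "contour_integral (linepath zm (- of_real a)) ?f" and ?B = "contour_integral (linepath (- of_real a) (of_real a)) ?f"
      and ?D = "contour_integral (linepath (of_real a) zp) ?f"
    have "norm (?A + ?B + ?D - H 0 * of_real (sqrt (pi / l))) = norm (?A + (?B - H 0 * of_real (sqrt (pi / l))) + ?D)"
      by (simp add: algebra_simps)
    also have "\<dots> \<le> norm ?A + norm (?B - H 0 * of_real (sqrt (pi / l))) + norm ?D"
      by (rule norm_triangle_le[OF add_mono[OF norm_triangle_ineq]]) simp
    also have "\<dots> \<le> C * M / (l * sqrt l)"
      using add_mono[OF add_mono[OF b2 b3] b1]
      by (simp add: C_def add_divide_distrib distrib_right)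
    finally show "norm (?A + ?B + ?D - H 0 * of_real (sqrt (pi / l))) \<le> C * M / (l * sqrt l)" .
  qed
qed

text \<open>A holomorphic square root of \<open>g t0 - g t\<close> straightens the saddle to \<open>z \<mapsto> z\<^sup>2\<close>; its sign is
  chosen so that the outgoing direction is mapped into the right half plane.\<close>

lemma saddle_coordinate:
  assumes "open T" "g holomorphic_on T" "t0 \<in> T" "deriv g t0 = 0" "deriv (deriv g) t0 \<noteq> 0"
    and A: "is_Arg (- deriv (deriv g) t0) \<omega>0"
  obtains G r where "r > 0" "ball t0 r \<subseteq> T" "G holomorphic_on ball t0 r"
    "\<And>t. t \<in> ball t0 r \<Longrightarrow> g t - g t0 = - ((t - t0) * G t)\<^sup>2"
    "G t0 = of_real (sqrt (norm (deriv (deriv g) t0) / 2)) * cis (\<omega>0 / 2)"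
proof -
  have d1: "(deriv ^^ 1) (\<lambda>t. - g t) t0 = 0" if "0 < i" "i < 2" for i :: nat
    using assms by (simp add: holomorphic_on_imp_differentiable_at)
  have ev: "\<forall>\<^sub>F t in nhds t0. deriv (\<lambda>t. - g t) t = - deriv g t"
    using assms(1,3) by (intro eventually_nhds_in_open[THEN eventually_mono])
      (use assms(1,2) in \<open>auto simp: holomorphic_on_imp_differentiable_at\<close>)
  have dd: "deriv (deriv (\<lambda>t. - g t)) t0 = - deriv (deriv g) t0"
    using deriv_cong_ev[OF ev refl] holomorphic_deriv[OF assms(2,1)] assms(1,3)
    by (simp add: holomorphic_on_imp_differentiable_at)
  \<comment> \<open>A zero of order two of \<open>g t0 - g\<close> is locally the square of a
    holomorphic function with a simple zero.\<close>
  obtain G0 r0 where G0: "0 < r0" "G0 holomorphic_on ball t0 r0"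
    "\<And>w. w \<in> ball t0 r0 \<Longrightarrow> - g w - - g t0 = ((w - t0) * G0 w) ^ 2"
  proof (rule holomorphic_factor_order_of_zero_strong[of "\<lambda>t. - g t" T t0 2])
    show "(\<lambda>t. - g t) holomorphic_on T" using assms by (intro holomorphic_intros)
    show "(deriv ^^ 2) (\<lambda>t. - g t) t0 \<noteq> 0" using dd assms by (simp add: numeral_2_eq_2)
    show "(deriv ^^ i) (\<lambda>t. - g t) t0 = 0" if "0 < i" "i < 2" for i
      using d1[OF that] that by (cases "i = 1") auto
  qed (use assms in auto)
  obtain r1 where r1: "r1 > 0" "ball t0 r1 \<subseteq> T" using assms(1,3) by (meson open_contains_ball)
  define r where "r = min r0 r1"
  have r: "r > 0" "ball t0 r \<subseteq> T" "ball t0 r \<subseteq> ball t0 r0" using G0(1) r1 by (auto simp: r_def)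
  have hG: "G0 holomorphic_on ball t0 r" using G0(2) r(3) by (rule holomorphic_on_subset)
  have geq: "g t - g t0 = - ((t - t0) * G0 t)\<^sup>2" if "t \<in> ball t0 r" for t
    using G0(3)[of t] that r(3) by (simp add: subset_iff) (metis add.commute diff_add_cancel minus_diff_eq uminus_add_conv_diff)
  define \<phi> where "\<phi> t = (t - t0) * G0 t" for t
  have geq': "g t = g t0 - (\<phi> t)\<^sup>2" if "t \<in> ball t0 r" for t
    using geq[OF that] by (simp add: \<phi>_def diff_eq_eq)
  have h\<phi>: "\<phi> holomorphic_on ball t0 r" unfolding \<phi>_def by (intro holomorphic_intros hG)
  have d\<phi>: "(\<phi> has_field_derivative deriv \<phi> t) (at t)" if "t \<in> ball t0 r" for t
    using holomorphic_derivI[OF h\<phi> _ that] by simp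
  have dG: "(G0 has_field_derivative deriv G0 t0) (at t0)"
    using holomorphic_derivI[OF hG] r by simp
  have d0: "deriv \<phi> t0 = G0 t0"
    unfolding \<phi>_def by (rule DERIV_imp_deriv) (auto intro!: derivative_eq_intros dG)
  have dg: "deriv g t = - 2 * \<phi> t * deriv \<phi> t" if t: "t \<in> ball t0 r" for t
  proof -
    have "((\<lambda>t. g t0 - (\<phi> t)\<^sup>2) has_field_derivative - 2 * \<phi> t * deriv \<phi> t) (at t)"
      by (auto intro!: derivative_eq_intros d\<phi>[OF t] simp: algebra_simps)
    then have "(g has_field_derivative - 2 * \<phi> t * deriv \<phi> t) (at t)"
      by (rule has_field_derivative_transform_within_open[OF _ _ t]) (use geq' in auto)
    then show ?thesis by (rule DERIV_imp_deriv)
  qed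
  have "deriv (deriv g) t0 = - 2 * (G0 t0)\<^sup>2"
  proof -
    have "(deriv \<phi> has_field_derivative deriv (deriv \<phi>) t0) (at t0)"
      using r by (intro holomorphic_derivI[OF holomorphic_deriv[OF h\<phi>]]) auto
    then have "((\<lambda>t. - 2 * \<phi> t * deriv \<phi> t) has_field_derivative - 2 * (G0 t0)\<^sup>2) (at t0)"
      using r by (auto intro!: derivative_eq_intros d\<phi> simp: d0 power2_eq_square \<phi>_def[of t0])
    then have "(deriv g has_field_derivative - 2 * (G0 t0)\<^sup>2) (at t0)"
      by (rule has_field_derivative_transform_within_open[of _ _ _ "ball t0 r"]) (use r in \<open>auto simp: dg\<close>)
    then show ?thesis by (rule DERIV_imp_deriv)
  qed
  then have G2: "(G0 t0)\<^sup>2 = - deriv (deriv g) t0 / 2" by simp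
  \<comment> \<open>The value prescribed by the branch \<open>\<omega>0\<close>. Its square agrees
    with that of \<open>G0 t0\<close>, so the two differ at most in sign, and the sign of
    \<open>G0\<close> can be flipped.\<close>
  define B where "B = of_real (sqrt (norm (deriv (deriv g) t0) / 2)) * cis (\<omega>0 / 2)"
  have "B\<^sup>2 = of_real (norm (deriv (deriv g) t0) / 2) * cis \<omega>0"
    unfolding B_def power_mult_distrib of_real_power[symmetric] by (simp add: Complex.DeMoivre)
  also have "\<dots> = - deriv (deriv g) t0 / 2"
    using A by (simp add: is_Arg_def cis_conv_exp)
  finally have "(G0 t0)\<^sup>2 = B\<^sup>2" using G2 by simp
  then consider "G0 t0 = B" | "- G0 t0 = B" by (auto simp: power2_eq_iff)
  then show ?thesis
  proof cases
    case 1
    show ?thesis using that[OF r(1,2) hG geq] 1 by (simp add: B_def)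
  next
    case 2
    show ?thesis using that[of r "\<lambda>t. - G0 t", OF r(1,2)] hG geq 2
      by (auto intro!: holomorphic_intros simp: B_def)
  qed
qed

text \<open>A closed neighbourhood of the path image is compact and still lies in \<open>T\<close>.
  Since \<open>K\<close> and \<open>L\<close> are chosen before \<open>f\<close>, the estimate is
  uniform over a whole family of integrands.\<close>

lemma holomorphic_bound_near_path:
  assumes "open T" "valid_path p" "path_image p \<subseteq> T"
  obtains K L where "compact K" "K \<subseteq> T" "L > 0"
    "\<forall>f B. f holomorphic_on T \<longrightarrow> (\<forall>z\<in>K. norm (f z) \<le> B) \<longrightarrow> norm (contour_integral p f) \<le> L * B"
proof -
  have cp: "compact (path_image p)" "path_image p \<noteq> {}"
    using assms(2) by (auto simp: valid_path_imp_path compact_path_image)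
  obtain e where e: "e > 0" "{x. infdist x (path_image p) \<le> e} \<subseteq> T"
    using compact_in_open_separated[OF cp(2,1) assms(1,3)] by blast
  let ?K = "{x. infdist x (path_image p) \<le> e}" and ?S = "{x. infdist x (path_image p) < e}"
  have oS: "open ?S"
    by (intro open_Collect_less continuous_intros)
  have pS: "path_image p \<subseteq> ?S" using e by auto
  obtain L where L: "L > 0" "\<And>f B. f holomorphic_on ?S \<Longrightarrow> (\<forall>z\<in>?S. norm (f z) \<le> B) \<Longrightarrow> norm (contour_integral p f) \<le> L * B"
    using contour_integral_bound_exists[OF oS assms(2) pS] by blast
  show ?thesis
  proof (rule that[of ?K L], goal_cases)
    case 1
    show ?case using compact_infdist_le[OF cp(2,1) e(1)] .
  next
    case 4
    show ?case
    proof (intro allI impI)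
    fix f B assume f: "f holomorphic_on T" "\<forall>z\<in>?K. norm (f z) \<le> B"
    have "?S \<subseteq> T" using e(2) by (auto intro: less_imp_le)
    then have "f holomorphic_on ?S" using f(1) holomorphic_on_subset by blast
    then show "norm (contour_integral p f) \<le> L * B" using L(2) f(2) by simp
    qed
  qed (use e L in auto)
qed

text \<open>Applying the preceding bound inside the open set where \<open>Re g < a\<close> yields a
  compact set, on which \<open>Re g\<close> stays below \<open>a\<close> by some
  \<open>\<delta> > 0\<close>. The point \<open>b\<close> enters only through its real part, because
  only the modulus of the exponential matters.\<close>

lemma exp_small_on_path:
  assumes "open T" "g holomorphic_on T" "valid_path p" "path_image p \<subseteq> T" "\<forall>t\<in>path_image p. Re (g t) < a"
    and fam: "\<forall>h\<in>\<H>. h holomorphic_on T"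
    and bdd: "\<forall>K. compact K \<longrightarrow> K \<subseteq> T \<longrightarrow> (\<exists>M. \<forall>h\<in>\<H>. \<forall>t\<in>K. norm (h t) \<le> M)"
  obtains C where "\<forall>h l b. h \<in> \<H> \<longrightarrow> l \<ge> 1 \<longrightarrow> Re b = a \<longrightarrow>
    norm (contour_integral p (\<lambda>t. exp (of_real l * (g t - b)) * h t)) \<le> C / (l * sqrt l)"
proof -
  let ?T = "T \<inter> (\<lambda>t. Re (g t)) -` {..<a}"
  have oT: "open ?T"
    using assms(1,2) by (intro continuous_open_preimage continuous_intros holomorphic_on_imp_continuous_on) auto
  obtain K L where KL: "compact K" "K \<subseteq> ?T" "L > 0"
    "\<forall>f B. f holomorphic_on ?T \<longrightarrow> (\<forall>z\<in>K. norm (f z) \<le> B) \<longrightarrow> norm (contour_integral p f) \<le> L * B"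
  proof (rule holomorphic_bound_near_path[OF oT assms(3)])
    show "path_image p \<subseteq> ?T" using assms(4,5) by auto
  qed (rule that)
  obtain M where M: "\<And>h t. h \<in> \<H> \<Longrightarrow> t \<in> K \<Longrightarrow> norm (h t) \<le> M"
    using bdd KL(1,2) by (meson Int_subset_iff)
  obtain \<delta> where \<delta>: "\<delta> > 0" "\<And>t. t \<in> K \<Longrightarrow> Re (g t) \<le> a - \<delta>"
  proof (cases "K = {}")
    case True
    then show ?thesis using that[of 1] by simp
  next
    case False
    have "continuous_on K (\<lambda>t. Re (g t))"
      using assms(2) KL(2) by (intro continuous_intros holomorphic_on_imp_continuous_on) (auto intro: holomorphic_on_subset)
    from continuous_attains_sup[OF KL(1) False this] obtain w where w: "w \<in> K" "\<And>t. t \<in> K \<Longrightarrow> Re (g t) \<le> Re (g w)" by blast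
    then show ?thesis using KL(2) by (intro that[of "a - Re (g w)"]) auto
  qed
  show ?thesis
  proof (rule that[of "L * (2 / \<delta>\<^sup>2) * \<bar>M\<bar>"], intro allI impI)
    fix h l b assume h: "h \<in> \<H>" and l: "l \<ge> (1::real)" and b: "Re b = a"
    have "norm (contour_integral p (\<lambda>t. exp (of_real l * (g t - b)) * h t)) \<le> L * (exp (- l * \<delta>) * \<bar>M\<bar>)"
    proof (rule KL(4)[rule_format])
      show "(\<lambda>t. exp (of_real l * (g t - b)) * h t) holomorphic_on ?T"
        using assms(2) fam[rule_format, OF h] by (intro holomorphic_intros) (auto intro: holomorphic_on_subset)
      fix z assume z: "z \<in> K"
      have "norm (exp (of_real l * (g z - b))) = exp (l * (Re (g z) - a))" using b by simp
      also have "\<dots> \<le> exp (- l * \<delta>)"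
        using mult_left_mono[OF \<delta>(2)[OF z], of l] l by (simp add: algebra_simps)
      finally show "norm (exp (of_real l * (g z - b)) * h z) \<le> exp (- l * \<delta>) * \<bar>M\<bar>"
        using M[OF h z] by (simp only: norm_mult) (intro mult_mono, auto)
    qed
    also have "\<dots> \<le> L * ((2 / \<delta>\<^sup>2) / (l * sqrt l) * \<bar>M\<bar>)"
      using exp_le_inverse_3_2[OF \<delta>(1) l] KL(3) by (intro mult_left_mono mult_right_mono) auto
    finally show "norm (contour_integral p (\<lambda>t. exp (of_real l * (g t - b)) * h t)) \<le> L * (2 / \<delta>\<^sup>2) * \<bar>M\<bar> / (l * sqrt l)"
      by (simp add: mult_ac)
  qed
qed

text \<open>On the convex set \<open>U\<close> there is a primitive of \<open>f\<close>, and
  composing it with \<open>\<psi>\<close> gives one on \<open>V\<close>. Both sides are therefore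
  the same difference of end values; apart from its end points, \<open>p\<close> need not follow the
  image of the polygon.\<close>

lemma contour_integral_change_primitive:
  assumes "convex U" "open U" "f holomorphic_on U" "open V" "\<psi> holomorphic_on V" "\<psi> ` V \<subseteq> U"
    and "valid_path p" "path_image p \<subseteq> U" "pathstart p = \<psi> z0" "pathfinish p = \<psi> z3"
    and seg: "closed_segment z0 z1 \<subseteq> V" "closed_segment z1 z2 \<subseteq> V" "closed_segment z2 z3 \<subseteq> V"
  shows "contour_integral p f =
      contour_integral (linepath z0 z1) (\<lambda>z. f (\<psi> z) * deriv \<psi> z)
    + contour_integral (linepath z1 z2) (\<lambda>z. f (\<psi> z) * deriv \<psi> z)
    + contour_integral (linepath z2 z3) (\<lambda>z. f (\<psi> z) * deriv \<psi> z)"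
proof -
  obtain Q where Q: "\<And>x. x \<in> U \<Longrightarrow> (Q has_field_derivative f x) (at x within U)"
    using holomorphic_convex_primitive'[OF assms(1-3)] by blast
  have 1: "contour_integral p f = Q (\<psi> z3) - Q (\<psi> z0)"
    using contour_integral_unique[OF contour_integral_primitive[OF Q assms(7,8)]] assms(9,10) by simp
  have Q\<psi>: "((\<lambda>z. Q (\<psi> z)) has_field_derivative f (\<psi> z) * deriv \<psi> z) (at z within V)" if z: "z \<in> V" for z
  proof -
    have "(Q has_field_derivative f (\<psi> z)) (at (\<psi> z))"
      using Q[of "\<psi> z"] z assms(2,6) at_within_open[of "\<psi> z" U] by auto
    moreover have "(\<psi> has_field_derivative deriv \<psi> z) (at z)"
      by (rule holomorphic_derivI[OF assms(5,4) z])
    ultimately have "((\<lambda>z. Q (\<psi> z)) has_field_derivative f (\<psi> z) * deriv \<psi> z) (at z)"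
      by (rule DERIV_chain2)
    then show ?thesis by (rule has_field_derivative_at_within)
  qed
  have "contour_integral (linepath u v) (\<lambda>z. f (\<psi> z) * deriv \<psi> z) = Q (\<psi> v) - Q (\<psi> u)"
    if "closed_segment u v \<subseteq> V" for u v
    using contour_integral_unique[OF contour_integral_primitive[OF Q\<psi>, of "linepath u v"]] that by simp
  then show ?thesis using 1 seg by simp
qed

text \<open>\<open>\<H>\<close> is a locally bounded family: the amplitude in the application depends on the large parameter.\<close>

theorem saddle_point_asymptotics:
  assumes "open T" "g holomorphic_on T" "t0 \<in> T" "deriv g t0 = 0" "deriv (deriv g) t0 \<noteq> 0"
    and c: "valid_path c" "path_image c \<subseteq> T" "passes_through c t0 (deriv (deriv g) t0) \<omega> \<omega>0"
    and below: "\<forall>t\<in>path_image c - {t0}. Re (g t) < Re (g t0)"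
    and fam: "\<forall>h\<in>\<H>. h holomorphic_on T"
    and bdd: "\<forall>K. compact K \<longrightarrow> K \<subseteq> T \<longrightarrow> (\<exists>M. \<forall>h\<in>\<H>. \<forall>t\<in>K. norm (h t) \<le> M)"
  obtains C where "\<forall>h\<in>\<H>. \<forall>l\<ge>1.
    norm (contour_integral c (\<lambda>t. exp (of_real l * (g t - g t0)) * h t)
          - branch_sqrt (deriv (deriv g) t0) \<omega>0 * h t0 / of_real (sqrt l)) \<le> C / (l * sqrt l)"
proof -
  let ?g2 = "deriv (deriv g) t0"
  from c(3) obtain s0 \<omega>' where A: "is_Arg (- ?g2) \<omega>0" and w: "\<bar>\<omega>0 + 2 * \<omega>\<bar> \<le> pi / 2"
    and s0: "0 < s0" "s0 < 1" "\<And>s. s \<in> {0..1} \<Longrightarrow> c s = t0 \<longleftrightarrow> s = s0"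
    and limr: "((\<lambda>s. sgn (c s - t0)) \<longlongrightarrow> cis \<omega>) (at_right s0)"
    and liml: "((\<lambda>s. sgn (t0 - c s)) \<longlongrightarrow> cis \<omega>') (at_left s0)" and w': "\<bar>\<omega>0 + 2 * \<omega>'\<bar> \<le> pi / 2"
    unfolding passes_through_def by blast
  obtain G r0 where r0: "r0 > 0" "ball t0 r0 \<subseteq> T" and hG: "G holomorphic_on ball t0 r0"
    and geq: "\<And>t. t \<in> ball t0 r0 \<Longrightarrow> g t - g t0 = - ((t - t0) * G t)\<^sup>2"
    and G0: "G t0 = of_real (sqrt (norm ?g2 / 2)) * cis (\<omega>0 / 2)"
    by (rule saddle_coordinate[OF assms(1-5) A]) (rule that)
  have G0nz: "G t0 \<noteq> 0" using assms(5) by (simp add: G0)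
  \<comment> \<open>The straightening coordinate: \<open>g t = g t0 - (\<phi> t)^2\<close> near
    \<open>t0\<close>. Since \<open>deriv \<phi> t0 = G t0 \<noteq> 0\<close> it has a local inverse
    \<open>\<psi>\<close>, in which the integral is computed.\<close>
  define \<phi> where "\<phi> t = (t - t0) * G t" for t
  have h\<phi>: "\<phi> holomorphic_on ball t0 r0" unfolding \<phi>_def by (intro holomorphic_intros hG)
  have dG: "(G has_field_derivative deriv G t0) (at t0)"
    using holomorphic_derivI[OF hG] r0 by simp
  have d\<phi>: "deriv \<phi> t0 = G t0"
    unfolding \<phi>_def by (rule DERIV_imp_deriv) (auto intro!: derivative_eq_intros dG)
  obtain r where r: "r > 0" "ball t0 r \<subseteq> ball t0 r0" "inj_on \<phi> (ball t0 r)"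
    using has_complex_derivative_locally_injective[OF h\<phi>, of t0] r0 d\<phi> G0nz by auto
  have h\<phi>r: "\<phi> holomorphic_on ball t0 r" using h\<phi> r(2) by (rule holomorphic_on_subset)
  have rT: "ball t0 r \<subseteq> T" using r r0 by auto
  obtain \<psi> where \<psi>: "\<psi> holomorphic_on (\<phi> ` ball t0 r)" "\<And>z. z \<in> ball t0 r \<Longrightarrow> deriv \<phi> z * deriv \<psi> (\<phi> z) = 1"
     "\<And>z. z \<in> ball t0 r \<Longrightarrow> \<psi> (\<phi> z) = z"
    using holomorphic_has_inverse[OF h\<phi>r open_ball r(3)] by blast
  have o\<phi>: "open (\<phi> ` ball t0 r)" by (rule open_mapping_thm3[OF h\<phi>r open_ball r(3)])
  have "0 \<in> \<phi> ` ball t0 r" using r(1) by (intro image_eqI[of _ _ t0]) (auto simp: \<phi>_def)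
  then obtain R where R: "R > 0" "ball 0 R \<subseteq> \<phi> ` ball t0 r"
    using o\<phi> by (meson open_contains_ball)
  have \<psi>b: "\<psi> z \<in> ball t0 r" "\<phi> (\<psi> z) = z" if "z \<in> ball 0 R" for z
    using that R(2) \<psi>(3) by auto
  have h\<psi>: "\<psi> holomorphic_on ball 0 R" using \<psi>(1) R(2) by (rule holomorphic_on_subset)
  have \<psi>0: "\<psi> 0 = t0" using \<psi>(3)[of t0] r(1) by (simp add: \<phi>_def)
  have d\<psi>0: "deriv \<psi> 0 = 1 / G t0"
    using \<psi>(2)[of t0] r(1) d\<phi> G0nz by (simp add: \<phi>_def field_simps)
  define U where "U = ball t0 r \<inter> \<phi> -` ball 0 R"
  have oU: "open U" unfolding U_def
    using h\<phi>r by (intro continuous_open_preimage holomorphic_on_imp_continuous_on) auto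
  have t0U: "t0 \<in> U" using r(1) R(1) by (simp add: U_def \<phi>_def)
  have cs0: "c s0 = t0" using s0 by simp
  have cc: "(c \<longlongrightarrow> t0) (at s0)"
  proof -
    have "continuous_on {0<..<1} c"
      using valid_path_imp_path[OF c(1)] unfolding path_def by (rule continuous_on_subset) auto
    then show ?thesis using s0(1,2) cs0 by (auto simp: continuous_on_eq_continuous_at isCont_def)
  qed
  have inU: "\<forall>\<^sub>F s in at s0. c s \<in> U" by (rule topological_tendstoD[OF cc oU t0U])
  have inU_r: "\<forall>\<^sub>F s in at_right s0. c s \<in> U" and inU_l: "\<forall>\<^sub>F s in at_left s0. c s \<in> U"
    using inU by (auto simp: eventually_at_split)
  have GtT: "((\<lambda>s. G (c s)) \<longlongrightarrow> G t0) F" if "F \<le> at s0" for F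
    using dG that cc by (intro isCont_tendsto_compose[of t0 G] DERIV_isCont[of G]) (auto intro: tendsto_mono)
  have sG: "sgn (G t0) = cis (\<omega>0 / 2)"
    using assms(5) by (simp add: G0 sgn_mult sgn_of_real del: real_sqrt_divide)
  have pos: "Re (cis \<alpha> * cis (\<omega>0 / 2)) > 0" if "\<bar>\<omega>0 + 2 * \<alpha>\<bar> \<le> pi / 2" for \<alpha>
  proof -
    have "cos (\<alpha> + \<omega>0 / 2) > 0"
      using that pi_gt_zero unfolding abs_le_iff
      by (intro cos_gt_zero_pi) linarith+
    then show ?thesis by (simp add: cis_mult)
  qed
  have Re_sgn: "Re (sgn z) > 0 \<Longrightarrow> Re z > 0" for z
    by (auto simp: sgn_eq zero_less_divide_iff)
  have right: "\<forall>\<^sub>F s in at_right s0. Re (\<phi> (c s)) > 0"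
  proof -
    have "((\<lambda>s. Re (sgn (c s - t0) * sgn (G (c s)))) \<longlongrightarrow> Re (cis \<omega> * cis (\<omega>0 / 2))) (at_right s0)"
      unfolding sG[symmetric] by (intro tendsto_intros limr GtT G0nz at_le) auto
    from order_tendstoD(1)[OF this pos[OF w]] show ?thesis
    proof eventually_elim
      case (elim s)
      then show ?case unfolding \<phi>_def by (metis Re_sgn sgn_mult)
    qed
  qed
  have left: "\<forall>\<^sub>F s in at_left s0. Re (- \<phi> (c s)) > 0"
  proof -
    have "((\<lambda>s. Re (sgn (t0 - c s) * sgn (G (c s)))) \<longlongrightarrow> Re (cis \<omega>' * cis (\<omega>0 / 2))) (at_left s0)"
      unfolding sG[symmetric] by (intro tendsto_intros liml GtT G0nz at_le) auto
    from order_tendstoD(1)[OF this pos[OF w']] show ?thesis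
    proof eventually_elim
      case (elim s)
      have "- \<phi> (c s) = (t0 - c s) * G (c s)" by (simp add: \<phi>_def algebra_simps)
      then show ?case using elim by (metis Re_sgn sgn_mult)
    qed
  qed
  obtain b where b: "b > s0" "\<And>s. s0 < s \<Longrightarrow> s < b \<Longrightarrow> Re (\<phi> (c s)) > 0 \<and> c s \<in> U"
    using eventually_conj[OF right inU_r] s0(2) unfolding eventually_at_right_field by blast
  obtain b' where b': "b' < s0" "\<And>s. b' < s \<Longrightarrow> s < s0 \<Longrightarrow> Re (- \<phi> (c s)) > 0 \<and> c s \<in> U"
    using eventually_conj[OF left inU_l] s0(1) unfolding eventually_at_left_field by blast
  \<comment> \<open>The cut points are so close to \<open>s0\<close> that the piece between them
    stays in \<open>U\<close> and its ends are mapped into opposite valleys.\<close>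
  obtain sp where sp: "s0 < sp" "sp < b" "sp < 1" using dense[of s0 "min b 1"] b(1) s0(2) by auto
  obtain sm where sm: "sm < s0" "b' < sm" "0 < sm" using dense[of "max b' 0" s0] b'(1) s0(1) by auto
  have midU: "c s \<in> U" if "s \<in> {sm..sp}" for s
    using b(2)[of s] b'(2)[of s] that sp sm cs0 t0U by (cases s s0 rule: linorder_cases) auto
  have \<phi>2: "Re ((\<phi> (c s))\<^sup>2) > 0" if "s \<in> {0..1}" "s \<noteq> s0" "c s \<in> U" for s
  proof -
    have "c s \<in> path_image c - {t0}" using that s0(3) by (auto simp: path_image_def)
    then have "Re (g (c s) - g t0) < 0" using below by simp
    moreover have "g (c s) - g t0 = - (\<phi> (c s))\<^sup>2"
      using geq[of "c s"] that(3) r(2) by (auto simp: \<phi>_def U_def subset_iff)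
    ultimately show ?thesis by simp
  qed
  define zp where "zp = \<phi> (c sp)"
  define zm where "zm = \<phi> (c sm)"
  have zp: "zp \<in> valley" "zp \<in> ball 0 R"
    using b(2)[of sp] sp s0 \<phi>2[of sp] by (auto simp: zp_def valley_iff U_def)
  have zm: "- zm \<in> valley" "zm \<in> ball 0 R"
    using b'(2)[of sm] sm s0 \<phi>2[of sm] by (auto simp: zm_def valley_iff U_def)
  obtain r' where r': "norm zp < r'" "norm zm < r'" "r' < R"
    using dense[of "max (norm zp) (norm zm)" R] zp zm by auto
  have r'0: "0 < r'" using r'(1) norm_ge_zero[of zp] by linarith
  obtain a where a: "0 < a" "a < r'" using dense[OF r'0] by blast
  obtain C0 where C0: "\<forall>H l M. H holomorphic_on ball 0 R \<longrightarrow> (\<forall>z\<in>cball 0 r'. norm (H z) \<le> M) \<longrightarrow> l \<ge> 1 \<longrightarrow>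
     norm (contour_integral (linepath zm (- of_real a)) (\<lambda>z. exp (- of_real l * z\<^sup>2) * H z)
         + contour_integral (linepath (- of_real a) (of_real a)) (\<lambda>z. exp (- of_real l * z\<^sup>2) * H z)
         + contour_integral (linepath (of_real a) zp) (\<lambda>z. exp (- of_real l * z\<^sup>2) * H z)
         - H 0 * of_real (sqrt (pi / l))) \<le> C0 * M / (l * sqrt l)"
    by (rule laplace_local[OF a r'(3) r'(2) r'(1) zp(1) zm(1)]) (rule that)
  have r'R: "cball 0 r' \<subseteq> ball 0 R" using r' by auto
  have "compact (\<psi> ` cball 0 r')"
    using h\<psi> r'R by (intro compact_continuous_image) (auto intro: holomorphic_on_imp_continuous_on holomorphic_on_subset)
  moreover have "\<psi> ` cball 0 r' \<subseteq> T" using \<psi>b(1) r'R rT by blast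
  \<comment> \<open>Local boundedness of the family enters here: one bound for all amplitudes on the
    compact image of the disc.\<close>
  ultimately obtain M1 where M1: "\<And>h z. h \<in> \<H> \<Longrightarrow> z \<in> cball 0 r' \<Longrightarrow> norm (h (\<psi> z)) \<le> M1"
    using bdd by (meson imageI)
  have "compact (deriv \<psi> ` cball 0 r')"
    using holomorphic_deriv[OF h\<psi> open_ball] r'R by (intro compact_continuous_image) (auto intro: holomorphic_on_imp_continuous_on holomorphic_on_subset)
  from compact_imp_bounded[OF this] obtain M2 where M2: "\<And>z. z \<in> cball 0 r' \<Longrightarrow> norm (deriv \<psi> z) \<le> M2"
    unfolding bounded_iff by blast
  have sub: "c ` {u..v} \<subseteq> path_image c - {t0}" if "0 \<le> u" "v \<le> 1" "s0 < u \<or> v < s0" for u v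
  proof
    fix x assume "x \<in> c ` {u..v}"
    then obtain s where s: "x = c s" "s \<in> {u..v}" by blast
    then have "s \<in> {0..1}" "s \<noteq> s0" using that by auto
    then show "x \<in> path_image c - {t0}" using s0(3)[of s] s(1) by (auto simp: path_image_def)
  qed
  have sub1: "path_image (subpath 0 sm c) \<subseteq> path_image c - {t0}"
    using s0(1,2) sm sp sub unfolding path_image_subpath by auto
  have sub2: "path_image (subpath sp 1 c) \<subseteq> path_image c - {t0}"
    using s0(1,2) sm sp sub unfolding path_image_subpath by auto
  have vp: "valid_path (subpath 0 sm c)" "valid_path (subpath sm sp c)" "valid_path (subpath sp 1 c)"
    using c(1) sm sp s0 by (auto intro!: valid_path_subpath)
  obtain C1 where C1: "\<forall>h l b. h \<in> \<H> \<longrightarrow> l \<ge> 1 \<longrightarrow> Re b = Re (g t0) \<longrightarrow>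
    norm (contour_integral (subpath 0 sm c) (\<lambda>t. exp (of_real l * (g t - b)) * h t)) \<le> C1 / (l * sqrt l)"
  proof (rule exp_small_on_path[OF assms(1,2) vp(1) _ _ fam bdd])
    show "path_image (subpath 0 sm c) \<subseteq> T" "\<forall>t\<in>path_image (subpath 0 sm c). Re (g t) < Re (g t0)"
      using sub1 c(2) below by blast+
  qed (rule that)
  obtain C2 where C2: "\<forall>h l b. h \<in> \<H> \<longrightarrow> l \<ge> 1 \<longrightarrow> Re b = Re (g t0) \<longrightarrow>
    norm (contour_integral (subpath sp 1 c) (\<lambda>t. exp (of_real l * (g t - b)) * h t)) \<le> C2 / (l * sqrt l)"
  proof (rule exp_small_on_path[OF assms(1,2) vp(3) _ _ fam bdd])
    show "path_image (subpath sp 1 c) \<subseteq> T" "\<forall>t\<in>path_image (subpath sp 1 c). Re (g t) < Re (g t0)"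
      using sub2 c(2) below by blast+
  qed (rule that)
  show ?thesis
  proof (rule that[of "C1 + C0 * (M1 * M2) + C2"], intro ballI allI impI)
    fix h l assume h: "h \<in> \<H>" and l: "l \<ge> (1::real)"
    let ?f = "\<lambda>t. exp (of_real l * (g t - g t0)) * h t"
    have hf: "?f holomorphic_on T" using assms(2) fam[rule_format, OF h] by (intro holomorphic_intros)
    have ci: "?f contour_integrable_on c"
      using c(1,2) hf assms(1) by (intro contour_integrable_holomorphic_simple[OF hf assms(1)])
    have split: "contour_integral c ?f = contour_integral (subpath 0 sm c) ?f
        + contour_integral (subpath sm sp c) ?f + contour_integral (subpath sp 1 c) ?f"
    proof -
      have "contour_integral (subpath 0 sm c) ?f + contour_integral (subpath sm sp c) ?f = contour_integral (subpath 0 sp c) ?f"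
        by (rule contour_integral_subpath_combine[OF ci c(1)]) (use sm sp s0 in auto)
      moreover have "contour_integral (subpath 0 sp c) ?f + contour_integral (subpath sp 1 c) ?f = contour_integral (subpath 0 1 c) ?f"
        by (rule contour_integral_subpath_combine[OF ci c(1)]) (use sm sp s0 in auto)
      ultimately show ?thesis by simp
    qed
    let ?H = "\<lambda>z. h (\<psi> z) * deriv \<psi> z"
    have sgs: "closed_segment zm (- of_real a) \<subseteq> ball 0 R" "closed_segment (- complex_of_real a) (of_real a) \<subseteq> ball 0 R"
       "closed_segment (of_real a) zp \<subseteq> ball 0 R"
      by (rule closed_segment_subset; use zp zm a r' in simp)+
    have \<psi>c: "\<psi> (\<phi> (c s)) = c s" if "s \<in> {sm..sp}" for s
      using \<psi>(3) midU[OF that] by (auto simp: U_def)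
    have fH: "?f (\<psi> z) * deriv \<psi> z = exp (- of_real l * z\<^sup>2) * ?H z" if "z \<in> ball 0 R" for z
    proof -
      have "g (\<psi> z) - g t0 = - z\<^sup>2"
        using geq[of "\<psi> z"] \<psi>b[OF that] r(2) unfolding \<phi>_def by auto
      then show ?thesis by simp
    qed
    \<comment> \<open>In the ball around \<open>t0\<close> only the end points of the middle piece
      matter, so it is exchanged for the polygon through \<open>-a\<close> and \<open>a\<close> in
      the \<open>z\<close>-plane.\<close>
    have "contour_integral (subpath sm sp c) ?f =
        contour_integral (linepath zm (- of_real a)) (\<lambda>z. ?f (\<psi> z) * deriv \<psi> z)
      + contour_integral (linepath (- of_real a) (of_real a)) (\<lambda>z. ?f (\<psi> z) * deriv \<psi> z)
      + contour_integral (linepath (of_real a) zp) (\<lambda>z. ?f (\<psi> z) * deriv \<psi> z)"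
    proof (rule contour_integral_change_primitive[OF convex_ball open_ball _ open_ball h\<psi> _ vp(2)])
      show "?f holomorphic_on ball t0 r" using hf rT by (rule holomorphic_on_subset)
      show "\<psi> ` ball 0 R \<subseteq> ball t0 r" using \<psi>b by auto
      show "path_image (subpath sm sp c) \<subseteq> ball t0 r" using midU sm sp by (auto simp: path_image_subpath U_def)
      show "pathstart (subpath sm sp c) = \<psi> zm" "pathfinish (subpath sm sp c) = \<psi> zp"
        using \<psi>c sm sp by (auto simp: zm_def zp_def)
    qed (use sgs in auto)
    also have "\<dots> = contour_integral (linepath zm (- of_real a)) (\<lambda>z. exp (- of_real l * z\<^sup>2) * ?H z)
         + contour_integral (linepath (- of_real a) (of_real a)) (\<lambda>z. exp (- of_real l * z\<^sup>2) * ?H z)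
         + contour_integral (linepath (of_real a) zp) (\<lambda>z. exp (- of_real l * z\<^sup>2) * ?H z)"
      by (intro arg_cong2[of _ _ _ _ "(+)"] contour_integral_cong refl fH) (use sgs in \<open>simp_all add: subset_iff\<close>)
    finally have mid: "contour_integral (subpath sm sp c) ?f = \<dots>" .
    have "?H holomorphic_on ball 0 R"
      using fam[rule_format, OF h] h\<psi> \<psi>b(1) rT
      by (intro holomorphic_on_mult holomorphic_on_compose_gen[unfolded comp_def, of \<psi> _ h T] holomorphic_deriv) auto
    moreover have "norm (?H z) \<le> M1 * M2" if "z \<in> cball 0 r'" for z
      using M1[OF h that] M2[OF that] order_trans[OF norm_ge_zero M1[OF h that]]
      unfolding norm_mult by (intro mult_mono) auto
    ultimately have "norm (contour_integral (subpath sm sp c) ?f - ?H 0 * of_real (sqrt (pi / l))) \<le> C0 * (M1 * M2) / (l * sqrt l)"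
      unfolding mid using l C0 by blast
    \<comment> \<open>Here \<open>?H 0 = h t0 / G t0\<close>, and the factor
      \<open>1 / sqrt 2\<close> in the modulus of \<open>G t0\<close> turns \<open>sqrt pi\<close>
      into the \<open>sqrt (2 * pi)\<close> of \<open>branch_sqrt\<close>.\<close>
    also have "?H 0 * of_real (sqrt (pi / l)) = branch_sqrt ?g2 \<omega>0 * h t0 / of_real (sqrt l)"
      by (simp add: \<psi>0 d\<psi>0 G0 branch_sqrt_def real_sqrt_divide real_sqrt_mult field_simps)
    finally have m: "norm (contour_integral (subpath sm sp c) ?f - branch_sqrt ?g2 \<omega>0 * h t0 / of_real (sqrt l)) \<le> C0 * (M1 * M2) / (l * sqrt l)" .
    let ?a = "contour_integral (subpath 0 sm c) ?f" and ?b = "contour_integral (subpath sm sp c) ?f - branch_sqrt ?g2 \<omega>0 * h t0 / of_real (sqrt l)"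
      and ?d = "contour_integral (subpath sp 1 c) ?f"
    have "norm (contour_integral c ?f - branch_sqrt ?g2 \<omega>0 * h t0 / of_real (sqrt l)) = norm (?a + ?b + ?d)"
      unfolding split by (simp add: algebra_simps)
    also have "\<dots> \<le> norm ?a + norm ?b + norm ?d"
      by (rule norm_triangle_le[OF add_mono[OF norm_triangle_ineq]]) simp
    also have "\<dots> \<le> (C1 + C0 * (M1 * M2) + C2) / (l * sqrt l)"
      using C1[rule_format, OF h l refl] m C2[rule_format, OF h l refl] by (simp add: add_divide_distrib)
    finally show "norm (contour_integral c ?f - branch_sqrt ?g2 \<omega>0 * h t0 / of_real (sqrt l)) \<le> (C1 + C0 * (M1 * M2) + C2) / (l * sqrt l)" .
  qed
qed

section \<open>Smooth functions and cut-offs\<close>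

lemma partial_eq: "(f has_derivative f') (at z) \<Longrightarrow> partial b f z = f' b"
  unfolding partial_def by (metis frechet_derivative_at)

lemma has_derivative_frechet: "f differentiable (at z) \<Longrightarrow> (f has_derivative (\<lambda>b. partial b f z)) (at z)"
  unfolding partial_def by (simp add: frechet_derivative_works)

lemma Ck_SucD: "Ck (Suc n) f \<Longrightarrow> Ck n f"
proof (induction n arbitrary: f)
  case 0
  then show ?case by (auto intro: differentiable_imp_continuous_on simp: differentiable_on_def differentiable_at_withinI)
qed auto

lemma Ck_SucI:
  assumes "\<And>z. (f has_derivative f' z) (at z)" "\<And>b. b \<in> Basis \<Longrightarrow> Ck n (\<lambda>z. f' z b)"
  shows "Ck (Suc n) f"
proof -
  have "partial b f = (\<lambda>z. f' z b)" for b using partial_eq[OF assms(1)] by blast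
  then show ?thesis using assms by (auto simp: differentiable_def)
qed

lemma Ck_has_derivative: "Ck (Suc n) f \<Longrightarrow> (f has_derivative (\<lambda>b. partial b f z)) (at z)"
  by (simp add: has_derivative_frechet)

lemma Ck_const [simp]: "Ck n (\<lambda>z::'a::euclidean_space. c)"
proof (induction n arbitrary: c)
  case (Suc n)
  show ?case by (rule Ck_SucI[where f' = "\<lambda>_ _. 0"]) (use Suc in auto)
qed auto

lemma Ck_add: "Ck n f \<Longrightarrow> Ck n g \<Longrightarrow> Ck n (\<lambda>z::'a::euclidean_space. f z + g z)"
proof (induction n arbitrary: f g)
  case (Suc n)
  show ?case
    by (rule Ck_SucI[where f' = "\<lambda>z b. partial b f z + partial b g z"])
       (use Suc in \<open>auto intro!: has_derivative_add has_derivative_frechet\<close>)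
qed (auto intro: continuous_intros)

lemma Ck_mult: "Ck n f \<Longrightarrow> Ck n g \<Longrightarrow> Ck n (\<lambda>z::'a::euclidean_space. f z * g z)"
proof (induction n arbitrary: f g)
  case (Suc n)
  have "Ck n f" "Ck n g" using Suc.prems Ck_SucD by blast+
  then show ?case
    by (intro Ck_SucI[where f' = "\<lambda>z b. f z * partial b g z + partial b f z * g z"])
       (use Suc in \<open>auto intro!: has_derivative_mult has_derivative_frechet Ck_add\<close>)
qed (auto intro: continuous_intros)

lemma Ck_minus: "Ck n f \<Longrightarrow> Ck n (\<lambda>z::'a::euclidean_space. - f z)"
  using Ck_mult[OF Ck_const[of n "-1"], of f] by simp

lemma Ck_diff: "Ck n f \<Longrightarrow> Ck n g \<Longrightarrow> Ck n (\<lambda>z::'a::euclidean_space. f z - g z)"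
  using Ck_add[OF _ Ck_minus, of n f g] by simp

lemma Ck_cnj: "Ck n f \<Longrightarrow> Ck n (\<lambda>z::'a::euclidean_space. cnj (f z))"
proof (induction n arbitrary: f)
  case (Suc n)
  show ?case
    by (rule Ck_SucI[where f' = "\<lambda>z b. cnj (partial b f z)"])
       (use Suc in \<open>auto intro!: bounded_linear.has_derivative[OF bounded_linear_cnj] has_derivative_frechet\<close>)
qed (auto intro: continuous_intros)

lemma Ck_inverse:
  assumes "\<And>z. f z \<noteq> 0"
  shows "Ck n f \<Longrightarrow> Ck n (\<lambda>z::'a::euclidean_space. inverse (f z))"
proof (induction n)
  case 0
  then show ?case using assms by (auto intro: continuous_intros)
next
  case (Suc n)
  have "Ck n f" using Suc.prems Ck_SucD by blast
  then have "Ck n (\<lambda>z. inverse (f z))" by (rule Suc.IH)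
  then show ?case
    by (intro Ck_SucI[where f' = "\<lambda>z b. - (inverse (f z) * partial b f z * inverse (f z))"])
       (use Suc assms in \<open>auto intro!: Ck_minus Ck_mult Deriv.has_derivative_inverse has_derivative_frechet\<close>)
qed

lemma Ck_affine:
  fixes \<beta> :: "real \<Rightarrow> complex" and L :: "'a::euclidean_space \<Rightarrow> real"
  assumes "bounded_linear L"
  shows "Ck n \<beta> \<Longrightarrow> Ck n (\<lambda>z. \<beta> (L z + r))"
proof (induction n arbitrary: \<beta>)
  case 0
  have "continuous_on UNIV (\<lambda>z. L z + r)"
    using assms by (intro continuous_intros linear_continuous_on)
  with 0 show ?case by (auto intro: continuous_on_compose2)
next
  case (Suc n)
  have d: "((\<lambda>z. L z + r) has_derivative L) (at z)" for z
    using bounded_linear_imp_has_derivative[OF assms] by (auto intro!: derivative_eq_intros)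
  show ?case
  proof (rule Ck_SucI[where f' = "\<lambda>z b. of_real (L b) * partial 1 \<beta> (L z + r)"])
    fix z
    have D: "(\<beta> has_derivative (\<lambda>b. partial b \<beta> (L z + r))) (at (L z + r))"
      using Suc.prems by (rule Ck_has_derivative)
    have "(\<lambda>b. partial b \<beta> (L z + r)) = (\<lambda>b. of_real b * partial 1 \<beta> (L z + r))"
    proof
      fix b
      show "partial b \<beta> (L z + r) = of_real b * partial 1 \<beta> (L z + r)"
        using linear_cmul[OF has_derivative_linear[OF D], of b 1] by (simp add: scaleR_conv_of_real)
    qed
    note D' = D[unfolded this]
    show "((\<lambda>z. \<beta> (L z + r)) has_derivative (\<lambda>b. of_real (L b) * partial 1 \<beta> (L z + r))) (at z)"
      by (rule has_derivative_compose[OF d D'])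
    fix b :: 'a
    show "Ck n (\<lambda>z. of_real (L b) * partial 1 \<beta> (L z + r))"
      using Suc by (intro Ck_mult Ck_const Suc.IH) auto
  qed
qed

lemma has_derivative_exp_linear:
  fixes c1 c2 :: complex
  shows "((\<lambda>z::real \<times> real. exp (c1 * of_real (fst z) + c2 * of_real (snd z))) has_derivative
    (\<lambda>b. exp (c1 * of_real (fst z) + c2 * of_real (snd z)) * (c1 * of_real (fst b) + c2 * of_real (snd b)))) (at z)"
proof -
  have "((\<lambda>z. c1 * of_real (fst z) + c2 * of_real (snd z)) has_derivative
      (\<lambda>b. c1 * of_real (fst b) + c2 * of_real (snd b))) (at z)"
    by (intro derivative_intros bounded_linear.has_derivative[OF bounded_linear_of_real]
          bounded_linear_imp_has_derivative bounded_linear_fst bounded_linear_snd)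
  from has_derivative_compose[OF this has_field_derivative_imp_has_derivative[OF DERIV_exp]]
  show ?thesis .
qed

lemma Ck_exp_linear:
  "Ck n (\<lambda>z::real \<times> real. exp (c1 * of_real (fst z) + c2 * of_real (snd z)))"
proof (induction n)
  case 0
  show ?case by (auto intro!: continuous_intros)
next
  case (Suc n)
  show ?case
    by (rule Ck_SucI[OF has_derivative_exp_linear]) (use Suc in \<open>auto intro!: Ck_mult\<close>)
qed

text \<open>The polynomial parameter makes the family closed under differentiation, so smoothness
  follows for all members simultaneously by induction on the order.\<close>

definition exp_recip :: "real poly \<Rightarrow> real \<Rightarrow> real" where
  "exp_recip p x = (if x \<le> 0 then 0 else poly p (1 / x) * exp (- (1 / x)))"

lemma poly_times_exp_minus_tendsto_0: "((\<lambda>x. poly p x * exp (- x)) \<longlongrightarrow> (0::real)) at_top"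
proof -
  have "((\<lambda>x. \<Sum>i\<le>degree p. coeff p i * (x ^ i / exp x)) \<longlongrightarrow> (\<Sum>i\<le>degree p. coeff p i * 0)) at_top"
    by (intro tendsto_intros tendsto_power_div_exp_0)
  moreover have "(\<lambda>x. \<Sum>i\<le>degree p. coeff p i * (x ^ i / exp x)) = (\<lambda>x. poly p x * exp (- x))"
    by (auto simp: poly_altdef sum_distrib_left exp_minus divide_inverse mult_ac)
  ultimately show ?thesis by simp
qed

lemma exp_recip_tendsto_0: "(exp_recip p \<longlongrightarrow> 0) (at 0)"
proof -
  have "((\<lambda>x. poly p (1 / x) * exp (- (1 / x))) \<longlongrightarrow> 0) (at_right 0)"
    using filterlim_compose[OF poly_times_exp_minus_tendsto_0 filterlim_inverse_at_top_right, of p]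
    by (simp add: inverse_eq_divide)
  moreover have "\<forall>\<^sub>F x in at_right 0. poly p (1 / x) * exp (- (1 / x)) = exp_recip p x"
    by (auto simp: eventually_at_filter exp_recip_def)
  ultimately have r: "(exp_recip p \<longlongrightarrow> 0) (at_right 0)" by (rule Lim_transform_eventually)
  have "\<forall>\<^sub>F x in at_left 0. 0 = exp_recip p x"
    by (auto simp: eventually_at_filter exp_recip_def)
  then have "(exp_recip p \<longlongrightarrow> 0) (at_left 0)"
    by (rule Lim_transform_eventually[OF tendsto_const])
  with r show ?thesis by (simp add: filterlim_at_split)
qed

text \<open>Each \<open>pCons 0\<close> multiplies by \<open>1 / x\<close>, so the new polynomial
  encodes \<open>(p - p')(1/x) / x^2\<close>. At the origin the difference quotient is itself a
  member of the family, with polynomial \<open>pCons 0 p\<close>, and tends to 0.\<close>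

lemma exp_recip_DERIV:
  "(exp_recip p has_real_derivative exp_recip (pCons 0 (pCons 0 (p - pderiv p))) x) (at x)"
proof (cases x "0::real" rule: linorder_cases)
  case less
  have "((\<lambda>x. 0) has_real_derivative 0) (at x)" by simp
  then have "(exp_recip p has_real_derivative 0) (at x)"
    by (rule has_field_derivative_transform_within_open[of _ _ _ "{..<0}"]) (use less in \<open>auto simp: exp_recip_def\<close>)
  then show ?thesis using less by (simp add: exp_recip_def)
next
  case greater
  have "((\<lambda>x. poly p (1 / x) * exp (- (1 / x))) has_real_derivative
      exp_recip (pCons 0 (pCons 0 (p - pderiv p))) x) (at x)"
    using greater
    by (auto intro!: derivative_eq_intros poly_DERIV[THEN DERIV_chain2] simp: exp_recip_def power2_eq_square algebra_simps)
  then show ?thesis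
    by (rule has_field_derivative_transform_within_open[of _ _ _ "{0<..}"]) (use greater in \<open>auto simp: exp_recip_def\<close>)
next
  case equal
  have "\<forall>\<^sub>F h in at 0. exp_recip (pCons 0 p) h = (exp_recip p (0 + h) - exp_recip p 0) / h"
    by (auto simp: eventually_at_filter exp_recip_def)
  then have "((\<lambda>h. (exp_recip p (0 + h) - exp_recip p 0) / h) \<longlongrightarrow> 0) (at 0)"
    by (rule Lim_transform_eventually[OF exp_recip_tendsto_0])
  then have "(exp_recip p has_real_derivative 0) (at 0)" by (simp add: DERIV_def)
  then show ?thesis using equal by (simp add: exp_recip_def)
qed

lemma Ck_exp_recip: "Ck n (\<lambda>x. of_real (exp_recip p x))"
proof (induction n arbitrary: p)
  case 0
  have "isCont (exp_recip p) x" for x using exp_recip_DERIV DERIV_isCont by blast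
  then show ?case by (auto intro!: continuous_intros continuous_at_imp_continuous_on)
next
  case (Suc n)
  show ?case
  proof (rule Ck_SucI[where f' = "\<lambda>x b. of_real (exp_recip (pCons 0 (pCons 0 (p - pderiv p))) x) * of_real b"])
    fix x
    have "(exp_recip p has_derivative (\<lambda>b. exp_recip (pCons 0 (pCons 0 (p - pderiv p))) x * b)) (at x)"
      using exp_recip_DERIV by (rule has_field_derivative_imp_has_derivative)
    from bounded_linear.has_derivative[OF bounded_linear_of_real this]
    show "((\<lambda>x. complex_of_real (exp_recip p x)) has_derivative
       (\<lambda>b. of_real (exp_recip (pCons 0 (pCons 0 (p - pderiv p))) x) * of_real b)) (at x)" by simp
  qed (use Suc in \<open>auto intro!: Ck_mult\<close>)
qed

text \<open>With \<open>e x = exp (- (1 / x))\<close> for positive \<open>x\<close> and 0 otherwise,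
  the quotient \<open>e x / (e x + e (1 - x))\<close> works: \<open>x\<close> and
  \<open>1 - x\<close> are never both nonpositive, so the denominator is positive.\<close>

lemma smooth_step:
  obtains \<rho> :: "real \<Rightarrow> complex" where "\<And>n. Ck n \<rho>" "\<And>x. x \<le> 0 \<Longrightarrow> \<rho> x = 0" "\<And>x. x \<ge> 1 \<Longrightarrow> \<rho> x = 1"
proof -
  let ?e = "\<lambda>x. complex_of_real (exp_recip 1 x)"
  let ?d = "\<lambda>x. ?e x + ?e (- x + 1)"
  have pos: "exp_recip 1 x \<ge> 0" "x > 0 \<Longrightarrow> exp_recip 1 x > 0" for x by (auto simp: exp_recip_def)
  have "exp_recip 1 x + exp_recip 1 (- x + 1) > 0" for x
    using pos(1)[of x] pos(1)[of "- x + 1"] pos(2)[of x] pos(2)[of "- x + 1"]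
    by (cases "x > 0") auto
  then have nz: "?d x \<noteq> 0" for x by (metis of_real_add of_real_eq_0_iff less_irrefl)
  have "Ck n (\<lambda>x. ?e (- x + 1))" for n
    using Ck_affine[OF bounded_linear_minus[OF bounded_linear_ident] Ck_exp_recip] by simp
  then have "Ck n (\<lambda>x. ?e x * inverse (?d x))" for n
    by (intro Ck_mult Ck_inverse Ck_add Ck_exp_recip nz)
  moreover have "?e x * inverse (?d x) = 1" if "x \<ge> 1" for x
    using nz[of x] that by (simp add: exp_recip_def)
  ultimately show ?thesis
    by (intro that[of "\<lambda>x. ?e x * inverse (?d x)"]) (auto simp: exp_recip_def)
qed

lemma smooth_cutoff:
  obtains \<eta> :: "real \<times> real \<Rightarrow> complex" where "\<And>n. Ck n \<eta>"
    "\<And>z. \<bar>fst z\<bar> \<le> R \<Longrightarrow> \<bar>snd z\<bar> \<le> R \<Longrightarrow> \<eta> z = 1"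
    "\<And>z. R + 1 \<le> \<bar>fst z\<bar> \<or> R + 1 \<le> \<bar>snd z\<bar> \<Longrightarrow> \<eta> z = 0"
proof -
  obtain \<rho> :: "real \<Rightarrow> complex" where \<rho>: "\<And>n. Ck n \<rho>" "\<And>x. x \<le> 0 \<Longrightarrow> \<rho> x = 0" "\<And>x. x \<ge> 1 \<Longrightarrow> \<rho> x = 1"
    by (rule smooth_step) (rule that)
  \<comment> \<open>A product of two steps cuts off one coordinate on both sides, with transition
    zones of width 1 next to \<open>-R\<close> and \<open>R\<close>.\<close>
  let ?c = "\<lambda>L z. \<rho> (L z + (R + 1)) * \<rho> (- L z + (R + 1))"
  have C: "Ck n (?c L)" if "bounded_linear L" for n and L :: "real \<times> real \<Rightarrow> real"
    by (intro Ck_mult Ck_affine \<rho> that bounded_linear_minus)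
  show ?thesis
  proof (rule that[of "\<lambda>z. ?c fst z * ?c snd z"])
    show "Ck n (\<lambda>z. ?c fst z * ?c snd z)" for n
      by (intro Ck_mult[of n "?c fst" "?c snd"] C bounded_linear_fst bounded_linear_snd)
    show "?c fst z * ?c snd z = 1" if "\<bar>fst z\<bar> \<le> R" "\<bar>snd z\<bar> \<le> R" for z
      using that by (auto simp: \<rho>(3))
    show "?c fst z * ?c snd z = 0" if "R + 1 \<le> \<bar>fst z\<bar> \<or> R + 1 \<le> \<bar>snd z\<bar>" for z
      using that by (auto simp: abs_if \<rho>(2) split: if_splits)
  qed
qed

section \<open>The Cauchy--Pompeiu formula and Green's theorem\<close>

definition cpt :: "real \<times> real \<Rightarrow> complex" where
  "cpt z = Complex (fst z) (snd z)"

lemma cpt_eq: "cpt z = of_real (fst z) + \<i> * of_real (snd z)"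
  by (simp add: cpt_def complex_eq_iff)

lemma continuous_on_cpt [continuous_intros]: "continuous_on S f \<Longrightarrow> continuous_on S (\<lambda>z. cpt (f z))"
  unfolding cpt_eq by (intro continuous_intros)

lemma cpt_diff: "cpt (z - w) = cpt z - cpt w"
  by (simp add: cpt_def complex_eq_iff)

lemma cpt_eq_0_iff: "cpt z = 0 \<longleftrightarrow> z = 0"
  by (simp add: cpt_def complex_eq_iff prod_eq_iff)

lemma norm_cpt: "(norm (cpt z))\<^sup>2 = (fst z)\<^sup>2 + (snd z)\<^sup>2"
  by (simp add: cpt_def cmod_power2)

definition square :: "real \<Rightarrow> (real \<times> real) set" where
  "square R = cbox (- R, - R) (R, R)"

lemma mem_square: "z \<in> square R \<longleftrightarrow> \<bar>fst z\<bar> \<le> R \<and> \<bar>snd z\<bar> \<le> R"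
  by (cases z) (auto simp: square_def abs_le_iff)

definition vanishes_outside :: "real \<Rightarrow> (real \<times> real \<Rightarrow> complex) \<Rightarrow> bool" where
  "vanishes_outside R h \<longleftrightarrow> (\<forall>z. z \<notin> square R \<longrightarrow> h z = 0)"

lemma vanishes_outsideD: "vanishes_outside R h \<Longrightarrow> z \<notin> square R \<Longrightarrow> h z = 0"
  unfolding vanishes_outside_def by blast

lemma integrable_vanishing_outside_square:
  fixes h :: "real \<times> real \<Rightarrow> complex"
  assumes "continuous_on UNIV h" "vanishes_outside R h"
  shows "integrable lborel h"
    and "(LINT z|lborel. h z) = integral {-R..R} (\<lambda>x. integral {-R..R} (\<lambda>y. h (x, y)))"
proof -
  have eq: "(\<lambda>z. indicator (square R) z *\<^sub>R h z) = h"
    using assms(2) by (auto simp: indicator_def vanishes_outside_def)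
  have c: "continuous_on (square R) h" using assms(1) continuous_on_subset by blast
  have i: "set_integrable lborel (square R) h"
    unfolding set_integrable_def by (rule borel_integrable_compact) (use c in \<open>auto simp: square_def\<close>)
  then show "integrable lborel h" unfolding set_integrable_def eq .
  have "(LINT z|lborel. h z) = integral (square R) h"
    using set_borel_integral_eq_integral(2)[OF i] unfolding set_lebesgue_integral_def eq .
  also have "\<dots> = integral {-R..R} (\<lambda>x. integral {-R..R} (\<lambda>y. h (x, y)))"
    using integral_prod_continuous[OF c[unfolded square_def]] by (simp add: square_def)
  finally show "(LINT z|lborel. h z) = integral {-R..R} (\<lambda>x. integral {-R..R} (\<lambda>y. h (x, y)))" .
qed

text \<open>With the differentiated variable innermost, the fundamental theorem of calculus leaves
  only values on the edges of the square. For the \<open>x\<close>-derivative this requires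
  exchanging the iterated integrals.\<close>

lemma
  fixes h hx hy :: "real \<times> real \<Rightarrow> complex"
  assumes R: "R > 0" and zero: "\<And>z. \<bar>fst z\<bar> = R \<or> \<bar>snd z\<bar> = R \<Longrightarrow> h z = 0"
  shows integral_x_derivative_0: "\<lbrakk>\<And>x y. ((\<lambda>x. h (x, y)) has_vector_derivative hx (x, y)) (at x);
      continuous_on UNIV hx; vanishes_outside R hx\<rbrakk> \<Longrightarrow> (LINT z|lborel. hx z) = 0"
    and integral_y_derivative_0: "\<lbrakk>\<And>x y. ((\<lambda>y. h (x, y)) has_vector_derivative hy (x, y)) (at y);
      continuous_on UNIV hy; vanishes_outside R hy\<rbrakk> \<Longrightarrow> (LINT z|lborel. hy z) = 0"
proof -
  assume d: "\<And>x y. ((\<lambda>y. h (x, y)) has_vector_derivative hy (x, y)) (at y)"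
    and c: "continuous_on UNIV hy" and z: "vanishes_outside R hy"
  have "integral {-R..R} (\<lambda>y. hy (x, y)) = 0" for x
  proof (rule integral_unique)
    have "((\<lambda>y. hy (x, y)) has_integral (h (x, R) - h (x, - R))) {-R..R}"
      using R by (intro fundamental_theorem_of_calculus has_vector_derivative_at_within[OF d]) auto
    then show "((\<lambda>y. hy (x, y)) has_integral 0) {-R..R}" using R by (simp add: zero)
  qed
  then show "(LINT z|lborel. hy z) = 0"
    by (simp add: integrable_vanishing_outside_square(2)[OF c z])
next
  assume d: "\<And>x y. ((\<lambda>x. h (x, y)) has_vector_derivative hx (x, y)) (at x)"
    and c: "continuous_on UNIV hx" and z: "vanishes_outside R hx"
  have "integral {-R..R} (\<lambda>x. hx (x, y)) = 0" for y
  proof (rule integral_unique)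
    have "((\<lambda>x. hx (x, y)) has_integral (h (R, y) - h (- R, y))) {-R..R}"
      using R by (intro fundamental_theorem_of_calculus has_vector_derivative_at_within[OF d]) auto
    then show "((\<lambda>x. hx (x, y)) has_integral 0) {-R..R}" using R by (simp add: zero)
  qed
  moreover have "integral {-R..R} (\<lambda>x. integral {-R..R} (\<lambda>y. hx (x, y))) =
      integral {-R..R} (\<lambda>y. integral {-R..R} (\<lambda>x. hx (x, y)))"
    using integral_swap_continuous[of "-R" "-R" R R "\<lambda>x y. hx (x, y)"] continuous_on_subset[OF c] by simp
  ultimately show "(LINT z|lborel. hx z) = 0"
    by (simp add: integrable_vanishing_outside_square(2)[OF c z])
qed

text \<open>The function \<open>1 / z\<close>, written as \<open>cnj z / |z|^2\<close>, with the
  denominator shifted by \<open>e\<close> to remove the singularity.\<close>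

definition cauchy_kernel :: "real \<Rightarrow> real \<times> real \<Rightarrow> complex" where
  "cauchy_kernel e z = cnj (cpt z) / of_real ((fst z)\<^sup>2 + (snd z)\<^sup>2 + e)"

definition cauchy_kernel_x :: "real \<Rightarrow> real \<times> real \<Rightarrow> complex" where
  "cauchy_kernel_x e z = 1 / of_real ((fst z)\<^sup>2 + (snd z)\<^sup>2 + e) - 2 * of_real (fst z) * cnj (cpt z) / (of_real ((fst z)\<^sup>2 + (snd z)\<^sup>2 + e))\<^sup>2"

definition cauchy_kernel_y :: "real \<Rightarrow> real \<times> real \<Rightarrow> complex" where
  "cauchy_kernel_y e z = - \<i> / of_real ((fst z)\<^sup>2 + (snd z)\<^sup>2 + e) - 2 * of_real (snd z) * cnj (cpt z) / (of_real ((fst z)\<^sup>2 + (snd z)\<^sup>2 + e))\<^sup>2"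

context
  fixes e :: real assumes e: "e > 0"
begin

lemma kernel_denom: "(x::real)\<^sup>2 + y\<^sup>2 + e > 0" "(of_real ((x::real)\<^sup>2 + y\<^sup>2 + e) :: complex) \<noteq> 0"
proof -
  show "x\<^sup>2 + y\<^sup>2 + e > 0" using e by (intro add_nonneg_pos) auto
  then show "(of_real (x\<^sup>2 + y\<^sup>2 + e) :: complex) \<noteq> 0" by (simp only: of_real_eq_0_iff)
qed

lemma continuous_on_kernel:
  "continuous_on UNIV (cauchy_kernel e)" "continuous_on UNIV (cauchy_kernel_x e)" "continuous_on UNIV (cauchy_kernel_y e)"
  unfolding cauchy_kernel_def cauchy_kernel_x_def cauchy_kernel_y_def
  by (intro continuous_intros; use kernel_denom(2) in \<open>simp only: power_eq_0_iff\<close>; simp)+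

lemma kernel_derivatives:
  "((\<lambda>x. cauchy_kernel e (x - a, b)) has_vector_derivative cauchy_kernel_x e (x - a, b)) (at x)"
  "((\<lambda>y. cauchy_kernel e (a, y - b)) has_vector_derivative cauchy_kernel_y e (a, y - b)) (at y)"
proof -
  have nz: "(of_real x - of_real a)\<^sup>2 + (of_real b)\<^sup>2 + of_real e \<noteq> (0::complex)" for x a b
    using kernel_denom(2)[of "x - a" b] by simp
  have nz': "(of_real a)\<^sup>2 + (of_real x - of_real b)\<^sup>2 + of_real e \<noteq> (0::complex)" for x a b
    using kernel_denom(2)[of a "x - b"] by simp
  have "((\<lambda>u. (u - of_real a - \<i> * of_real b) / ((u - of_real a)\<^sup>2 + (of_real b)\<^sup>2 + of_real e)) has_field_derivative
      cauchy_kernel_x e (x - a, b)) (at (of_real x))"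
    using nz by (auto intro!: derivative_eq_intros simp: cauchy_kernel_x_def cpt_eq power2_eq_square divide_simps)
      ((auto simp: algebra_simps)?)
  from has_vector_derivative_real_field[OF this]
  show "((\<lambda>x. cauchy_kernel e (x - a, b)) has_vector_derivative cauchy_kernel_x e (x - a, b)) (at x)"
    by (simp add: cauchy_kernel_def cpt_eq)
  have "((\<lambda>u. (of_real a - \<i> * (u - of_real b)) / ((of_real a)\<^sup>2 + (u - of_real b)\<^sup>2 + of_real e)) has_field_derivative
      cauchy_kernel_y e (a, y - b)) (at (of_real y))"
    using nz' by (auto intro!: derivative_eq_intros simp: cauchy_kernel_y_def cpt_eq power2_eq_square divide_simps)
      ((auto simp: algebra_simps)?)
  from has_vector_derivative_real_field[OF this]
  show "((\<lambda>y. cauchy_kernel e (a, y - b)) has_vector_derivative cauchy_kernel_y e (a, y - b)) (at y)"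
    by (simp add: cauchy_kernel_def cpt_eq)
qed

text \<open>Regularisation replaces the point mass at the origin by a smooth bump of total mass
  \<open>2 * pi\<close> that concentrates there as \<open>e\<close> tends to 0.\<close>

lemma kernel_dbar: "cauchy_kernel_x e z + \<i> * cauchy_kernel_y e z = of_real (2 * e / ((fst z)\<^sup>2 + (snd z)\<^sup>2 + e)\<^sup>2)"
proof -
  define q :: complex where "q = of_real ((fst z)\<^sup>2 + (snd z)\<^sup>2 + e)"
  have q: "q \<noteq> 0" unfolding q_def by (rule kernel_denom(2))
  have q2: "(cpt z) * cnj (cpt z) = q - of_real e"
    by (simp add: complex_mult_cnj cpt_def q_def)
  have "cauchy_kernel_x e z + \<i> * cauchy_kernel_y e z = 2 / q - 2 * ((cpt z) * cnj (cpt z)) / q\<^sup>2"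
  proof -
    have "1 / q - 2 * X * c / q\<^sup>2 + \<i> * (- \<i> / q - 2 * Y * c / q\<^sup>2) = 2 / q - 2 * ((X + \<i> * Y) * c) / q\<^sup>2" for X Y c
      using q by (simp add: field_simps power2_eq_square)
    then show ?thesis
      unfolding cauchy_kernel_x_def cauchy_kernel_y_def q_def[symmetric] by (subst (2) cpt_eq) simp
  qed
  also have "\<dots> = 2 * of_real e / q\<^sup>2"
    unfolding q2 using q by (simp add: field_simps power2_eq_square)
  finally show ?thesis by (simp add: q_def)
qed

text \<open>The bound is independent of \<open>e\<close> and serves as the dominating function for
  \<open>e\<close> tending to 0. At the origin both sides are 0, by the convention
  \<open>1 / 0 = 0\<close>.\<close>

lemma norm_kernel_le: "norm (cauchy_kernel e z) \<le> 1 / norm (cpt z)"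
proof (cases "z = 0")
  case False
  then have n: "norm (cpt z) > 0" by (simp add: cpt_eq_0_iff)
  have "norm (cauchy_kernel e z) = norm (cpt z) / ((norm (cpt z))\<^sup>2 + e)"
    using kernel_denom(1)[of "fst z" "snd z"]
    by (simp add: cauchy_kernel_def norm_divide norm_cpt del: of_real_add of_real_power)
  also have "\<dots> \<le> norm (cpt z) / ((norm (cpt z))\<^sup>2)"
    using n e by (intro divide_left_mono mult_pos_pos) (auto simp: add_pos_pos)
  also have "\<dots> = 1 / norm (cpt z)" by (simp add: power2_eq_square)
  finally show ?thesis .
qed (simp add: cauchy_kernel_def cpt_eq)

end

section \<open>Total mass and limit of the approximate identity\<close>

lemma has_bochner_integral_FTC_UNIV:
  fixes f F :: "real \<Rightarrow> real"
  assumes "\<And>x. (F has_real_derivative f x) (at x)" "\<And>x. isCont f x" "\<And>x. 0 \<le> f x"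
    "(F \<longlongrightarrow> A) at_bot" "(F \<longlongrightarrow> B) at_top"
  shows "has_bochner_integral lborel f (B - A)"
proof -
  have i: "set_integrable lborel (einterval (-\<infinity>) \<infinity>) f" "(LBINT x=-\<infinity>..\<infinity>. f x) = B - A"
    using interval_integral_FTC_nonneg[of "-\<infinity>" \<infinity> F f A B] assms by (auto simp: ereal_tendsto_simps)
  have "einterval (-\<infinity>) \<infinity> = UNIV" by (auto simp: einterval_def)
  then show ?thesis
    using i by (simp add: has_bochner_integral_iff set_integrable_def interval_lebesgue_integral_def set_lebesgue_integral_def)
qed

text \<open>With \<open>A^2 = x^2 + 1\<close> this is the inner integral of
  \<open>1 / (x^2 + y^2 + 1)^2\<close>. The antiderivative is a rational function plus an
  arctangent, and only the arctangent survives at infinity.\<close>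

lemma has_bochner_integral_inverse_quartic:
  fixes A :: real
  assumes A: "A > 0"
  shows "has_bochner_integral lborel (\<lambda>y. 1 / (A\<^sup>2 + y\<^sup>2)\<^sup>2) (pi / (2 * A ^ 3))"
proof -
  let ?F = "\<lambda>y. y / (2 * A\<^sup>2 * (A\<^sup>2 + y\<^sup>2)) + arctan (y / A) / (2 * A ^ 3)"
  have nz: "A\<^sup>2 + y\<^sup>2 > 0" for y using A by (intro add_pos_nonneg) auto
  have nz': "A\<^sup>2 + y\<^sup>2 \<noteq> 0" for y using nz[of y] by (metis less_irrefl)
  have "has_bochner_integral lborel (\<lambda>y. 1 / (A\<^sup>2 + y\<^sup>2)\<^sup>2) ((pi / 2) / (2 * A ^ 3) - (- (pi / 2)) / (2 * A ^ 3))"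
  proof (rule has_bochner_integral_FTC_UNIV)
    fix x
    have e1: "1 + (x / A)\<^sup>2 = (A\<^sup>2 + x\<^sup>2) / A\<^sup>2" using A by (simp add: field_simps)
    have "((\<lambda>y. y / (2 * A\<^sup>2 * (A\<^sup>2 + y\<^sup>2))) has_real_derivative (A\<^sup>2 - x\<^sup>2) / (2 * A\<^sup>2 * (A\<^sup>2 + x\<^sup>2)\<^sup>2)) (at x)"
      using A nz'[of x] by (auto intro!: derivative_eq_intros simp: divide_simps) (simp add: algebra_simps power2_eq_square)
    moreover have "((\<lambda>y. arctan (y / A) / (2 * A ^ 3)) has_real_derivative 1 / (2 * A\<^sup>2 * (A\<^sup>2 + x\<^sup>2))) (at x)"
      using A by (auto intro!: derivative_eq_intros simp: e1) (simp add: divide_simps eval_nat_numeral)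
    ultimately have "(?F has_real_derivative (A\<^sup>2 - x\<^sup>2) / (2 * A\<^sup>2 * (A\<^sup>2 + x\<^sup>2)\<^sup>2) + 1 / (2 * A\<^sup>2 * (A\<^sup>2 + x\<^sup>2))) (at x)"
      by (rule DERIV_add)
    also have "(A\<^sup>2 - x\<^sup>2) / (2 * A\<^sup>2 * (A\<^sup>2 + x\<^sup>2)\<^sup>2) + 1 / (2 * A\<^sup>2 * (A\<^sup>2 + x\<^sup>2)) = 1 / (A\<^sup>2 + x\<^sup>2)\<^sup>2"
    proof -
      have "a / (2 * b * c\<^sup>2) + 1 / (2 * b * c) = (a + c) / (2 * b * c\<^sup>2)" if "b \<noteq> 0" "c \<noteq> 0" for a b c :: real
        using that by (simp add: divide_simps power2_eq_square)
      from this[of "A\<^sup>2" "A\<^sup>2 + x\<^sup>2" "A\<^sup>2 - x\<^sup>2"] show ?thesis using A nz'[of x] by simp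
    qed
    finally show "(?F has_real_derivative 1 / (A\<^sup>2 + x\<^sup>2)\<^sup>2) (at x)" .
    show "isCont (\<lambda>y. 1 / (A\<^sup>2 + y\<^sup>2)\<^sup>2) x" using nz'[of x] by (intro continuous_intros) auto
  next
    have lim: "((\<lambda>y. y / (2 * A\<^sup>2 * (A\<^sup>2 + y\<^sup>2))) \<longlongrightarrow> 0) at_top" "((\<lambda>y. y / (2 * A\<^sup>2 * (A\<^sup>2 + y\<^sup>2))) \<longlongrightarrow> 0) at_bot"
      using A by real_asymp+
    have at: "filterlim (\<lambda>y. y / A) at_top at_top" "filterlim (\<lambda>y. y / A) at_bot at_bot"
      using A by real_asymp+
    have "((\<lambda>y. arctan (y / A) / (2 * A ^ 3)) \<longlongrightarrow> (pi / 2) / (2 * A ^ 3)) at_top"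
      by (intro tendsto_divide tendsto_const filterlim_compose[OF tendsto_arctan_at_top at(1)]) (use A in auto)
    from tendsto_add[OF lim(1) this] show "(?F \<longlongrightarrow> (pi / 2) / (2 * A ^ 3)) at_top" by simp
    have "((\<lambda>y. arctan (y / A) / (2 * A ^ 3)) \<longlongrightarrow> (- (pi / 2)) / (2 * A ^ 3)) at_bot"
      by (intro tendsto_divide tendsto_const filterlim_compose[OF tendsto_arctan_at_bot at(2)]) (use A in auto)
    from tendsto_add[OF lim(2) this] show "(?F \<longlongrightarrow> (- (pi / 2)) / (2 * A ^ 3)) at_bot" by simp
  qed auto
  then show ?thesis by (simp add: field_simps)
qed

text \<open>The matching outer integral: \<open>x / sqrt (x^2 + 1)\<close> has derivative
  \<open>1 / sqrt (x^2 + 1)^3\<close> and runs from -1 to 1.\<close>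

lemma has_bochner_integral_inverse_cubed_sqrt:
  "has_bochner_integral lborel (\<lambda>x. pi / (2 * sqrt (x\<^sup>2 + 1) ^ 3)) pi"
proof -
  have pos: "x\<^sup>2 + 1 > 0" for x :: real by (simp add: add_nonneg_pos)
  have "has_bochner_integral lborel (\<lambda>x. pi / (2 * sqrt (x\<^sup>2 + 1) ^ 3)) (pi / 2 - - (pi / 2))"
  proof (rule has_bochner_integral_FTC_UNIV[where F = "\<lambda>x. (pi / 2) * (x / sqrt (x\<^sup>2 + 1))"])
    fix x :: real
    define s where "s = sqrt (x\<^sup>2 + 1)"
    have s: "s > 0" "s\<^sup>2 = x\<^sup>2 + 1" using pos[of x] by (auto simp: s_def)
    have "((\<lambda>x. x / sqrt (x\<^sup>2 + 1)) has_real_derivative (1 * s - x * (x / s)) / (s * s)) (at x)"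
      using pos[of x] s by (auto intro!: derivative_eq_intros simp: s_def[symmetric] divide_simps)
    also have "(1 * s - x * (x / s)) / (s * s) = 1 / s ^ 3"
      using s by (simp add: divide_simps power3_eq_cube) (simp add: power2_eq_square algebra_simps)
    finally have "((\<lambda>x. x / sqrt (x\<^sup>2 + 1)) has_real_derivative 1 / s ^ 3) (at x)" .
    from DERIV_cmult[OF this, of "pi / 2"]
    show "((\<lambda>x. (pi / 2) * (x / sqrt (x\<^sup>2 + 1))) has_real_derivative pi / (2 * sqrt (x\<^sup>2 + 1) ^ 3)) (at x)"
      by (simp add: s_def)
    show "isCont (\<lambda>x. pi / (2 * sqrt (x\<^sup>2 + 1) ^ 3)) x"
      using pos[of x] by (intro continuous_intros) auto
    show "0 \<le> pi / (2 * sqrt (x\<^sup>2 + 1) ^ 3)" by simp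
  next
    have l: "((\<lambda>x::real. x / sqrt (x\<^sup>2 + 1)) \<longlongrightarrow> 1) at_top" "((\<lambda>x::real. x / sqrt (x\<^sup>2 + 1)) \<longlongrightarrow> -1) at_bot"
      by real_asymp+
    show "((\<lambda>x. (pi / 2) * (x / sqrt (x\<^sup>2 + 1))) \<longlongrightarrow> pi / 2) at_top"
      using tendsto_mult_left[OF l(1), of "pi / 2"] by simp
    show "((\<lambda>x. (pi / 2) * (x / sqrt (x\<^sup>2 + 1))) \<longlongrightarrow> - (pi / 2)) at_bot"
      using tendsto_mult_left[OF l(2), of "pi / 2"] by simp
  qed
  then show ?thesis by simp
qed

lemma continuous_on_approximate_identity:
  "continuous_on UNIV (\<lambda>z::real \<times> real. 1 / ((fst z)\<^sup>2 + (snd z)\<^sup>2 + 1)\<^sup>2)"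
  by (intro continuous_intros) (use kernel_denom(1)[of 1] in \<open>auto simp: less_le\<close>)

lemma has_bochner_integral_approximate_identity:
  "has_bochner_integral lborel (\<lambda>z::real \<times> real. 1 / ((fst z)\<^sup>2 + (snd z)\<^sup>2 + 1)\<^sup>2) pi"
proof -
  let ?P = "\<lambda>z::real \<times> real. 1 / ((fst z)\<^sup>2 + (snd z)\<^sup>2 + 1)\<^sup>2"
  have m: "(\<lambda>z. ennreal (?P z)) \<in> borel_measurable (lborel \<Otimes>\<^sub>M lborel)"
    using borel_measurable_continuous_onI[OF continuous_on_approximate_identity] by (simp add: lborel_prod)
  have "(\<integral>\<^sup>+z. ?P z \<partial>lborel) = (\<integral>\<^sup>+x. \<integral>\<^sup>+y. ?P (x, y) \<partial>lborel \<partial>lborel)"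
    using lborel.nn_integral_fst[OF m] by (simp add: lborel_prod)
  also have "\<dots> = (\<integral>\<^sup>+x. pi / (2 * sqrt (x\<^sup>2 + 1) ^ 3) \<partial>lborel)"
  proof (intro nn_integral_cong)
    fix x :: real
    have p: "x\<^sup>2 + 1 > 0" by (simp add: add_nonneg_pos)
    have h: "has_bochner_integral lborel (\<lambda>y. 1 / ((sqrt (x\<^sup>2 + 1))\<^sup>2 + y\<^sup>2)\<^sup>2) (pi / (2 * sqrt (x\<^sup>2 + 1) ^ 3))"
      by (rule has_bochner_integral_inverse_quartic) (use p in simp)
    have e: "(sqrt (x\<^sup>2 + 1))\<^sup>2 + y\<^sup>2 = x\<^sup>2 + y\<^sup>2 + 1" for y using p by simp
    show "(\<integral>\<^sup>+y. ?P (x, y) \<partial>lborel) = ennreal (pi / (2 * sqrt (x\<^sup>2 + 1) ^ 3))"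
      using h unfolding e by (subst nn_integral_eq_integral) (auto simp: has_bochner_integral_iff)
  qed
  also have "\<dots> = ennreal pi"
    using has_bochner_integral_inverse_cubed_sqrt by (subst nn_integral_eq_integral) (auto simp: has_bochner_integral_iff)
  finally show ?thesis
    using borel_measurable_continuous_onI[OF continuous_on_approximate_identity]
    by (intro has_bochner_integral_nn_integral) auto
qed

lemma lborel_integral_affine:
  fixes F :: "'a::euclidean_space \<Rightarrow> complex"
  assumes "c > 0" "F \<in> borel_measurable borel"
  shows "(LINT z|lborel. F z) = (LINT u|lborel. of_real (c ^ DIM('a)) * F (w + c *\<^sub>R u))"
proof -
  have [measurable]: "F \<in> borel_measurable borel" by fact
  have "(LINT z|lborel. F z) = integral\<^sup>L (density (distr lborel borel (\<lambda>u. w + c *\<^sub>R u)) (\<lambda>_. \<bar>c\<bar> ^ DIM('a))) F"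
    using assms(1) by (subst lborel_affine[of c w]) auto
  also have "\<dots> = integral\<^sup>L (distr lborel borel (\<lambda>u. w + c *\<^sub>R u)) (\<lambda>z. (\<bar>c\<bar> ^ DIM('a)) *\<^sub>R F z)"
    by (rule integral_density) auto
  also have "\<dots> = (LINT u|lborel. (\<bar>c\<bar> ^ DIM('a)) *\<^sub>R F (w + c *\<^sub>R u))"
    by (rule integral_distr) auto
  finally show ?thesis using assms(1) by (simp add: scaleR_conv_of_real)
qed

text \<open>Substituting \<open>w + c n *\<^sub>R u\<close> for \<open>z\<close> turns the shrinking
  bump into a fixed density and moves the dependence on \<open>n\<close> into the argument of
  \<open>f\<close>. Continuity at \<open>w\<close> and dominated convergence finish the
  argument.\<close>

lemma approximate_identity_limit:
  fixes f :: "real \<times> real \<Rightarrow> complex"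
  assumes cf: "continuous_on UNIV f" and B: "\<And>z. norm (f z) \<le> B" and c: "\<And>n. c n > 0" "c \<longlonglongrightarrow> 0"
  shows "(\<lambda>n. LINT z|lborel. f z * of_real (2 * (c n)\<^sup>2 / ((fst (z - w))\<^sup>2 + (snd (z - w))\<^sup>2 + (c n)\<^sup>2)\<^sup>2)) \<longlonglongrightarrow> 2 * pi * f w"
proof -
  let ?P = "\<lambda>z::real \<times> real. 1 / ((fst z)\<^sup>2 + (snd z)\<^sup>2 + 1)\<^sup>2"
  have [measurable]: "f \<in> borel_measurable borel" using cf by (rule borel_measurable_continuous_onI)
  have P: "integrable lborel ?P" "(LINT z|lborel. ?P z) = pi"
    using has_bochner_integral_approximate_identity by (auto simp: has_bochner_integral_iff)
  have scale: "(LINT z|lborel. f z * of_real (2 * (c n)\<^sup>2 / ((fst (z - w))\<^sup>2 + (snd (z - w))\<^sup>2 + (c n)\<^sup>2)\<^sup>2))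
      = (LINT u|lborel. f (w + c n *\<^sub>R u) * of_real (2 * ?P u))" for n
  proof (subst lborel_integral_affine[OF c(1)[of n], where w = w])
    show "(\<lambda>z. f z * complex_of_real (2 * (c n)\<^sup>2 / ((fst (z - w))\<^sup>2 + (snd (z - w))\<^sup>2 + (c n)\<^sup>2)\<^sup>2)) \<in> borel_measurable borel"
      by (intro borel_measurable_continuous_onI continuous_intros cf)
         (use kernel_denom(1)[of "(c n)\<^sup>2"] c(1)[of n] in \<open>auto simp: less_le\<close>)
    have "c n ^ DIM(real \<times> real) * (2 * (c n)\<^sup>2 / ((c n * fst u)\<^sup>2 + (c n * snd u)\<^sup>2 + (c n)\<^sup>2)\<^sup>2) = 2 * ?P u" for u :: "real \<times> real"
    proof -
      have "(c n * fst u)\<^sup>2 + (c n * snd u)\<^sup>2 + (c n)\<^sup>2 = (c n)\<^sup>2 * ((fst u)\<^sup>2 + (snd u)\<^sup>2 + 1)"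
        by (simp add: power_mult_distrib algebra_simps)
      then show ?thesis using c(1)[of n] by (simp add: power_mult_distrib power2_eq_square)
    qed
    from arg_cong[OF this, of complex_of_real]
    have "complex_of_real (c n ^ DIM(real \<times> real)) * (f (w + c n *\<^sub>R u) * complex_of_real (2 * (c n)\<^sup>2 / ((fst (w + c n *\<^sub>R u - w))\<^sup>2 + (snd (w + c n *\<^sub>R u - w))\<^sup>2 + (c n)\<^sup>2)\<^sup>2))
       = f (w + c n *\<^sub>R u) * of_real (2 * ?P u)" for u
      by (simp only: of_real_mult[symmetric] mult.left_commute[of "complex_of_real _" "f _"]) simp
    then show "(LINT u|lborel. complex_of_real (c n ^ DIM(real \<times> real)) * (f (w + c n *\<^sub>R u) * complex_of_real (2 * (c n)\<^sup>2 / ((fst (w + c n *\<^sub>R u - w))\<^sup>2 + (snd (w + c n *\<^sub>R u - w))\<^sup>2 + (c n)\<^sup>2)\<^sup>2)))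
       = (LINT u|lborel. f (w + c n *\<^sub>R u) * of_real (2 * ?P u))" by simp
  qed
  have "(\<lambda>n. LINT u|lborel. f (w + c n *\<^sub>R u) * of_real (2 * ?P u)) \<longlonglongrightarrow> (LINT u|lborel. f w * of_real (2 * ?P u))"
  proof (rule integral_dominated_convergence[where w = "\<lambda>u. B * (2 * ?P u)"])
    show "integrable lborel (\<lambda>u. B * (2 * ?P u))" using P(1) by (intro integrable_mult_right)
    show "AE u in lborel. (\<lambda>n. f (w + c n *\<^sub>R u) * of_real (2 * ?P u)) \<longlonglongrightarrow> f w * of_real (2 * ?P u)"
    proof (intro AE_I2 tendsto_mult_right)
      fix u
      have "(\<lambda>n. w + c n *\<^sub>R u) \<longlonglongrightarrow> w + 0 *\<^sub>R u" by (intro tendsto_intros c)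
      moreover have "isCont f w" using cf continuous_on_eq_continuous_at open_UNIV by blast
      ultimately show "(\<lambda>n. f (w + c n *\<^sub>R u)) \<longlonglongrightarrow> f w" using isCont_tendsto_compose by fastforce
    qed
    show "AE u in lborel. norm (f (w + c n *\<^sub>R u) * of_real (2 * ?P u)) \<le> B * (2 * ?P u)" for n
    proof (intro AE_I2)
      fix u
      show "norm (f (w + c n *\<^sub>R u) * of_real (2 * ?P u)) \<le> B * (2 * ?P u)"
        unfolding norm_mult norm_of_real by (intro mult_mono B) (auto intro: order_trans[OF norm_ge_zero B])
    qed
    have m: "(\<lambda>u. h u * of_real (2 * ?P u)) \<in> borel_measurable lborel" if "continuous_on UNIV h" for h :: "real \<times> real \<Rightarrow> complex"
      using borel_measurable_continuous_onI[OF continuous_on_mult[OF that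
          continuous_on_of_real[OF continuous_on_mult_left[OF continuous_on_approximate_identity, of 2]]]]
      by simp
    show "(\<lambda>u. f w * of_real (2 * ?P u)) \<in> borel_measurable lborel" by (rule m) simp
    show "(\<lambda>u. f (w + c n *\<^sub>R u) * of_real (2 * ?P u)) \<in> borel_measurable lborel" for n
      by (rule m) (auto intro!: continuous_on_compose2[OF cf] continuous_intros)
  qed
  also have "(LINT u|lborel. f w * of_real (2 * ?P u)) = f w * of_real (2 * pi)"
    by (intro has_bochner_integral_integral_eq has_bochner_integral_mult_right has_bochner_integral_of_real
          has_bochner_integral_approximate_identity)
  finally show ?thesis unfolding scale by (simp add: mult_ac)
qed

section \<open>Local integrability of the Cauchy kernel\<close>

lemma powr_minus_half_integral_finite:
  fixes c :: real
  assumes "c > 0"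
  shows "(\<integral>\<^sup>+x. ennreal (indicator {-c..c} x * \<bar>x\<bar> powr (-1/2)) \<partial>lborel) < \<infinity>"
proof -
  have i: "(\<lambda>x::real. \<bar>x\<bar> powr (-1/2)) integrable_on {0..c}"
    by (rule integrable_eq[OF integrable_on_powr_from_0[of "-1/2" c]]) (use assms in auto)
  then have "(\<lambda>x::real. \<bar>x\<bar> powr (-1/2)) integrable_on {-c..0}"
    using Henstock_Kurzweil_Integration.integrable_reflect_real[where f = "\<lambda>x. \<bar>x\<bar> powr (-1/2)" and a = 0 and b = c] by simp
  then have "(\<lambda>x::real. \<bar>x\<bar> powr (-1/2)) integrable_on {-c..c}"
    using i assms by (intro Henstock_Kurzweil_Integration.integrable_combine[of "-c" 0 c]) auto
  then obtain J where "((\<lambda>x::real. \<bar>x\<bar> powr (-1/2)) has_integral J) {-c..c}" by blast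
  moreover have "(\<lambda>x. indicator {-c..c} x * \<bar>x\<bar> powr (-1/2)) = (\<lambda>x. if x \<in> {-c..c} then \<bar>x\<bar> powr (-1/2) else 0)"
    by (auto simp: indicator_def)
  ultimately have "((\<lambda>x. indicator {-c..c} x * \<bar>x\<bar> powr (-1/2)) has_integral J) UNIV"
    by (simp only: has_integral_restrict_UNIV)
  then have "(\<integral>\<^sup>+x. ennreal (indicator {-c..c} x * \<bar>x\<bar> powr (-1/2)) \<partial>lborel) = ennreal J"
    by (intro nn_integral_has_integral_lborel) auto
  then show ?thesis by simp
qed

text \<open>From \<open>2 |x| |y| \<le> x^2 + y^2\<close>. The point singularity is split into a
  product of two one-dimensional singularities, each of them integrable.\<close>

lemma inverse_norm_le_powr:
  assumes "x \<noteq> 0" "y \<noteq> 0"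
  shows "1 / norm (cpt (x, y)) \<le> \<bar>x\<bar> powr (-1/2) * \<bar>y\<bar> powr (-1/2)"
proof -
  have p: "\<bar>x\<bar> * \<bar>y\<bar> > 0" using assms by simp
  have "\<bar>x\<bar> * \<bar>y\<bar> \<le> (norm (cpt (x, y)))\<^sup>2"
    using sum_squares_bound[of "\<bar>x\<bar>" "\<bar>y\<bar>"] p by (simp add: norm_cpt)
  then have "sqrt (\<bar>x\<bar> * \<bar>y\<bar>) \<le> norm (cpt (x, y))" using real_le_rsqrt by (metis norm_ge_zero real_le_lsqrt real_sqrt_le_iff real_sqrt_unique)
  then have "1 / norm (cpt (x, y)) \<le> 1 / sqrt (\<bar>x\<bar> * \<bar>y\<bar>)"
    using p assms by (intro divide_left_mono mult_pos_pos) (auto simp: cpt_eq_0_iff zero_prod_def)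
  also have "\<dots> = \<bar>x\<bar> powr (-1/2) * \<bar>y\<bar> powr (-1/2)"
    using assms by (simp add: powr_minus_divide powr_half_sqrt real_sqrt_mult)
  finally show ?thesis .
qed

text \<open>Via \<open>1 / \<bar>x + i y\<bar> \<le> \<bar>x\<bar>\<^sup>-\<^sup>1\<^sup>/\<^sup>2 \<bar>y\<bar>\<^sup>-\<^sup>1\<^sup>/\<^sup>2\<close>.\<close>

lemma inverse_norm_locally_integrable:
  assumes R: "R > 0"
  obtains N :: real where "\<And>w. w \<in> square R \<Longrightarrow>
    (\<integral>\<^sup>+z. ennreal (indicator (square R) z / norm (cpt (z - w))) \<partial>lborel) \<le> ennreal N"
proof -
  \<comment> \<open>Differences of two points of \<open>square R\<close> lie in
    \<open>square (2 * R)\<close>. By translation invariance one integral around the origin then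
    bounds all of them, which makes \<open>N\<close> independent of \<open>w\<close>.\<close>
  define c where "c = 2 * R"
  let ?s = "\<lambda>x. ennreal (indicator {-c..c} x * \<bar>x\<bar> powr (-1/2))"
  let ?k = "\<lambda>u. ennreal (indicator (square c) u / norm (cpt u))"
  have [measurable]: "cpt \<in> borel_measurable borel"
    by (intro borel_measurable_continuous_onI continuous_intros)
  have [measurable]: "square r \<in> sets borel" for r by (simp add: square_def)
  have m: "?k \<in> borel_measurable (lborel \<Otimes>\<^sub>M lborel)" by (simp add: lborel_prod)
  define S where "S = (\<integral>\<^sup>+x. ?s x \<partial>lborel)"
  have S: "S < \<infinity>" unfolding S_def by (rule powr_minus_half_integral_finite) (use R c_def in auto)
  have "(\<integral>\<^sup>+u. ?k u \<partial>lborel) = (\<integral>\<^sup>+x. \<integral>\<^sup>+y. ?k (x, y) \<partial>lborel \<partial>lborel)"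
    using lborel.nn_integral_fst[OF m] by (simp add: lborel_prod)
  also have "\<dots> \<le> (\<integral>\<^sup>+x. \<integral>\<^sup>+y. ?s x * ?s y \<partial>lborel \<partial>lborel)"
  proof (rule nn_integral_mono_AE)
    show "AE x in lborel. (\<integral>\<^sup>+y. ?k (x, y) \<partial>lborel) \<le> (\<integral>\<^sup>+y. ?s x * ?s y \<partial>lborel)"
      using AE_lborel_singleton[of 0]
    proof eventually_elim
      case (elim x)
      show ?case
      proof (rule nn_integral_mono_AE)
        show "AE y in lborel. ?k (x, y) \<le> ?s x * ?s y"
          using AE_lborel_singleton[of 0]
        proof eventually_elim
          case (elim y)
          then show ?case
            using inverse_norm_le_powr[OF \<open>x \<noteq> 0\<close> \<open>y \<noteq> 0\<close>]
            by (auto simp: indicator_def mem_square ennreal_mult[symmetric] abs_le_iff intro!: ennreal_leI)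
        qed
      qed
    qed
  qed
  also have "\<dots> = S * S"
    by (simp add: nn_integral_cmult nn_integral_multc S_def)
  also have "\<dots> < \<infinity>" using S by (simp add: ennreal_mult_less_top)
  finally obtain N where N: "(\<integral>\<^sup>+u. ?k u \<partial>lborel) = ennreal N" "0 \<le> N" by (cases "\<integral>\<^sup>+u. ?k u \<partial>lborel") auto
  show ?thesis
  proof (rule that[of N])
    fix w :: "real \<times> real" assume w: "w \<in> square R"
    have "(\<integral>\<^sup>+z. ennreal (indicator (square R) z / norm (cpt (z - w))) \<partial>lborel)
        \<le> (\<integral>\<^sup>+z. ?k (- w + z) \<partial>lborel)"
    proof (rule nn_integral_mono)
      fix z
      show "ennreal (indicator (square R) z / norm (cpt (z - w))) \<le> ?k (- w + z)"
        using w by (auto simp: indicator_def mem_square c_def abs_le_iff intro!: ennreal_leI)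
    qed
    also have "\<dots> = (\<integral>\<^sup>+u. ?k u \<partial>distr lborel borel ((+) (- w)))"
      by (subst nn_integral_distr) auto
    also have "\<dots> = ennreal N" by (simp only: lborel_distr_plus N)
    finally show "(\<integral>\<^sup>+z. ennreal (indicator (square R) z / norm (cpt (z - w))) \<partial>lborel) \<le> ennreal N" .
  qed
qed

section \<open>The Cauchy--Pompeiu formula\<close>

lemma Ck_1_partials:
  fixes f :: "real \<times> real \<Rightarrow> complex"
  assumes "Ck 1 f"
  shows "continuous_on UNIV f" "continuous_on UNIV (partial (1, 0) f)" "continuous_on UNIV (partial (0, 1) f)"
    "((\<lambda>x. f (x, y)) has_vector_derivative partial (1, 0) f (x, y)) (at x)"
    "((\<lambda>y. f (x, y)) has_vector_derivative partial (0, 1) f (x, y)) (at y)"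
proof -
  have f: "Ck (Suc 0) f" using assms by simp
  show "continuous_on UNIV f" using Ck_SucD[OF f] by simp
  show "continuous_on UNIV (partial (1, 0) f)" "continuous_on UNIV (partial (0, 1) f)"
    using f by (auto simp: Basis_prod_def)
  have D: "(f has_derivative (\<lambda>b. partial b f z)) (at z)" for z
    using f by (rule Ck_has_derivative)
  have hom: "partial (r *\<^sub>R b) f z = r *\<^sub>R partial b f z" for r b z
    using linear_cmul[OF has_derivative_linear[OF D]] .
  have "((\<lambda>x. (x, y)) has_derivative (\<lambda>h. (h, 0))) (at x)"
    by (auto intro!: derivative_eq_intros)
  from has_derivative_compose[OF this D] show "((\<lambda>x. f (x, y)) has_vector_derivative partial (1, 0) f (x, y)) (at x)"
    unfolding has_vector_derivative_def hom[symmetric] by simp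
  have "((\<lambda>y. (x, y)) has_derivative (\<lambda>h. (0, h))) (at y)"
    by (auto intro!: derivative_eq_intros)
  from has_derivative_compose[OF this D] show "((\<lambda>y. f (x, y)) has_vector_derivative partial (0, 1) f (x, y)) (at y)"
    unfolding has_vector_derivative_def hom[symmetric] by simp
qed

lemma partial_cong_open:
  assumes "open S" "z \<in> S" "\<And>y. y \<in> S \<Longrightarrow> f y = g y" "g differentiable (at z)"
  shows "partial b f z = partial b g z"
proof -
  have "(g has_derivative (\<lambda>b. partial b g z)) (at z)" using assms(4) by (rule has_derivative_frechet)
  then have "(f has_derivative (\<lambda>b. partial b g z)) (at z)"
    by (rule has_derivative_transform_within_open[OF _ assms(1,2)]) (simp add: assms(3))
  then show ?thesis by (rule partial_eq)
qed

lemma open_Compl_square: "open (- square R)"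
  unfolding square_def by (intro open_Compl closed_cbox)

lemma partial_outside_square:
  assumes "vanishes_outside R f" "z \<notin> square R"
  shows "partial b f z = 0"
proof -
  have "partial b f z = partial b (\<lambda>_. 0) z"
    using assms by (intro partial_cong_open[OF open_Compl_square]) (auto simp: vanishes_outside_def)
  also have "\<dots> = 0" by (rule partial_eq) simp
  finally show ?thesis .
qed

definition two_dbar :: "(real \<times> real \<Rightarrow> complex) \<Rightarrow> real \<times> real \<Rightarrow> complex" where
  "two_dbar f z = partial (1, 0) f z + \<i> * partial (0, 1) f z"

lemma two_dbar_props:
  assumes "Ck 1 f" "vanishes_outside R f"
  shows "continuous_on UNIV (two_dbar f)" "vanishes_outside R (two_dbar f)"
  using Ck_1_partials(2,3)[OF assms(1)] partial_outside_square[OF assms(2)]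
  unfolding two_dbar_def vanishes_outside_def by (auto intro!: continuous_intros)

lemma bounded_vanishing_outside_square:
  fixes h :: "real \<times> real \<Rightarrow> complex"
  assumes "continuous_on UNIV h" "vanishes_outside R h"
  obtains M where "M \<ge> 0" "\<And>z. norm (h z) \<le> M"
proof -
  have "compact (h ` square R)"
    using assms(1) unfolding square_def by (intro compact_continuous_image compact_cbox) (rule continuous_on_subset, auto)
  from compact_imp_bounded[OF this] obtain M where M: "\<And>z. z \<in> square R \<Longrightarrow> norm (h z) \<le> M"
    unfolding bounded_iff by blast
  have "norm (h z) \<le> max M 0" for z
    using M[of z] vanishes_outsideD[OF assms(2), of z] by (cases "z \<in> square R") auto
  then show ?thesis using that[of "max M 0"] by auto
qed

text \<open>The product of \<open>f\<close> with the smooth kernel vanishes on the edges of the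
  square, so both of its partial derivatives have integral zero. Adding \<open>i\<close> times the
  second to the first and applying the product rule leaves exactly the term computed in
  \<open>kernel_dbar\<close>.\<close>

lemma cauchy_kernel_identity:
  fixes f :: "real \<times> real \<Rightarrow> complex"
  assumes f: "Ck 1 f" and R: "R > 0" and supp: "\<forall>z. R \<le> \<bar>fst z\<bar> \<or> R \<le> \<bar>snd z\<bar> \<longrightarrow> f z = 0" and e: "e > 0"
  shows "(LINT z|lborel. two_dbar f z * cauchy_kernel e (z - w)) =
     - (LINT z|lborel. f z * of_real (2 * e / ((fst (z - w))\<^sup>2 + (snd (z - w))\<^sup>2 + e)\<^sup>2))"
proof -
  note c = Ck_1_partials[OF f]
  have supp': "vanishes_outside R f" using supp by (auto simp: vanishes_outside_def mem_square)
  note p0 = partial_outside_square[OF supp']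
  let ?K = "\<lambda>z. cauchy_kernel e (z - w)" and ?Kx = "\<lambda>z. cauchy_kernel_x e (z - w)" and ?Ky = "\<lambda>z. cauchy_kernel_y e (z - w)"
  have cK: "continuous_on UNIV ?K" "continuous_on UNIV ?Kx" "continuous_on UNIV ?Ky"
    by (rule continuous_on_compose2[OF continuous_on_kernel(1)[OF e]] continuous_on_compose2[OF continuous_on_kernel(2)[OF e]]
        continuous_on_compose2[OF continuous_on_kernel(3)[OF e]]; auto intro!: continuous_intros)+
  let ?hx = "\<lambda>z. f z * ?Kx z + partial (1, 0) f z * ?K z" and ?hy = "\<lambda>z. f z * ?Ky z + partial (0, 1) f z * ?K z"
  have chx: "continuous_on UNIV ?hx" and chy: "continuous_on UNIV ?hy"
    by (intro continuous_intros c cK)+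
  have zx: "vanishes_outside R ?hx" and zy: "vanishes_outside R ?hy"
    using vanishes_outsideD[OF supp'] p0 by (auto simp: vanishes_outside_def)
  have Dx: "((\<lambda>x. f (x, y) * ?K (x, y)) has_vector_derivative ?hx (x, y)) (at x)" for x y
    using kernel_derivatives(1)[OF e, of "fst w" "y - snd w" x]
    by (intro has_vector_derivative_mult c) (cases w, simp)
  have Dy: "((\<lambda>y. f (x, y) * ?K (x, y)) has_vector_derivative ?hy (x, y)) (at y)" for x y
    using kernel_derivatives(2)[OF e, of "x - fst w" "snd w" y]
    by (intro has_vector_derivative_mult c) (cases w, simp)
  have "(LINT z|lborel. ?hx z) = 0"
    by (rule integral_x_derivative_0[OF R, where h = "\<lambda>z. f z * ?K z"]) (use supp Dx chx zx in auto)
  moreover have "(LINT z|lborel. ?hy z) = 0"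
    by (rule integral_y_derivative_0[OF R, where h = "\<lambda>z. f z * ?K z"]) (use supp Dy chy zy in auto)
  ultimately have "0 = (LINT z|lborel. ?hx z) + \<i> * (LINT z|lborel. ?hy z)" by simp
  also have "\<dots> = (LINT z|lborel. ?hx z + \<i> * ?hy z)"
    using integrable_vanishing_outside_square(1)[OF chx zx] integrable_vanishing_outside_square(1)[OF chy zy] by simp
  also have "(\<lambda>z. ?hx z + \<i> * ?hy z) = (\<lambda>z. two_dbar f z * ?K z + f z * (?Kx z + \<i> * ?Ky z))"
    by (auto simp: two_dbar_def algebra_simps)
  also have "(LINT z|lborel. two_dbar f z * ?K z + f z * (?Kx z + \<i> * ?Ky z)) =
      (LINT z|lborel. two_dbar f z * ?K z) + (LINT z|lborel. f z * (?Kx z + \<i> * ?Ky z))"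
    by (intro Bochner_Integration.integral_add integrable_vanishing_outside_square(1)[of _ R] continuous_intros c cK
        two_dbar_props[OF f supp']) (use vanishes_outsideD[OF supp'] vanishes_outsideD[OF two_dbar_props(2)[OF f supp']] in \<open>auto simp: vanishes_outside_def\<close>)
  finally show ?thesis unfolding kernel_dbar[OF e] by (simp add: eq_neg_iff_add_eq_0)
qed

text \<open>Limit of \<open>cauchy_kernel_identity\<close> along \<open>e = (c n)^2\<close>: the
  left side converges by dominated convergence, with the locally integrable bound
  \<open>M / |z - w|\<close>, and the right side by the approximate identity.\<close>

lemma cauchy_pompeiu:
  fixes f :: "real \<times> real \<Rightarrow> complex"
  assumes f: "Ck 1 f" and R: "R > 0" and supp: "\<forall>z. R \<le> \<bar>fst z\<bar> \<or> R \<le> \<bar>snd z\<bar> \<longrightarrow> f z = 0"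
    and w: "w \<in> square R"
  shows "(LINT z|lborel. two_dbar f z / cpt (z - w)) = - 2 * pi * f w"
proof -
  have supp': "vanishes_outside R f" using supp by (auto simp: vanishes_outside_def mem_square)
  note db = two_dbar_props[OF f supp']
  obtain M where M: "M \<ge> 0" "\<And>z. norm (two_dbar f z) \<le> M"
    using bounded_vanishing_outside_square[OF db] by blast
  obtain B where B: "\<And>z. norm (f z) \<le> B"
    using bounded_vanishing_outside_square[OF Ck_1_partials(1)[OF f] supp'] by blast
  define c where "c n = 1 / (real n + 1)" for n
  have c: "\<And>n. c n > 0" "c \<longlonglongrightarrow> 0" unfolding c_def by (simp_all add: LIMSEQ_inverse_real_of_nat_add[of 0, simplified inverse_eq_divide])
     (use LIMSEQ_inverse_real_of_nat in \<open>simp add: inverse_eq_divide add.commute\<close>)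
  have lim1: "(\<lambda>n. - (LINT z|lborel. two_dbar f z * cauchy_kernel ((c n)\<^sup>2) (z - w))) \<longlonglongrightarrow> 2 * pi * f w"
    unfolding cauchy_kernel_identity[OF f R supp zero_less_power[OF c(1)]] minus_minus
    by (rule approximate_identity_limit[OF Ck_1_partials(1)[OF f] B c])
  have [measurable]: "cpt \<in> borel_measurable borel"
    by (intro borel_measurable_continuous_onI continuous_intros)
  have [measurable]: "two_dbar f \<in> borel_measurable borel" using db(1) by (rule borel_measurable_continuous_onI)
  have [measurable]: "square r \<in> sets borel" for r by (simp add: square_def)
  obtain N :: real where N: "(\<integral>\<^sup>+z. ennreal (indicator (square R) z / norm (cpt (z - w))) \<partial>lborel) \<le> ennreal N"
    using inverse_norm_locally_integrable[OF R] w by blast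
  have iN: "integrable lborel (\<lambda>z. M * (indicator (square R) z / norm (cpt (z - w))))"
  proof (intro integrable_mult_right integrableI_bounded)
    show "(\<lambda>z. indicator (square R) z / norm (cpt (z - w))) \<in> borel_measurable lborel" by measurable
    have "(\<integral>\<^sup>+z. ennreal (norm (indicator (square R) z / norm (cpt (z - w)))) \<partial>lborel)
       = (\<integral>\<^sup>+z. ennreal (indicator (square R) z / norm (cpt (z - w))) \<partial>lborel)" by simp
    also have "\<dots> < \<infinity>" using N by (rule le_less_trans) simp
    finally show "(\<integral>\<^sup>+z. ennreal (norm (indicator (square R) z / norm (cpt (z - w)))) \<partial>lborel) < \<infinity>" .
  qed
  have "(\<lambda>n. LINT z|lborel. two_dbar f z * cauchy_kernel ((c n)\<^sup>2) (z - w)) \<longlonglongrightarrow> (LINT z|lborel. two_dbar f z / cpt (z - w))"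
  proof (rule integral_dominated_convergence[OF _ _ iN])
    show "(\<lambda>z. two_dbar f z / cpt (z - w)) \<in> borel_measurable lborel" by measurable
    have "continuous_on UNIV (\<lambda>z. two_dbar f z * cauchy_kernel ((c n)\<^sup>2) (z - w))" for n
      using c(1)[of n] by (intro continuous_intros db continuous_on_compose2[OF continuous_on_kernel(1)]) auto
    then have "(\<lambda>z. two_dbar f z * cauchy_kernel ((c n)\<^sup>2) (z - w)) \<in> borel_measurable borel" for n
      by (rule borel_measurable_continuous_onI)
    then show "(\<lambda>z. two_dbar f z * cauchy_kernel ((c n)\<^sup>2) (z - w)) \<in> borel_measurable lborel" for n
      by simp
    show "AE z in lborel. (\<lambda>n. two_dbar f z * cauchy_kernel ((c n)\<^sup>2) (z - w)) \<longlonglongrightarrow> two_dbar f z / cpt (z - w)"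
    proof (rule AE_I2)
      fix z
      show "(\<lambda>n. two_dbar f z * cauchy_kernel ((c n)\<^sup>2) (z - w)) \<longlonglongrightarrow> two_dbar f z / cpt (z - w)"
      \<comment> \<open>At \<open>z = w\<close> the kernel is 0, and so is the quotient by the
        convention for division by zero.\<close>
      proof (cases "z = w")
        case True
        then show ?thesis by (simp add: cauchy_kernel_def cpt_eq)
      next
        case False
        then have nz: "cpt (z - w) \<noteq> 0" by (simp add: cpt_eq_0_iff)
        have n2: "(fst (z - w))\<^sup>2 + (snd (z - w))\<^sup>2 = (norm (cpt (z - w)))\<^sup>2" by (simp add: norm_cpt)
        have "(\<lambda>n. two_dbar f z * (cnj (cpt (z - w)) / of_real ((norm (cpt (z - w)))\<^sup>2 + (c n)\<^sup>2))) \<longlonglongrightarrow>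
           two_dbar f z * (cnj (cpt (z - w)) / of_real ((norm (cpt (z - w)))\<^sup>2 + 0\<^sup>2))"
          using nz by (intro tendsto_intros c) auto
        also have "cnj (cpt (z - w)) / of_real ((norm (cpt (z - w)))\<^sup>2 + 0\<^sup>2) = 1 / cpt (z - w)"
          using nz complex_norm_square[of "cpt (z - w)"] by (simp add: field_simps)
        finally show ?thesis unfolding cauchy_kernel_def n2 by simp
      qed
    qed
    show "AE z in lborel. norm (two_dbar f z * cauchy_kernel ((c n)\<^sup>2) (z - w)) \<le> M * (indicator (square R) z / norm (cpt (z - w)))" for n
    proof (rule AE_I2)
      fix z
      show "norm (two_dbar f z * cauchy_kernel ((c n)\<^sup>2) (z - w)) \<le> M * (indicator (square R) z / norm (cpt (z - w)))"
      proof (cases "z \<in> square R")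
        case True
        have "norm (cauchy_kernel ((c n)\<^sup>2) (z - w)) \<le> 1 / norm (cpt (z - w))"
          using c(1)[of n] by (intro norm_kernel_le) simp
        then show ?thesis using True M unfolding norm_mult by (intro mult_mono) auto
      qed (simp add: vanishes_outsideD[OF db(2)])
    qed
  qed
  from tendsto_minus[OF this] have "- (LINT z|lborel. two_dbar f z / cpt (z - w)) = 2 * pi * f w"
    using lim1 LIMSEQ_unique by blast
  then show ?thesis by (simp add: minus_equation_iff)
qed

text \<open>Cauchy--Pompeiu on the curve and Fubini turn the line integral into an area integral weighted by
  the inner integral, which is a winding number.\<close>

lemma curve_integral_two_dbar:
  fixes f :: "real \<times> real \<Rightarrow> complex" and \<gamma>' :: "real \<Rightarrow> complex"
  assumes f: "Ck 1 f" and R: "R > 0" and supp: "\<forall>z. R \<le> \<bar>fst z\<bar> \<or> R \<le> \<bar>snd z\<bar> \<longrightarrow> f z = 0"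
    and ab: "a \<le> b" and \<gamma>: "continuous_on {a..b} \<gamma>" "continuous_on {a..b} \<gamma>'" "\<And>t. t \<in> {a..b} \<Longrightarrow> \<gamma> t \<in> square R"
  shows "integrable lborel (\<lambda>z. two_dbar f z * (LINT t:{a..b}|lborel. \<gamma>' t / (cpt z - cpt (\<gamma> t))))" (is ?int)
    and "- 2 * pi * integral {a..b} (\<lambda>t. f (\<gamma> t) * \<gamma>' t) =
      (LINT z|lborel. two_dbar f z * (LINT t:{a..b}|lborel. \<gamma>' t / (cpt z - cpt (\<gamma> t))))" (is ?eq)
proof -
  have supp': "vanishes_outside R f" using supp by (auto simp: vanishes_outside_def mem_square)
  note db = two_dbar_props[OF f supp']
  obtain M where M: "M \<ge> 0" "\<And>z. norm (two_dbar f z) \<le> M"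
    using bounded_vanishing_outside_square[OF db] by blast
  \<comment> \<open>Clamping to the interval extends \<open>\<gamma>\<close> and
    \<open>\<gamma>'\<close> continuously to the whole line, which makes the integrand on the
    product space measurable.\<close>
  define cl where "cl t = max a (min b t)" for t
  have cl: "cl t \<in> {a..b}" for t using ab by (auto simp: cl_def)
  have cl_id: "cl t = t" if "t \<in> {a..b}" for t using that by (auto simp: cl_def)
  have ccl: "continuous_on UNIV cl" unfolding cl_def by (intro continuous_intros)
  define \<eta> where "\<eta> t = \<gamma> (cl t)" for t
  define \<eta>' where "\<eta>' t = \<gamma>' (cl t)" for t
  have c\<eta>: "continuous_on UNIV \<eta>" "continuous_on UNIV \<eta>'"
    unfolding \<eta>_def \<eta>'_def using cl by (auto intro!: continuous_on_compose2[OF \<gamma>(1) ccl] continuous_on_compose2[OF \<gamma>(2) ccl])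
  have [measurable]: "\<eta> \<in> borel_measurable borel" "\<eta>' \<in> borel_measurable borel"
    using c\<eta> by (auto intro: borel_measurable_continuous_onI)
  have [measurable]: "cpt \<in> borel_measurable borel"
    by (intro borel_measurable_continuous_onI continuous_intros)
  have [measurable]: "two_dbar f \<in> borel_measurable borel" using db(1) by (rule borel_measurable_continuous_onI)
  have [measurable]: "square r \<in> sets borel" for r by (simp add: square_def)
  have "compact (\<gamma>' ` {a..b})" using \<gamma>(2) by (intro compact_continuous_image) auto
  from compact_imp_bounded[OF this] obtain M' where M': "\<And>t. t \<in> {a..b} \<Longrightarrow> norm (\<gamma>' t) \<le> M'"
    unfolding bounded_iff by blast
  have M'0: "M' \<ge> 0" using M'[of a] ab order_trans[OF norm_ge_zero] by auto
  obtain N :: real where N: "\<And>w. w \<in> square R \<Longrightarrow> (\<integral>\<^sup>+z. ennreal (indicator (square R) z / norm (cpt (z - w))) \<partial>lborel) \<le> ennreal N"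
    by (rule inverse_norm_locally_integrable[OF R]) (rule that)
  let ?\<Phi> = "\<lambda>t z. indicator {a..b} t * \<eta>' t * (two_dbar f z / (cpt z - cpt (\<eta> t)))"
  have m: "case_prod ?\<Phi> \<in> borel_measurable (lborel \<Otimes>\<^sub>M lborel)"
    unfolding case_prod_unfold by measurable
  \<comment> \<open>Absolute integrability by Tonelli: the inner area integral is bounded by the
    same \<open>N\<close> for every point of the curve.\<close>
  have int: "integrable (lborel \<Otimes>\<^sub>M lborel) (case_prod ?\<Phi>)"
  proof (rule integrableI_bounded[OF m])
    have "(\<integral>\<^sup>+p. ennreal (norm (case_prod ?\<Phi> p)) \<partial>(lborel \<Otimes>\<^sub>M lborel))
        = (\<integral>\<^sup>+t. \<integral>\<^sup>+z. ennreal (norm (?\<Phi> t z)) \<partial>lborel \<partial>lborel)"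
      using lborel.nn_integral_fst[of "\<lambda>p. ennreal (norm (case_prod ?\<Phi> p))" lborel] m by simp
    also have "\<dots> \<le> (\<integral>\<^sup>+t. ennreal (M' * M * N) * indicator {a..b} t \<partial>lborel)"
    proof (rule nn_integral_mono)
      fix t
      show "(\<integral>\<^sup>+z. ennreal (norm (?\<Phi> t z)) \<partial>lborel) \<le> ennreal (M' * M * N) * indicator {a..b} t"
      proof (cases "t \<in> {a..b}")
        case True
        have "(\<integral>\<^sup>+z. ennreal (norm (?\<Phi> t z)) \<partial>lborel) \<le>
            (\<integral>\<^sup>+z. ennreal (M' * M) * ennreal (indicator (square R) z / norm (cpt (z - \<eta> t))) \<partial>lborel)"
        proof (rule nn_integral_mono)
          fix z
          have "norm (?\<Phi> t z) \<le> M' * M * (indicator (square R) z / norm (cpt (z - \<eta> t)))"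
          proof (cases "z \<in> square R")
            case z: True
            have "norm (?\<Phi> t z) = norm (\<gamma>' t) * (norm (two_dbar f z) / norm (cpt (z - \<eta> t)))"
              using True by (simp add: norm_mult norm_divide \<eta>'_def cl_id cpt_diff)
            also have "\<dots> \<le> M' * (M / norm (cpt (z - \<eta> t)))"
              using M M' True M'0 by (intro mult_mono divide_right_mono) auto
            finally show ?thesis using z by simp
          qed (simp add: vanishes_outsideD[OF db(2)])
          then show "ennreal (norm (?\<Phi> t z)) \<le> ennreal (M' * M) * ennreal (indicator (square R) z / norm (cpt (z - \<eta> t)))"
            using M M'0 by (subst ennreal_mult[symmetric]) (auto intro!: ennreal_leI)
        qed
        also have "\<dots> = ennreal (M' * M) * (\<integral>\<^sup>+z. ennreal (indicator (square R) z / norm (cpt (z - \<eta> t))) \<partial>lborel)"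
          by (rule nn_integral_cmult) measurable
        also have "\<dots> \<le> ennreal (M' * M) * ennreal N"
          using \<gamma>(3) cl by (intro mult_left_mono N) (auto simp: \<eta>_def)
        also have "\<dots> = ennreal (M' * M * N)" using M M'0 by (intro ennreal_mult'[symmetric]) auto
        finally show ?thesis using True by simp
      qed simp
    qed
    also have "\<dots> < \<infinity>" using ab by (simp add: nn_integral_cmult ennreal_mult_less_top)
    finally show "(\<integral>\<^sup>+p. ennreal (norm (case_prod ?\<Phi> p)) \<partial>(lborel \<Otimes>\<^sub>M lborel)) < \<infinity>" .
  qed
  have eq: "(\<lambda>z. LINT t|lborel. ?\<Phi> t z) = (\<lambda>z. two_dbar f z * (LINT t:{a..b}|lborel. \<gamma>' t / (cpt z - cpt (\<gamma> t))))"
  proof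
    fix z
    have "(LINT t|lborel. ?\<Phi> t z) = (LINT t|lborel. two_dbar f z * (indicator {a..b} t *\<^sub>R (\<gamma>' t / (cpt z - cpt (\<gamma> t)))))"
      by (intro Bochner_Integration.integral_cong refl) (auto simp: indicator_def \<eta>_def \<eta>'_def cl_id)
    then show "(LINT t|lborel. ?\<Phi> t z) = two_dbar f z * (LINT t:{a..b}|lborel. \<gamma>' t / (cpt z - cpt (\<gamma> t)))"
      unfolding set_lebesgue_integral_def by (simp only: integral_mult_right_zero)
  qed
  show ?int
    using lborel_pair.integrable_snd[OF int] unfolding eq .
  have "(LINT z|lborel. LINT t|lborel. ?\<Phi> t z) = (LINT t|lborel. LINT z|lborel. ?\<Phi> t z)"
    by (rule lborel_pair.Fubini_integral[OF int])
  also have "(\<lambda>t. LINT z|lborel. ?\<Phi> t z) = (\<lambda>t. indicator {a..b} t *\<^sub>R (- 2 * pi * (f (\<gamma> t) * \<gamma>' t)))"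
  proof
    fix t
    have "(LINT z|lborel. ?\<Phi> t z) = indicator {a..b} t * \<eta>' t * (LINT z|lborel. two_dbar f z / cpt (z - \<eta> t))"
      unfolding cpt_diff by (rule integral_mult_right_zero)
    also have "\<dots> = indicator {a..b} t *\<^sub>R (- 2 * pi * (f (\<gamma> t) * \<gamma>' t))"
    proof (cases "t \<in> {a..b}")
      case True
      then show ?thesis
        using cauchy_pompeiu[OF f R supp, of "\<eta> t"] \<gamma>(3)[OF cl, of t] by (simp add: \<eta>_def \<eta>'_def cl_id)
    qed simp
    finally show "(LINT z|lborel. ?\<Phi> t z) = indicator {a..b} t *\<^sub>R (- 2 * pi * (f (\<gamma> t) * \<gamma>' t))" .
  qed
  also have "(LINT t|lborel. indicator {a..b} t *\<^sub>R (- 2 * pi * (f (\<gamma> t) * \<gamma>' t))) = - 2 * pi * integral {a..b} (\<lambda>t. f (\<gamma> t) * \<gamma>' t)"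
  proof -
    have "continuous_on {a..b} (\<lambda>t. - 2 * pi * (f (\<gamma> t) * \<gamma>' t))"
      using Ck_1_partials(1)[OF f] by (intro continuous_intros continuous_on_compose2[OF _ \<gamma>(1)] \<gamma>(2)) auto
    from set_borel_integral_eq_integral(2)[OF borel_integrable_atLeastAtMost'[OF this]] show ?thesis
      by (simp add: set_lebesgue_integral_def)
  qed
  finally show ?eq unfolding eq by simp
qed

text \<open>Winding numbers are constant on connected sets off the path and vanish far away; an
  unbounded set reaches that far.\<close>

lemma winding_number_unbounded_component:
  assumes "path q" "pathfinish q = pathstart q" "connected C" "\<not> bounded C" "C \<inter> path_image q = {}" "z \<in> C"
  shows "winding_number q z = 0"
proof -
  obtain B where B: "\<And>z. B \<le> norm z \<Longrightarrow> winding_number q z = 0"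
    using winding_number_zero_at_infinity[OF assms(1,2)] by blast
  obtain w where w: "w \<in> C" "B \<le> norm w"
    using assms(4) unfolding bounded_iff by (meson le_cases)
  have "winding_number q z = winding_number q w"
    by (rule winding_number_eq[OF assms(1,2) assms(6) w(1) assms(3,5)])
  then show ?thesis using B[OF w(2)] by simp
qed

lemma bounded_subset_square:
  fixes S :: "(real \<times> real) set"
  assumes "bounded S"
  obtains R where "R > 0" "S \<subseteq> square R"
proof -
  obtain B where B: "\<And>z. z \<in> S \<Longrightarrow> norm z \<le> B" using assms by (auto simp: bounded_iff)
  show ?thesis
  proof (rule that[of "max B 1"])
    show "S \<subseteq> square (max B 1)"
    proof
      fix z assume "z \<in> S"
      then have "norm z \<le> B" by (rule B)
      moreover have "\<bar>fst z\<bar> \<le> norm z" "\<bar>snd z\<bar> \<le> norm z"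
        using norm_fst_le[of "fst z" "snd z"] norm_snd_le[of "snd z" "fst z"] by auto
      ultimately show "z \<in> square (max B 1)" by (auto simp: mem_square)
    qed
  qed auto
qed

text \<open>The cut-off is 1 with a margin around \<open>S\<close>. Its vanishing from
  \<open>R + 2\<close> on is stated with a non-strict inequality, the form in which the
  Cauchy--Pompeiu lemmas expect a function that is zero on the edges too.\<close>

lemma cutoff_exists:
  fixes S :: "(real \<times> real) set"
  assumes "bounded S"
  obtains R \<eta> where "R > 0" "S \<subseteq> square R" "\<And>n. Ck n \<eta>"
    "\<And>z. z \<in> square (R + 1) \<Longrightarrow> \<eta> z = 1"
    "\<forall>z. R + 2 \<le> \<bar>fst z\<bar> \<or> R + 2 \<le> \<bar>snd z\<bar> \<longrightarrow> \<eta> z = 0"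
proof -
  obtain R where R: "R > 0" "S \<subseteq> square R" using bounded_subset_square[OF assms] by blast
  obtain \<eta> :: "real \<times> real \<Rightarrow> complex" where \<eta>: "\<And>n. Ck n \<eta>"
    "\<And>z. \<bar>fst z\<bar> \<le> R + 1 \<Longrightarrow> \<bar>snd z\<bar> \<le> R + 1 \<Longrightarrow> \<eta> z = 1"
    "\<And>z. R + 1 + 1 \<le> \<bar>fst z\<bar> \<or> R + 1 + 1 \<le> \<bar>snd z\<bar> \<Longrightarrow> \<eta> z = 0"
    by (rule smooth_cutoff[of "R + 1"]) (rule that)
  show ?thesis
    by (rule that[OF R \<eta>(1)]) (use \<eta>(2,3) in \<open>auto simp: mem_square add.assoc\<close>)
qed

section \<open>Winding numbers and Green's theorem for a closed curve\<close>

context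
  fixes p :: "real \<Rightarrow> real \<times> real" and d :: "real \<Rightarrow> complex"
  assumes simple: "simple_path p" and closed_p: "pathfinish p = pathstart p" and ccw: "counterclockwise p"
    and deriv_p: "\<And>s. s \<in> {0..1} \<Longrightarrow> ((\<lambda>s. cpt (p s)) has_vector_derivative d s) (at s within {0..1})"
    and cont_d: "continuous_on {0..1} d"
begin

text \<open>A differentiable image of an interval is negligible in the plane. The singular inner
  integral therefore only has to be evaluated off the curve.\<close>

lemma AE_not_on_curve: "AE z in lborel. z \<notin> path_image p"
proof -
  have "(\<lambda>s. (Re (cpt (p s)), Im (cpt (p s)))) differentiable_on {0..1}"
    unfolding differentiable_on_def
  proof
    fix s :: real assume "s \<in> {0..1}"
    from deriv_p[OF this] have D: "((\<lambda>s. cpt (p s)) has_derivative (\<lambda>h. h *\<^sub>R d s)) (at s within {0..1})"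
      by (simp add: has_vector_derivative_def)
    have "((\<lambda>s. (Re (cpt (p s)), Im (cpt (p s)))) has_derivative (\<lambda>h. (Re (h *\<^sub>R d s), Im (h *\<^sub>R d s)))) (at s within {0..1})"
      by (intro has_derivative_Pair bounded_linear.has_derivative[OF bounded_linear_Re D] bounded_linear.has_derivative[OF bounded_linear_Im D])
    then show "(\<lambda>s. (Re (cpt (p s)), Im (cpt (p s)))) differentiable at s within {0..1}"
      by (rule differentiableI)
  qed
  then have "negligible ((\<lambda>s. (Re (cpt (p s)), Im (cpt (p s)))) ` {0..1})"
    by (rule negligible_differentiable_image_lowdim[rotated]) simp
  moreover have "(\<lambda>s. (Re (cpt (p s)), Im (cpt (p s)))) ` {0..1} = path_image p"
    by (simp add: cpt_def path_image_def)
  ultimately have "path_image p \<in> null_sets lebesgue" by (simp add: negligible_iff_null_sets)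
  moreover have "path_image p \<in> sets borel"
    using compact_path_image[OF simple_path_imp_path[OF simple]] by (intro borel_closed compact_imp_closed)
  ultimately have "path_image p \<in> null_sets lborel" by (simp add: null_sets_completion_iff)
  then show ?thesis by (rule AE_not_in)
qed

text \<open>The minus sign is due to the kernel \<open>1 / (z - w)\<close>, opposite to the usual
  one. The orientation gives winding number 1 inside; every other point off the curve lies in an
  unbounded component and gets 0.\<close>

lemma winding_number_curve:
  assumes z: "z \<notin> path_image p"
  shows "(LINT s:{0..1}|lborel. d s / (cpt z - cpt (p s))) = - 2 * pi * \<i> * indicator (inside (path_image p)) z"
proof -
  define q where "q = (\<lambda>s. cpt (p s))"
  have imq: "path_image q = cpt ` path_image p" by (auto simp: q_def path_image_def)
  have inj: "cpt x = cpt y \<longleftrightarrow> x = y" for x y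
    by (metis cpt_diff cpt_eq_0_iff right_minus_eq)
  have zq: "cpt z \<notin> path_image q" using z by (auto simp: imq inj)
  have dq: "(q has_vector_derivative d s) (at s within {0..1})" if "s \<in> {0..1}" for s
    unfolding q_def using deriv_p[OF that] .
  have cq: "continuous_on {0..1} q"
    using dq has_vector_derivative_continuous continuous_on_eq_continuous_within by blast
  \<comment> \<open>The end points are exceptional because only one-sided derivatives are given
    there.\<close>
  have vq: "valid_path q"
    unfolding valid_path_def piecewise_C1_differentiable_on_def
  proof (intro conjI exI[of _ "{0, 1}"] cq)
    have "(q has_vector_derivative d s) (at s)" if "s \<in> {0..1} - {0, 1}" for s
      using dq[of s] that at_within_interior[of s "{0..1}"] by (auto simp: interior_cbox[of 0 "1::real", simplified])
    then show "q C1_differentiable_on {0..1} - {0, 1}"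
      unfolding C1_differentiable_on_def
      by (intro exI[of _ d] conjI ballI continuous_on_subset[OF cont_d]) auto
  qed auto
  have vd: "vector_derivative q (at s within {0..1}) = d s" if "s \<in> {0..1}" for s
    using dq[OF that] that by (intro vector_derivative_within_cbox[of 0 1, simplified]) auto
  have loop: "pathfinish q = pathstart q"
    using closed_p by (simp add: q_def pathfinish_def pathstart_def)
  have nz: "cpt z \<noteq> q s" if "s \<in> {0..1}" for s using zq that by (auto simp: path_image_def)
  have cont: "continuous_on {0..1} (\<lambda>s. d s / (cpt z - q s))"
    using nz by (intro continuous_intros cont_d cq) auto
  have "((\<lambda>w. 1 / (w - cpt z)) has_contour_integral 2 * pi * \<i> * winding_number q (cpt z)) q"
    by (rule has_contour_integral_winding_number[OF vq zq])
  then have "((\<lambda>s. 1 / (q s - cpt z) * vector_derivative q (at s within {0..1})) has_integral 2 * pi * \<i> * winding_number q (cpt z)) {0..1}"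
    unfolding has_contour_integral_def .
  then have "((\<lambda>s. - (1 / (q s - cpt z) * vector_derivative q (at s within {0..1}))) has_integral - (2 * pi * \<i> * winding_number q (cpt z))) {0..1}"
    by (rule has_integral_neg)
  moreover have "- (1 / (q s - cpt z) * vector_derivative q (at s within {0..1})) = d s / (cpt z - q s)" if "s \<in> {0..1}" for s
    using vd[OF that] nz[OF that] by (simp add: field_simps)
  ultimately have "((\<lambda>s. d s / (cpt z - q s)) has_integral - (2 * pi * \<i> * winding_number q (cpt z))) {0..1}"
    by (rule has_integral_eq[rotated])
  then have I: "(LINT s:{0..1}|lborel. d s / (cpt z - cpt (p s))) = - (2 * pi * \<i> * winding_number q (cpt z))"
    using set_borel_integral_eq_integral(2)[OF borel_integrable_atLeastAtMost'[OF cont]]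
    by (simp add: q_def integral_unique)
  have "winding_number q (cpt z) = indicator (inside (path_image p)) z"
  proof (cases "z \<in> inside (path_image p)")
    case True
    then show ?thesis
      using ccw unfolding counterclockwise_def q_def cpt_def by (cases z) auto
  next
    case False
    let ?C = "connected_component_set (- path_image p) z"
    have "\<not> bounded ?C" using False z by (simp add: inside_def)
    then have "\<not> bounded (cpt ` ?C)"
    proof (rule contrapos_nn)
      assume "bounded (cpt ` ?C)"
      then obtain B where B: "\<And>y. y \<in> ?C \<Longrightarrow> norm (cpt y) \<le> B" unfolding bounded_iff by blast
      have "norm y \<le> B" if "y \<in> ?C" for y
        using B[OF that] by (simp add: cpt_def norm_prod_def cmod_def)
      then show "bounded ?C" unfolding bounded_iff by blast
    qed
    moreover have "connected (cpt ` ?C)"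
      by (intro connected_continuous_image connected_connected_component continuous_intros)
    moreover have "cpt ` ?C \<inter> path_image q = {}"
      using connected_component_subset[of "- path_image p" z] by (auto simp: imq inj)
    moreover have "cpt z \<in> cpt ` ?C" using z by (simp add: connected_component_refl_eq)
    ultimately have "winding_number q (cpt z) = 0"
      by (intro winding_number_unbounded_component[OF valid_path_imp_path[OF vq] loop])
    then show ?thesis using False by simp
  qed
  then show ?thesis by (simp add: I)
qed

text \<open>A cut-off changes \<open>f\<close> neither on the curve nor inside it and makes
  \<open>curve_integral_two_dbar\<close> applicable. The inner integral there equals
  \<open>- 2 * pi * i\<close> times the indicator of the inside for almost every \<open>z\<close>,
  and the common factor \<open>- 2 * pi\<close> cancels.\<close>

lemma green_two_dbar:
  assumes f: "Ck 1 f"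
  shows "integral {0..1} (\<lambda>s. f (p s) * d s) = \<i> * (LINT z:inside (path_image p)|lborel. two_dbar f z)"
proof -
  let ?D = "inside (path_image p)"
  have cp: "compact (path_image p)" using simple by (simp add: compact_path_image simple_path_imp_path)
  have oD: "open ?D" using cp by (simp add: open_inside compact_imp_closed)
  have bd: "bounded (path_image p \<union> ?D)" using cp by (simp add: bounded_inside compact_imp_bounded)
  obtain R \<eta> where R: "R > 0" "path_image p \<union> ?D \<subseteq> square R" and \<eta>: "\<And>n. Ck n \<eta>"
    "\<And>z. z \<in> square (R + 1) \<Longrightarrow> \<eta> z = 1"
    "\<forall>z. R + 2 \<le> \<bar>fst z\<bar> \<or> R + 2 \<le> \<bar>snd z\<bar> \<longrightarrow> \<eta> z = 0"
    by (rule cutoff_exists[OF bd]) (rule that)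
  define f' where "f' z = \<eta> z * f z" for z
  have f': "Ck 1 f'" unfolding f'_def using \<eta>(1) f by (rule Ck_mult)
  have supp: "\<forall>z. R + 2 \<le> \<bar>fst z\<bar> \<or> R + 2 \<le> \<bar>snd z\<bar> \<longrightarrow> f' z = 0"
    using \<eta>(3) by (auto simp: f'_def)
  have fp: "f' z = f z" if "z \<in> square (R + 1)" for z
    using \<eta>(2)[OF that] by (simp add: f'_def)
  have dbD: "two_dbar f' z = two_dbar f z" if "z \<in> ?D" for z
  proof -
    have S: "?D \<subseteq> square (R + 1)" using R(2) by (auto simp: mem_square)
    have "Ck (Suc 0) f" using f by simp
    then have "f differentiable (at z)" unfolding Ck.simps by blast
    moreover have "f' y = f y" if "y \<in> ?D" for y using fp S that by blast
    ultimately show ?thesis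
      unfolding two_dbar_def using partial_cong_open[OF oD that, of f' f] by simp
  qed
  have pR: "p s \<in> square R" if "s \<in> {0..1}" for s using R(2) that by (auto simp: path_image_def)
  have fpp: "f' (p s) = f (p s)" if "s \<in> {0..1}" for s
    by (rule fp) (use pR[OF that] in \<open>auto simp: mem_square\<close>)
  have "continuous_on {0..1} p" using simple_path_imp_path[OF simple] by (simp add: path_def)
  moreover have "p s \<in> square (R + 2)" if "s \<in> {0..1}" for s using pR[OF that] by (auto simp: mem_square)
  ultimately have curve: "integrable lborel (\<lambda>z. two_dbar f' z * (LINT s:{0..1}|lborel. d s / (cpt z - cpt (p s))))"
    "- 2 * pi * integral {0..1} (\<lambda>s. f' (p s) * d s) =
      (LINT z|lborel. two_dbar f' z * (LINT s:{0..1}|lborel. d s / (cpt z - cpt (p s))))"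
    using curve_integral_two_dbar[OF f' _ supp zero_le_one _ cont_d] R(1) by auto
  have "- 2 * pi * integral {0..1} (\<lambda>s. f (p s) * d s) = - 2 * pi * integral {0..1} (\<lambda>s. f' (p s) * d s)"
  proof -
    have "integral {0..1} (\<lambda>s. f (p s) * d s) = integral {0..1} (\<lambda>s. f' (p s) * d s)"
      by (intro Henstock_Kurzweil_Integration.integral_cong) (simp add: fpp)
    then show ?thesis by simp
  qed
  also have "\<dots> = (LINT z|lborel. two_dbar f' z * (LINT s:{0..1}|lborel. d s / (cpt z - cpt (p s))))"
    by (rule curve(2))
  also have "\<dots> = (LINT z|lborel. (- 2 * pi * \<i>) * (indicator ?D z *\<^sub>R two_dbar f z))"
  proof (rule integral_cong_AE)
    have [measurable]: "?D \<in> sets borel" using oD by simp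
    have [measurable]: "two_dbar f \<in> borel_measurable borel"
      unfolding two_dbar_def
      by (intro borel_measurable_continuous_onI continuous_intros Ck_1_partials[OF f])
    show "(\<lambda>z. (- 2 * pi * \<i>) * (indicator ?D z *\<^sub>R two_dbar f z)) \<in> borel_measurable lborel" by measurable
    have eq: "AE z in lborel. two_dbar f' z * (LINT s:{0..1}|lborel. d s / (cpt z - cpt (p s)))
        = (- 2 * pi * \<i>) * (indicator ?D z *\<^sub>R two_dbar f z)"
      using AE_not_on_curve by eventually_elim (use dbD in \<open>auto simp: winding_number_curve indicator_def\<close>)
    then show "AE z in lborel. two_dbar f' z * (LINT s:{0..1}|lborel. d s / (cpt z - cpt (p s)))
        = (- 2 * pi * \<i>) * (indicator ?D z *\<^sub>R two_dbar f z)" .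
    show "(\<lambda>z. two_dbar f' z * (LINT s:{0..1}|lborel. d s / (cpt z - cpt (p s)))) \<in> borel_measurable lborel"
      using curve(1) by (rule borel_measurable_integrable)
  qed
  also have "\<dots> = - 2 * pi * (\<i> * (LINT z:?D|lborel. two_dbar f z))"
    unfolding set_lebesgue_integral_def by (simp only: integral_mult_right_zero mult.assoc)
  finally show ?thesis by simp
qed

text \<open>\<open>P dx + Q dy\<close> is the mean of \<open>A dz\<close> and the conjugate of
  \<open>B dz\<close>, with \<open>A = P - i Q\<close> and \<open>B = cnj (P + i Q)\<close>. Two
  separate functions are needed since \<open>P\<close> and \<open>Q\<close> are complex valued, and
  the two halves need not be conjugate to each other.\<close>

lemma green_curve:
  assumes P: "Ck 1 P" and Q: "Ck 1 Q"
  shows "integral {0..1} (\<lambda>s. P (p s) * of_real (Re (d s)) + Q (p s) * of_real (Im (d s))) =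
    (LINT z:inside (path_image p)|lborel. partial (1, 0) Q z - partial (0, 1) P z)"
proof -
  let ?D = "inside (path_image p)"
  have cp: "compact (path_image p)" using simple by (simp add: compact_path_image simple_path_imp_path)
  have oD: "open ?D" using cp by (simp add: open_inside compact_imp_closed)
  have bD: "bounded ?D" using cp by (simp add: bounded_inside compact_imp_bounded)
  define A where "A z = P z - \<i> * Q z" for z
  define B where "B z = cnj (P z + \<i> * Q z)" for z
  have A: "Ck 1 A" and B: "Ck 1 B"
    unfolding A_def B_def by (intro Ck_diff Ck_cnj Ck_add Ck_mult Ck_const P Q)+
  have dP: "(P has_derivative (\<lambda>b. partial b P z)) (at z)" "(Q has_derivative (\<lambda>b. partial b Q z)) (at z)" for z
    by (rule Ck_has_derivative[OF P[unfolded One_nat_def]] Ck_has_derivative[OF Q[unfolded One_nat_def]])+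
  have pA: "partial b A z = partial b P z - \<i> * partial b Q z" for b z
    unfolding A_def by (rule partial_eq) (intro derivative_intros dP)
  have pB: "partial b B z = cnj (partial b P z + \<i> * partial b Q z)" for b z
    unfolding B_def
    by (rule partial_eq) (intro bounded_linear.has_derivative[OF bounded_linear_cnj] derivative_intros dP)
  have cont_p: "continuous_on {0..1} p" using simple_path_imp_path[OF simple] by (simp add: path_def)
  have cA: "continuous_on {0..1} (\<lambda>s. A (p s) * d s)" and cB: "continuous_on {0..1} (\<lambda>s. B (p s) * d s)"
    using Ck_1_partials(1)[OF A] Ck_1_partials(1)[OF B]
    by (auto intro!: continuous_intros cont_d continuous_on_compose2[OF _ cont_p])
  have iD: "set_integrable lborel ?D (two_dbar h)" if h: "Ck 1 h" for h
  proof -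
    have c: "continuous_on UNIV (two_dbar h)"
      unfolding two_dbar_def by (intro continuous_intros Ck_1_partials[OF h])
    have "set_integrable lborel (closure ?D) (two_dbar h)"
      unfolding set_integrable_def
      by (rule borel_integrable_compact) (use bD c in \<open>auto simp: compact_closure intro: continuous_on_subset\<close>)
    then show ?thesis by (rule set_integrable_subset) (use oD closure_subset in auto)
  qed
  have "integral {0..1} (\<lambda>s. P (p s) * of_real (Re (d s)) + Q (p s) * of_real (Im (d s)))
     = integral {0..1} (\<lambda>s. (1 / 2) * (A (p s) * d s) + (1 / 2) * cnj (B (p s) * d s))"
  proof (intro Henstock_Kurzweil_Integration.integral_cong)
    fix s
    have "u * of_real a + v * of_real b = (1 / 2) * ((u - \<i> * v) * (of_real a + \<i> * of_real b))
        + (1 / 2) * cnj (cnj (u + \<i> * v) * (of_real a + \<i> * of_real b))" for u v a b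
      by (simp add: algebra_simps)
    from this[of "P (p s)" "Re (d s)" "Q (p s)" "Im (d s)"]
    show "P (p s) * of_real (Re (d s)) + Q (p s) * of_real (Im (d s)) = (1 / 2) * (A (p s) * d s) + (1 / 2) * cnj (B (p s) * d s)"
      unfolding A_def B_def complex_eq[symmetric] .
  qed
  also have "\<dots> = (1 / 2) * integral {0..1} (\<lambda>s. A (p s) * d s) + (1 / 2) * cnj (integral {0..1} (\<lambda>s. B (p s) * d s))"
  proof -
    have "integral {0..1} (\<lambda>s. (1 / 2) * (A (p s) * d s) + (1 / 2) * cnj (B (p s) * d s))
      = integral {0..1} (\<lambda>s. (1 / 2) * (A (p s) * d s)) + integral {0..1} (\<lambda>s. (1 / 2) * cnj (B (p s) * d s))"
      by (intro integral_add integrable_continuous_interval continuous_intros cA cB)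
    moreover have "integral {0..1} (\<lambda>s. cnj (B (p s) * d s)) = cnj (integral {0..1} (\<lambda>s. B (p s) * d s))"
      using integral_linear[OF integrable_continuous_interval[OF cB] bounded_linear_cnj] by (simp add: comp_def)
    ultimately show ?thesis by simp
  qed
  also have "\<dots> = (LINT z:?D|lborel. (\<i> / 2) * two_dbar A z) + (LINT z:?D|lborel. - (\<i> / 2) * cnj (two_dbar B z))"
  proof -
    have "(LINT z:?D|lborel. cnj (two_dbar B z)) = cnj (LINT z:?D|lborel. two_dbar B z)"
      unfolding set_lebesgue_integral_def
      using Bochner_Integration.integral_cnj[of lborel "\<lambda>x. indicat_real ?D x *\<^sub>R two_dbar B x"] by simp
    then show ?thesis unfolding green_two_dbar[OF A] green_two_dbar[OF B] set_integral_mult_right by simp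
  qed
  also have "\<dots> = (LINT z:?D|lborel. (\<i> / 2) * two_dbar A z + - (\<i> / 2) * cnj (two_dbar B z))"
  proof (rule set_integral_add(2)[symmetric])
    have "set_integrable lborel ?D (\<lambda>z. cnj (two_dbar B z))"
      using integrable_cnj[OF iD[OF B, unfolded set_integrable_def]] unfolding set_integrable_def by simp
    then show "set_integrable lborel ?D (\<lambda>z. - (\<i> / 2) * cnj (two_dbar B z))"
      by (rule set_integrable_mult_right)
  qed (rule set_integrable_mult_right[OF iD[OF A]])
  also have "(\<lambda>z. (\<i> / 2) * two_dbar A z + - (\<i> / 2) * cnj (two_dbar B z)) = (\<lambda>z. partial (1, 0) Q z - partial (0, 1) P z)"
    by (auto simp: two_dbar_def pA pB algebra_simps)
  finally show ?thesis .
qed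

end

section \<open>Testing the weak equation\<close>

lemma Ck_partial: "Ck (Suc n) f \<Longrightarrow> b \<in> Basis \<Longrightarrow> Ck n (partial b f)"
  by simp

lemma test_function_partial:
  assumes "test_function \<phi>" "b \<in> Basis"
  shows "test_function (partial b \<phi>)"
proof -
  let ?S = "closure {z. \<phi> z \<noteq> 0}"
  have "\<forall>n. Ck n (partial b \<phi>)"
    using assms Ck_partial unfolding test_function_def by blast
  moreover have "{z. partial b \<phi> z \<noteq> 0} \<subseteq> ?S"
  proof (rule ccontr)
    assume "\<not> {z. partial b \<phi> z \<noteq> 0} \<subseteq> ?S"
    then obtain z where z: "partial b \<phi> z \<noteq> 0" "z \<in> - ?S" by blast
    have "((\<lambda>_. 0) has_derivative (\<lambda>_. 0)) (at z)" by simp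
    then have "(\<phi> has_derivative (\<lambda>_. 0)) (at z)"
      by (rule has_derivative_transform_within_open[OF _ _ z(2)]) (use closure_subset[of "{z. \<phi> z \<noteq> 0}"] in auto)
    then have "partial b \<phi> z = 0" by (rule partial_eq)
    then show False using z by simp
  qed
  then have "closure {z. partial b \<phi> z \<noteq> 0} \<subseteq> ?S" by (simp add: closure_minimal)
  then have "compact (closure {z. partial b \<phi> z \<noteq> 0})"
    using assms(1) unfolding test_function_def by (metis closed_closure compact_Int_closed inf.absorb_iff2)
  ultimately show ?thesis by (simp add: test_function_def)
qed

text \<open>On the compact support, \<open>|u| \<le> |u|^2 + 1\<close> reduces integrability to the
  local square integrability of \<open>u\<close>.\<close>

lemma locally_L2_times_test_integrable:
  fixes u \<phi> :: "'a::euclidean_space \<Rightarrow> complex"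
  assumes u: "locally_L2 u" and \<phi>: "continuous_on UNIV \<phi>" "compact (closure {z. \<phi> z \<noteq> 0})"
  shows "integrable lebesgue (\<lambda>z. u z * \<phi> z)"
proof -
  let ?S = "closure {z. \<phi> z \<noteq> 0}"
  have i1: "integrable lebesgue (\<lambda>z. indicator ?S z *\<^sub>R (norm (u z))\<^sup>2)"
    using u \<phi>(2) unfolding locally_L2_def set_integrable_def by blast
  have "compact (\<phi> ` ?S)" using \<phi> by (intro compact_continuous_image) (rule continuous_on_subset, auto)
  from compact_imp_bounded[OF this] obtain M where M: "\<And>z. z \<in> ?S \<Longrightarrow> norm (\<phi> z) \<le> M"
    unfolding bounded_iff by blast
  have i2: "integrable lebesgue (\<lambda>z. indicator ?S z *\<^sub>R (1::real))"
  proof -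
    have "integrable lborel (\<lambda>z. indicator ?S z *\<^sub>R (1::real))"
      by (rule borel_integrable_compact[OF \<phi>(2)]) simp
    then show ?thesis by (rule integrable_completion[THEN iffD2, rotated]) auto
  qed
  have [measurable]: "u \<in> borel_measurable lebesgue" using u by (simp add: locally_L2_def)
  have "\<phi> \<in> borel_measurable borel" using \<phi>(1) by (rule borel_measurable_continuous_onI)
  then have [measurable]: "\<phi> \<in> borel_measurable lebesgue" by (simp add: measurable_completion)
  show ?thesis
  proof (rule Bochner_Integration.integrable_bound)
    show "integrable lebesgue (\<lambda>z. \<bar>M\<bar> * (indicator ?S z *\<^sub>R (norm (u z))\<^sup>2 + indicator ?S z *\<^sub>R 1))"
      using i1 i2 by (intro integrable_mult_right Bochner_Integration.integrable_add)
    show "(\<lambda>z. u z * \<phi> z) \<in> borel_measurable lebesgue" by measurable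
    show "AE z in lebesgue. norm (u z * \<phi> z) \<le> norm (\<bar>M\<bar> * (indicator ?S z *\<^sub>R (norm (u z))\<^sup>2 + indicator ?S z *\<^sub>R 1))"
    proof (rule AE_I2)
      fix z
      show "norm (u z * \<phi> z) \<le> norm (\<bar>M\<bar> * (indicator ?S z *\<^sub>R (norm (u z))\<^sup>2 + indicator ?S z *\<^sub>R 1))"
      proof (cases "z \<in> ?S")
        case True
        have "norm (u z) \<le> (norm (u z))\<^sup>2 + 1"
          using zero_le_power2[of "norm (u z) - 1 / 2"] by (simp add: power2_diff power2_eq_square algebra_simps)
        then have "norm (u z) * norm (\<phi> z) \<le> ((norm (u z))\<^sup>2 + 1) * \<bar>M\<bar>"
          using M[OF True] by (intro mult_mono) auto
        then show ?thesis using True by (simp add: norm_mult abs_mult mult.commute add_nonneg_nonneg)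
      next
        case False
        then have "\<phi> z = 0" using closure_subset[of "{z. \<phi> z \<noteq> 0}"] by auto
        then show ?thesis by simp
      qed
    qed
  qed
qed

text \<open>Each direction uses two weak identities, one for \<open>w b\<close> tested with
  \<open>\<phi>\<close> and one for \<open>u\<close> tested with \<open>partial b \<phi>\<close>;
  the two signs cancel.\<close>

lemma weak_laplacian_test:
  fixes u :: "'a::euclidean_space \<Rightarrow> complex"
  assumes "locally_L2 u" and L: "weak_laplacian u L" and \<phi>: "test_function \<phi>"
  shows "integrable lebesgue (\<lambda>z. L z * \<phi> z)"
    and "(LINT z|lebesgue. L z * \<phi> z) = (LINT z|lebesgue. u z * laplacian \<phi> z)"
proof -
  obtain w w' where w: "\<And>b. b \<in> Basis \<Longrightarrow> locally_L2 (w b)" "\<And>b. b \<in> Basis \<Longrightarrow> weak_partial b u (w b)"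
    "\<And>b. b \<in> Basis \<Longrightarrow> locally_L2 (w' b)" "\<And>b. b \<in> Basis \<Longrightarrow> weak_partial b (w b) (w' b)"
    and Leq: "L = (\<lambda>z. \<Sum>b\<in>Basis. w' b z)"
    using L unfolding weak_laplacian_def by blast
  have tf: "continuous_on UNIV \<psi>" "compact (closure {z. \<psi> z \<noteq> 0})" if "test_function \<psi>" for \<psi> :: "'a \<Rightarrow> complex"
    using that Ck.simps(1) unfolding test_function_def by blast+
  have i: "integrable lebesgue (\<lambda>z. w' b z * \<phi> z)" if "b \<in> Basis" for b
    by (rule locally_L2_times_test_integrable[OF w(3)[OF that] tf[OF \<phi>]])
  show "integrable lebesgue (\<lambda>z. L z * \<phi> z)"
    unfolding Leq sum_distrib_right by (intro Bochner_Integration.integrable_sum i)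
  have t1: "test_function (partial b \<phi>)" "test_function (partial b (partial b \<phi>))" if "b \<in> Basis" for b
    using test_function_partial[OF _ that] \<phi> by blast+
  have i2: "integrable lebesgue (\<lambda>z. u z * partial b (partial b \<phi>) z)" if "b \<in> Basis" for b
    by (rule locally_L2_times_test_integrable[OF assms(1) tf[OF t1(2)[OF that]]])
  have "(LINT z|lebesgue. w' b z * \<phi> z) = (LINT z|lebesgue. u z * partial b (partial b \<phi>) z)" if b: "b \<in> Basis" for b
    using w(4)[OF b] w(2)[OF b] \<phi> t1(1)[OF b] unfolding weak_partial_def by (metis minus_equation_iff)
  then show "(LINT z|lebesgue. L z * \<phi> z) = (LINT z|lebesgue. u z * laplacian \<phi> z)"
    unfolding Leq laplacian_def sum_distrib_right sum_distrib_left
    by (simp add: i i2 Bochner_Integration.integral_sum)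
qed

text \<open>Testing the equation with a cut-off solution of \<open>\<Delta>\<phi> + k\<^sup>2 q \<phi> = 0\<close> removes the unknown field, which
  vanishes wherever the cut-off is not locally constant.\<close>

lemma nonscattering_orthogonality:
  assumes ns: "nonscattering k q D uin" and D: "open D" "bounded D" and kq: "k > 0" "q \<noteq> 1"
    and cu: "continuous_on UNIV uin"
    and \<phi>: "\<And>n. Ck n \<phi>" "\<And>z. laplacian \<phi> z + of_real (k\<^sup>2 * q) * \<phi> z = 0"
  shows "(LINT z:D|lebesgue. uin z * \<phi> z) = 0"
proof -
  obtain u L where H: "H2_loc u" "weak_laplacian u L" and u0: "AE z in lebesgue. z \<notin> D \<longrightarrow> u z = 0"
    and eq: "AE z in lebesgue. L z + of_real (k\<^sup>2 * q) * u z = of_real (k\<^sup>2 * (1 - q)) * uin z * indicator D z"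
    using ns unfolding nonscattering_def by blast
  have u: "locally_L2 u" using H(1) by (simp add: H2_loc_def)
  obtain R \<eta> where R: "R > 0" "D \<subseteq> square R" and \<eta>: "\<And>n. Ck n \<eta>"
    "\<And>z. z \<in> square (R + 1) \<Longrightarrow> \<eta> z = 1"
    "\<forall>z. R + 2 \<le> \<bar>fst z\<bar> \<or> R + 2 \<le> \<bar>snd z\<bar> \<longrightarrow> \<eta> z = 0"
    by (rule cutoff_exists[OF D(2)]) (rule that)
  define \<psi> where "\<psi> z = \<eta> z * \<phi> z" for z
  have \<psi>C: "Ck n \<psi>" for n unfolding \<psi>_def by (intro Ck_mult \<eta> \<phi>)
  have "{z. \<psi> z \<noteq> 0} \<subseteq> square (R + 2)"
  proof (rule subsetI, rule ccontr)
    fix z assume z: "z \<in> {z. \<psi> z \<noteq> 0}" "z \<notin> square (R + 2)"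
    then have "R + 2 \<le> \<bar>fst z\<bar> \<or> R + 2 \<le> \<bar>snd z\<bar>" by (auto simp: mem_square)
    then have "\<eta> z = 0" using \<eta>(3) by blast
    then show False using z(1) by (simp add: \<psi>_def)
  qed
  then have "bounded {z. \<psi> z \<noteq> 0}"
    unfolding square_def by (rule bounded_subset[OF bounded_cbox])
  then have "compact (closure {z. \<psi> z \<noteq> 0})"
    by (simp only: compact_closure)
  with \<psi>C have \<psi>T: "test_function \<psi>" by (simp add: test_function_def)
  have \<psi>D: "\<psi> z = \<phi> z" if "z \<in> D" for z
    using that R(2) \<eta>(2)[of z] by (auto simp: \<psi>_def mem_square)
  have diff\<phi>: "\<phi> differentiable (at z)" and diffp: "partial b \<phi> differentiable (at z)" if "b \<in> Basis" for b z
    using \<phi>(1)[of "Suc (Suc 0)"] that unfolding Ck.simps by blast+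
  have p1: "partial b \<psi> z = partial b \<phi> z" if "b \<in> Basis" "z \<in> D" for b z
    by (rule partial_cong_open[OF D(1) that(2) \<psi>D diff\<phi>[OF that(1)]])
  have "partial b (partial b \<psi>) z = partial b (partial b \<phi>) z" if "b \<in> Basis" "z \<in> D" for b z
    by (rule partial_cong_open[OF D(1) that(2) p1[OF that(1)] diffp[OF that(1)]])
  then have lapD: "laplacian \<psi> z = - of_real (k\<^sup>2 * q) * \<psi> z" if "z \<in> D" for z
    using \<phi>(2)[of z] that \<psi>D[OF that] by (simp add: laplacian_def eq_neg_iff_add_eq_0)
  have c\<psi>: "continuous_on UNIV \<psi>" using \<psi>C[of 0] by simp
  have iu: "integrable lebesgue (\<lambda>z. u z * \<psi> z)"
    using \<psi>T c\<psi> by (intro locally_L2_times_test_integrable[OF u]) (auto simp: test_function_def)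
  have "(LINT z|lebesgue. L z * \<psi> z) = (LINT z|lebesgue. u z * laplacian \<psi> z)"
    by (rule weak_laplacian_test(2)[OF u H(2) \<psi>T])
  also have "\<dots> = (LINT z|lebesgue. (- of_real (k\<^sup>2 * q)) * (u z * \<psi> z))"
  proof (rule integral_cong_AE)
    have um: "u \<in> borel_measurable lebesgue" using u by (simp add: locally_L2_def)
    have "Ck 0 (partial b (partial b \<psi>))" if "b \<in> Basis" for b
      using \<psi>C[of "Suc (Suc 0)"] that unfolding Ck.simps(2) by blast
    then have "continuous_on UNIV (laplacian \<psi>)"
      unfolding laplacian_def by (intro continuous_on_sum) simp
    then have "laplacian \<psi> \<in> borel_measurable lebesgue"
      by (intro measurable_completion) (simp add: borel_measurable_continuous_onI)
    with um show "(\<lambda>z. u z * laplacian \<psi> z) \<in> borel_measurable lebesgue" by (rule borel_measurable_times)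
    show "(\<lambda>z. (- of_real (k\<^sup>2 * q)) * (u z * \<psi> z)) \<in> borel_measurable lebesgue"
      by (rule borel_measurable_integrable[OF integrable_mult_right[OF iu]])
    show "AE z in lebesgue. u z * laplacian \<psi> z = (- of_real (k\<^sup>2 * q)) * (u z * \<psi> z)"
      using u0 by eventually_elim (use lapD in auto)
  qed
  also have "\<dots> = - of_real (k\<^sup>2 * q) * (LINT z|lebesgue. u z * \<psi> z)" by (rule integral_mult_right_zero)
  finally have 1: "(LINT z|lebesgue. L z * \<psi> z) + of_real (k\<^sup>2 * q) * (LINT z|lebesgue. u z * \<psi> z) = 0" by simp
  have iL: "integrable lebesgue (\<lambda>z. L z * \<psi> z)" by (rule weak_laplacian_test(1)[OF u H(2) \<psi>T])
  have iq: "integrable lebesgue (\<lambda>z. of_real (k\<^sup>2 * q) * (u z * \<psi> z))" using iu by (rule integrable_mult_right)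
  have "(LINT z|lebesgue. L z * \<psi> z + of_real (k\<^sup>2 * q) * (u z * \<psi> z)) = 0"
    using 1 by (simp only: Bochner_Integration.integral_add[OF iL iq] integral_mult_right_zero)
  moreover have "(LINT z|lebesgue. L z * \<psi> z + of_real (k\<^sup>2 * q) * (u z * \<psi> z)) =
      (LINT z|lebesgue. of_real (k\<^sup>2 * (1 - q)) * (indicator D z *\<^sub>R (uin z * \<phi> z)))"
  proof -
    have ae: "AE z in lebesgue. L z * \<psi> z + of_real (k\<^sup>2 * q) * (u z * \<psi> z) = of_real (k\<^sup>2 * (1 - q)) * (indicator D z *\<^sub>R (uin z * \<phi> z))"
      using eq
    proof eventually_elim
      case (elim z)
      have "L z * \<psi> z + of_real (k\<^sup>2 * q) * (u z * \<psi> z) = (L z + of_real (k\<^sup>2 * q) * u z) * \<psi> z"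
        by (simp add: algebra_simps)
      then show ?case unfolding elim using \<psi>D[of z] by (auto simp: indicator_def)
    qed
    have m: "(\<lambda>z. L z * \<psi> z + of_real (k\<^sup>2 * q) * (u z * \<psi> z)) \<in> borel_measurable lebesgue"
      using iL iq by (intro borel_measurable_integrable Bochner_Integration.integrable_add)
    moreover have "(\<lambda>z. of_real (k\<^sup>2 * (1 - q)) * (indicator D z *\<^sub>R (uin z * \<phi> z))) \<in> borel_measurable lebesgue"
    proof -
      have [measurable]: "D \<in> sets borel" using D(1) by simp
      have [measurable]: "uin \<in> borel_measurable borel" "\<phi> \<in> borel_measurable borel"
        using cu \<phi>(1)[of 0] by (auto intro: borel_measurable_continuous_onI)
      have "(\<lambda>z. of_real (k\<^sup>2 * (1 - q)) * (indicator D z *\<^sub>R (uin z * \<phi> z))) \<in> borel_measurable borel"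
        by measurable
      then show ?thesis by (simp add: measurable_completion)
    qed
    ultimately show ?thesis using ae by (intro integral_cong_AE)
  qed
  ultimately have "of_real (k\<^sup>2 * (1 - q)) * (LINT z|lebesgue. indicator D z *\<^sub>R (uin z * \<phi> z)) = 0"
    by (simp only: integral_mult_right_zero)
  moreover have "complex_of_real (k\<^sup>2 * (1 - q)) \<noteq> 0" using kq by (simp only: of_real_eq_0_iff) simp
  ultimately show ?thesis unfolding set_lebesgue_integral_def by (simp only: mult_eq_0_iff) blast
qed

section \<open>The boundary integral\<close>

text \<open>Since \<open>\<Omega>\<close> is open, its slices contain real intervals, on which the
  complex derivative of \<open>H\<close> restricts to the real derivative of \<open>G\<close>.
  \<open>H\<close> and \<open>G\<close> are arbitrary so that the lemma can be applied again to
  first derivatives.\<close>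

lemma partial_real_restriction:
  fixes G :: "real \<times> real \<Rightarrow> complex"
  assumes H: "analytic2_on H \<Omega>" "open \<Omega>" and in\<Omega>: "(of_real a, of_real b) \<in> \<Omega>"
    and agree: "\<And>a b. (of_real a, of_real b) \<in> \<Omega> \<Longrightarrow> G (a, b) = H (of_real a, of_real b)"
    and G: "G differentiable (at (a, b))"
  shows "partial (1, 0) G (a, b) = d1 H (of_real a, of_real b)"
    and "partial (0, 1) G (a, b) = d2 H (of_real a, of_real b)"
proof -
  have D: "(G has_derivative (\<lambda>h. partial h G (a, b))) (at (a, b))"
    using G by (rule has_derivative_frechet)
  have hom: "partial (r *\<^sub>R h) G (a, b) = r *\<^sub>R partial h G (a, b)" for r h
    using linear_cmul[OF has_derivative_linear[OF D]] .
  let ?U = "(\<lambda>s. (complex_of_real s, complex_of_real b)) -` \<Omega>" and ?V = "(\<lambda>s. (complex_of_real a, complex_of_real s)) -` \<Omega>"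
  have oU: "open ?U" and oV: "open ?V" by (intro open_vimage H(2) continuous_intros)+
  have "((\<lambda>s. (s, b)) has_derivative (\<lambda>h. (h, 0))) (at a)" by (auto intro!: derivative_eq_intros)
  from has_derivative_compose[OF this D] have 1: "((\<lambda>s. G (s, b)) has_vector_derivative partial (1, 0) G (a, b)) (at a)"
    unfolding has_vector_derivative_def hom[symmetric] by simp
  have "((\<lambda>s. H (s, of_real b)) has_field_derivative d1 H (of_real a, of_real b)) (at (of_real a))"
    using analytic2_on_chain[OF H(1), of UNIV "\<lambda>s. s" "\<lambda>_. of_real b" "of_real a"] in\<Omega> by simp
  from has_vector_derivative_real_field[OF this]
  have "((\<lambda>s. G (s, b)) has_vector_derivative d1 H (of_real a, of_real b)) (at a)"
    by (rule has_vector_derivative_transform_within_open[OF _ oU]) (use in\<Omega> agree in auto)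
  with 1 show "partial (1, 0) G (a, b) = d1 H (of_real a, of_real b)" by (rule vector_derivative_unique_at)
  have "((\<lambda>s. (a, s)) has_derivative (\<lambda>h. (0, h))) (at b)" by (auto intro!: derivative_eq_intros)
  from has_derivative_compose[OF this D] have 2: "((\<lambda>s. G (a, s)) has_vector_derivative partial (0, 1) G (a, b)) (at b)"
    unfolding has_vector_derivative_def hom[symmetric] by simp
  have "((\<lambda>s. H (of_real a, s)) has_field_derivative d2 H (of_real a, of_real b)) (at (of_real b))"
    using analytic2_on_chain[OF H(1), of UNIV "\<lambda>_. of_real a" "\<lambda>s. s" "of_real b"] in\<Omega> by simp
  from has_vector_derivative_real_field[OF this]
  have "((\<lambda>s. G (a, s)) has_vector_derivative d2 H (of_real a, of_real b)) (at b)"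
    by (rule has_vector_derivative_transform_within_open[OF _ oV]) (use in\<Omega> agree in auto)
  with 2 show "partial (0, 1) G (a, b) = d2 H (of_real a, of_real b)" by (rule vector_derivative_unique_at)
qed

lemma laplacian_plane:
  fixes f :: "real \<times> real \<Rightarrow> complex"
  shows "laplacian f z = partial (1, 0) (partial (1, 0) f) z + partial (0, 1) (partial (0, 1) f) z"
proof -
  have B: "(Basis :: (real \<times> real) set) = {(1, 0), (0, 1)}" by (auto simp: Basis_prod_def)
  show ?thesis unfolding laplacian_def B by (subst sum.insert) auto
qed

lemma Ck_2_differentiable:
  fixes f :: "real \<times> real \<Rightarrow> complex"
  assumes "Ck 2 f"
  shows "f differentiable (at z)" "partial (1, 0) f differentiable (at z)" "partial (0, 1) f differentiable (at z)"
    "Ck 1 f" "Ck 1 (partial (1, 0) f)" "Ck 1 (partial (0, 1) f)"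
proof -
  have f: "Ck (Suc (Suc 0)) f" using assms by (simp only: numeral_2_eq_2)
  have B: "(1, 0) \<in> (Basis :: (real \<times> real) set)" "(0, 1) \<in> (Basis :: (real \<times> real) set)" by (auto simp: Basis_prod_def)
  show p: "Ck 1 (partial (1, 0) f)" "Ck 1 (partial (0, 1) f)"
    using Ck_partial[OF f B(1)] Ck_partial[OF f B(2)] by (simp_all only: One_nat_def)
  show f1: "Ck 1 f" using Ck_SucD[OF f] by (simp only: One_nat_def)
  show "f differentiable (at z)" "partial (1, 0) f differentiable (at z)" "partial (0, 1) f differentiable (at z)"
    using f1 p unfolding One_nat_def Ck.simps by blast+
qed

text \<open>The data common to the asymptotic and the scattering part: wave, analytic curve and
  analytic extension. The index \<open>q\<close>, the saddle and the contour stay outside.\<close>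

locale wave_on_curve =
  fixes k :: real and uin :: "real \<times> real \<Rightarrow> complex" and x1 x2 :: "complex \<Rightarrow> complex" and T :: "complex set"
    and F :: "complex \<times> complex \<Rightarrow> complex" and \<Omega> :: "(complex \<times> complex) set"
  assumes open_T: "open T" and real_T: "of_real ` {-pi..pi} \<subseteq> T"
    and hol_x: "x1 holomorphic_on T" "x2 holomorphic_on T"
    and real_x: "\<forall>t\<in>{-pi..pi}. x1 (of_real t) \<in> \<real> \<and> x2 (of_real t) \<in> \<real>"
    and Ck_uin: "Ck 2 uin" and helmholtz: "\<forall>z. laplacian uin z + of_real (k\<^sup>2) * uin z = 0"
    and open_\<Omega>: "open \<Omega>" and sub_\<Omega>: "(\<lambda>t. (x1 t, x2 t)) ` T \<subseteq> \<Omega>" and analytic_F: "analytic2_on F \<Omega>"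
    and agree_F: "\<forall>a b. (of_real a, of_real b) \<in> \<Omega> \<longrightarrow> F (of_real a, of_real b) = uin (a, b)"
begin

abbreviation "g \<equiv> gfun x1 x2"

definition along :: "(complex \<times> complex \<Rightarrow> complex) \<Rightarrow> complex \<Rightarrow> complex" where
  "along H t = H (x1 t, x2 t)"

lemma along_derivative:
  assumes "analytic2_on H \<Omega>" "t \<in> T"
  shows "(along H has_field_derivative along (d1 H) t * deriv x1 t + along (d2 H) t * deriv x2 t) (at t)"
  unfolding along_def
  by (rule analytic2_on_chain[OF assms(1) open_T hol_x assms(2)]) (use assms(2) sub_\<Omega> in auto)

lemma along_holomorphic: "analytic2_on H \<Omega> \<Longrightarrow> along H holomorphic_on T"
  using along_derivative open_T by (auto simp: holomorphic_on_open)

lemmas analytic_dF = analytic2_on_d1[OF analytic_F] analytic2_on_d2[OF analytic_F]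

lemmas analytic_ddF = analytic2_on_d1[OF analytic_dF(1)] analytic2_on_d2[OF analytic_dF(1)]
  analytic2_on_d1[OF analytic_dF(2)] analytic2_on_d2[OF analytic_dF(2)]

lemma real_point:
  assumes "t \<in> {-pi..pi}"
  shows "x1 (of_real t) = of_real (fst (curve_pt x1 x2 t))" "x2 (of_real t) = of_real (snd (curve_pt x1 x2 t))"
    "(of_real (fst (curve_pt x1 x2 t)), of_real (snd (curve_pt x1 x2 t))) \<in> \<Omega>"
proof -
  show x: "x1 (of_real t) = of_real (fst (curve_pt x1 x2 t))" "x2 (of_real t) = of_real (snd (curve_pt x1 x2 t))"
    using real_x assms by (auto simp: curve_pt_def elim!: Reals_cases)
  show "(of_real (fst (curve_pt x1 x2 t)), of_real (snd (curve_pt x1 x2 t))) \<in> \<Omega>"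
    unfolding x[symmetric] using sub_\<Omega> real_T assms by blast
qed

lemma partials_F:
  assumes "(of_real a, of_real b) \<in> \<Omega>"
  shows "partial (1, 0) uin (a, b) = d1 F (of_real a, of_real b)" "partial (0, 1) uin (a, b) = d2 F (of_real a, of_real b)"
proof -
  have ag: "uin (a, b) = F (of_real a, of_real b)" if "(of_real a, of_real b) \<in> \<Omega>" for a b
    using agree_F that by simp
  show "partial (1, 0) uin (a, b) = d1 F (of_real a, of_real b)" "partial (0, 1) uin (a, b) = d2 F (of_real a, of_real b)"
    by (rule partial_real_restriction[OF analytic_F open_\<Omega> assms ag Ck_2_differentiable(1)[OF Ck_uin]]; assumption)+
qed

lemma helmholtz_F:
  assumes "(of_real a, of_real b) \<in> \<Omega>"
  shows "d1 (d1 F) (of_real a, of_real b) + d2 (d2 F) (of_real a, of_real b) + of_real (k\<^sup>2) * F (of_real a, of_real b) = 0"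
proof -
  have "partial (1, 0) (partial (1, 0) uin) (a, b) = d1 (d1 F) (of_real a, of_real b)"
    by (rule partial_real_restriction(1)[OF analytic_dF(1) open_\<Omega> assms _ Ck_2_differentiable(2)[OF Ck_uin]])
       (rule partials_F(1))
  moreover have "partial (0, 1) (partial (0, 1) uin) (a, b) = d2 (d2 F) (of_real a, of_real b)"
    by (rule partial_real_restriction(2)[OF analytic_dF(2) open_\<Omega> assms _ Ck_2_differentiable(3)[OF Ck_uin]])
       (rule partials_F(2))
  moreover have "laplacian uin (a, b) + of_real (k\<^sup>2) * uin (a, b) = 0" using helmholtz by blast
  ultimately show ?thesis unfolding laplacian_plane using agree_F assms by simp
qed

lemma on_curve:
  assumes "t \<in> {-pi..pi}"
  shows "uin (curve_pt x1 x2 t) = along F (of_real t)"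
    "partial (1, 0) uin (curve_pt x1 x2 t) = along (d1 F) (of_real t)"
    "partial (0, 1) uin (curve_pt x1 x2 t) = along (d2 F) (of_real t)"
    "along (d1 (d1 F)) (of_real t) + along (d2 (d2 F)) (of_real t) + of_real (k\<^sup>2) * along F (of_real t) = 0"
proof -
  obtain a b where ab: "curve_pt x1 x2 t = (a, b)" by force
  note r = real_point[OF assms, unfolded ab fst_conv snd_conv]
  show "uin (curve_pt x1 x2 t) = along F (of_real t)"
    "partial (1, 0) uin (curve_pt x1 x2 t) = along (d1 F) (of_real t)"
    "partial (0, 1) uin (curve_pt x1 x2 t) = along (d2 F) (of_real t)"
    "along (d1 (d1 F)) (of_real t) + along (d2 (d2 F)) (of_real t) + of_real (k\<^sup>2) * along F (of_real t) = 0"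
    using agree_F partials_F[OF r(3)] helmholtz_F[OF r(3)] r(3) by (simp_all add: along_def r(1,2) ab)
qed

text \<open>The left side is holomorphic and vanishes on the real interval, hence on the whole
  component of \<open>T\<close> containing it by the identity theorem. \<open>T\<close> need not be
  connected; the set \<open>C\<close>, later the contour, places \<open>t\<close> in the right
  component.\<close>

lemma helmholtz_along:
  assumes C: "connected C" "C \<subseteq> T" "- of_real pi \<in> C" "t \<in> C"
  shows "along (d1 (d1 F)) t + along (d2 (d2 F)) t + of_real (k\<^sup>2) * along F t = 0"
proof -
  let ?h = "\<lambda>t. along (d1 (d1 F)) t + along (d2 (d2 F)) t + of_real (k\<^sup>2) * along F t"
  let ?S = "connected_component_set T (- of_real pi)"
  let ?U = "of_real ` {-pi..pi} :: complex set"
  have m: "- of_real pi \<in> ?U" by (intro image_eqI[of _ _ "- pi"]) auto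
  have US: "?U \<subseteq> ?S"
    by (rule connected_component_maximal[OF m _ real_T]) (intro connected_continuous_image continuous_intros; simp)
  have CS: "C \<subseteq> ?S" using C by (intro connected_component_maximal)
  have hT: "?h holomorphic_on T"
    by (intro holomorphic_intros along_holomorphic analytic_ddF analytic_F)
  show ?thesis
  proof (rule analytic_continuation[of ?h ?S ?U "of_real 0"])
    show "?h holomorphic_on ?S" using hT connected_component_subset by (rule holomorphic_on_subset)
    show "open ?S" by (rule open_connected_component[OF open_T])
    show "of_real 0 \<in> ?S" using US by (auto intro!: image_eqI[of _ _ 0])
    show "(of_real 0 :: complex) islimpt ?U"
      unfolding islimpt_approachable
    proof (intro allI impI bexI conjI)
      fix e :: real assume "e > 0"
      then show "complex_of_real (min (e / 2) 1) \<noteq> of_real 0" "dist (complex_of_real (min (e / 2) 1)) (of_real 0) < e"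
        by (auto simp: min_def dist_norm)
      show "complex_of_real (min (e / 2) 1) \<in> ?U"
        using \<open>e > 0\<close> pi_gt3 by (intro imageI) (auto simp: min_def)
    qed
    show "\<And>z. z \<in> ?U \<Longrightarrow> ?h z = 0" using on_curve(4) by auto
  qed (use US CS C(4) in auto)
qed

lemma deriv_g: "t \<in> T \<Longrightarrow> deriv g t = deriv x1 t + \<i> * deriv x2 t"
  and hol_g: "g holomorphic_on T"
proof -
  show "g holomorphic_on T" unfolding gfun_def by (intro holomorphic_intros hol_x)
  show "deriv g t = deriv x1 t + \<i> * deriv x2 t" if "t \<in> T"
    unfolding gfun_def
    by (rule DERIV_imp_deriv) (auto intro!: derivative_eq_intros holomorphic_derivI[OF hol_x(1) open_T that] holomorphic_derivI[OF hol_x(2) open_T that])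
qed

text \<open>The imaginary part of \<open>x\<close> is constantly 0 on the interval. Derivatives
  within the closed interval are used so that the two end points are covered.\<close>

lemma real_derivs:
  assumes t: "t \<in> {-pi..pi}"
  shows "deriv x1 (of_real t) = of_real (Re (deriv x1 (of_real t)))" "deriv x2 (of_real t) = of_real (Re (deriv x2 (of_real t)))"
proof -
  have "deriv x (of_real t) = of_real (Re (deriv x (of_real t)))"
    if x: "x holomorphic_on T" "\<And>t. t \<in> {-pi..pi} \<Longrightarrow> x (of_real t) \<in> \<real>" for x
  proof -
    have "(x has_field_derivative deriv x (of_real t)) (at (of_real t))"
      using real_T t by (intro holomorphic_derivI[OF x(1) open_T]) auto
    from has_vector_derivative_real_field[OF this]
    have "((\<lambda>t. x (of_real t)) has_vector_derivative deriv x (of_real t)) (at t within {-pi..pi})"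
      by (rule has_vector_derivative_at_within)
    from bounded_linear.has_vector_derivative[OF bounded_linear_Im this]
    have "((\<lambda>t. Im (x (of_real t))) has_vector_derivative Im (deriv x (of_real t))) (at t within {-pi..pi})"
      by simp
    moreover have "((\<lambda>t. Im (x (of_real t))) has_vector_derivative 0) (at t within {-pi..pi})"
      by (rule has_vector_derivative_transform[OF t _ has_vector_derivative_const]) (use x(2) in \<open>auto simp: complex_is_Real_iff\<close>)
    ultimately have "Im (deriv x (of_real t)) = 0"
      using t vector_derivative_unique_within_closed_interval[of "-pi" pi t] by auto
    then show ?thesis by (simp add: complex_eq_iff)
  qed
  then show "deriv x1 (of_real t) = of_real (Re (deriv x1 (of_real t)))" "deriv x2 (of_real t) = of_real (Re (deriv x2 (of_real t)))"
    using hol_x real_x by blast+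
qed

end

text \<open>All four follow from \<open>(m + l)^2 = l^2 + k^2 * q\<close> with
  \<open>m = lam_tilde k q l\<close>. The first is the decisive one: the product
  \<open>l * m\<close> is a function of the bounded quantity \<open>m\<close> alone.\<close>

lemma lam_tilde_props:
  assumes "q > 0" "l \<ge> 1"
  shows "l * lam_tilde k q l = (k\<^sup>2 * q - (lam_tilde k q l)\<^sup>2) / 2"
    "0 \<le> lam_tilde k q l" "lam_tilde k q l \<le> k\<^sup>2 * q / 2 / l" "lam_tilde k q l \<le> k\<^sup>2 * q / 2"
proof -
  let ?m = "lam_tilde k q l"
  have nn: "0 \<le> k\<^sup>2 * q" using assms by simp
  have "(?m + l)\<^sup>2 = l\<^sup>2 + k\<^sup>2 * q" using nn by (simp add: lam_tilde_def)
  then have e: "?m\<^sup>2 + 2 * (l * ?m) = k\<^sup>2 * q" by (simp add: power2_sum mult_ac)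
  then show 1: "l * ?m = (k\<^sup>2 * q - ?m\<^sup>2) / 2" by (simp add: field_simps)
  show "0 \<le> ?m" using nn assms unfolding lam_tilde_def by (simp add: real_le_rsqrt)
  have "l * ?m \<le> k\<^sup>2 * q / 2" using 1 by simp
  then show "?m \<le> k\<^sup>2 * q / 2 / l" using assms by (simp add: pos_le_divide_eq mult_ac)
  also have "\<dots> \<le> k\<^sup>2 * q / 2"
    using assms nn mult_left_mono[of 1 l "k\<^sup>2 * q"] by (simp add: divide_le_eq)
  finally show "?m \<le> k\<^sup>2 * q / 2" .
qed

section \<open>Two integrations by parts along the contour\<close>

context wave_on_curve
begin

text \<open>Twice the Wirtinger derivative \<open>d/dz\<close> of the wave, continued analytically
  along the curve.\<close>

definition W :: "complex \<Rightarrow> complex" where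
  "W t = along (d1 F) t - \<i> * along (d2 F) t"

definition W' :: "complex \<Rightarrow> complex" where
  "W' t = (along (d1 (d1 F)) t * deriv x1 t + along (d2 (d1 F)) t * deriv x2 t)
    - \<i> * (along (d1 (d2 F)) t * deriv x1 t + along (d2 (d2 F)) t * deriv x2 t)"

lemma W_derivative: "t \<in> T \<Longrightarrow> (W has_field_derivative W' t) (at t)"
  unfolding W_def W'_def
  by (intro DERIV_diff DERIV_cmult along_derivative analytic_dF)

lemma hol_W: "W holomorphic_on T"
  unfolding W_def by (intro holomorphic_intros along_holomorphic analytic_dF)

lemma hol_W': "W' holomorphic_on T"
  unfolding W'_def by (intro holomorphic_intros along_holomorphic analytic_ddF holomorphic_deriv hol_x open_T)

text \<open>At a critical point of \<open>g\<close> one has \<open>x1' = - i x2'\<close>, so that \<open>W'\<close> reduces to the Laplacian.\<close>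

lemma W'_critical:
  assumes "connected C" "C \<subseteq> T" "- of_real pi \<in> C" "t0 \<in> C" "deriv g t0 = 0"
  shows "\<i> * W' t0 = - of_real (k\<^sup>2) * along F t0 * deriv x2 t0"
proof -
  have t0: "t0 \<in> T" using assms by blast
  have x: "deriv x1 t0 = - \<i> * deriv x2 t0"
    using deriv_g[OF t0] assms(5) by (simp add: eq_neg_iff_add_eq_0)
  have "(x1 t0, x2 t0) \<in> \<Omega>" using t0 sub_\<Omega> by auto
  then have c: "along (d1 (d2 F)) t0 = along (d2 (d1 F)) t0"
    unfolding along_def by (rule d1_d2_commute[OF analytic_F])
  \<comment> \<open>After substituting \<open>x1' = - i x2'\<close> the two mixed derivatives enter
    with opposite signs and cancel.\<close>
  have "\<i> * W' t0 = deriv x2 t0 * (along (d1 (d1 F)) t0 + along (d2 (d2 F)) t0)"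
    unfolding W'_def x c by (simp add: algebra_simps)
  also have "along (d1 (d1 F)) t0 + along (d2 (d2 F)) t0 = - of_real (k\<^sup>2) * along F t0"
    using helmholtz_along[OF assms(1-4)] by (simp add: eq_neg_iff_add_eq_0)
  finally show ?thesis by (simp add: mult_ac)
qed

text \<open>What remains after the second integration by parts, up to the factor
  \<open>exp (l g) / l\<close>. The variable \<open>\<epsilon>\<close> stands for
  \<open>lam_tilde\<close>, and \<open>l * lam_tilde\<close> has been rewritten as
  \<open>(k^2 q - \<epsilon>^2) / 2\<close>; the large parameter thus enters only through a bounded
  one.\<close>

definition amplitude :: "real \<Rightarrow> complex \<Rightarrow> complex \<Rightarrow> complex" where
  "amplitude q \<epsilon> t = exp (\<i> * \<epsilon> * x2 t) *
     (\<i> * W' t + (of_real (k\<^sup>2 * q) - \<epsilon>\<^sup>2) / 2 * ((\<i> * deriv x1 t + deriv x2 t) * along F t) - \<epsilon> * W t * deriv x2 t)"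

text \<open>The sum of the two terms integrated out: the one with \<open>along F\<close> removes the
  summand of order \<open>l\<close>, the one with \<open>W\<close> removes the remaining multiple of
  \<open>g'\<close>.\<close>

definition boundary_term :: "real \<Rightarrow> real \<Rightarrow> complex \<Rightarrow> complex" where
  "boundary_term q l t = (\<i> * along F t - \<i> / of_real l * W t) * exp (of_real l * g t + \<i> * of_real (lam_tilde k q l) * x2 t)"

definition integrand :: "real \<Rightarrow> real \<Rightarrow> complex \<Rightarrow> complex" where
  "integrand q l t = ((deriv x2 t * along (d1 F) t - deriv x1 t * along (d2 F) t) + \<i> * of_real l * deriv g t * along F t
      + \<i> * of_real (lam_tilde k q l) * deriv x1 t * along F t) * exp (of_real l * g t + \<i> * of_real (lam_tilde k q l) * x2 t)"

lemma hol_amplitude: "amplitude q \<epsilon> holomorphic_on T"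
  unfolding amplitude_def
  by (intro holomorphic_intros hol_x hol_W hol_W' along_holomorphic analytic_F holomorphic_deriv open_T) auto

lemma hol_integrand: "integrand q l holomorphic_on T"
  unfolding integrand_def
  by (intro holomorphic_intros hol_x hol_g along_holomorphic analytic_F analytic_dF holomorphic_deriv open_T)

lemma bdry_integral_eq: "bdry_integral k q uin x1 x2 l = contour_integral (linepath (- of_real pi) (of_real pi)) (integrand q l)"
proof -
  have "bdry_integral k q uin x1 x2 l = integral {-pi..pi} (\<lambda>t. integrand q l (of_real t))"
    unfolding bdry_integral_def Let_def integrand_def
    by (intro Henstock_Kurzweil_Integration.integral_cong) (simp add: on_curve)
  also have "\<dots> = contour_integral (linepath (- of_real pi) (of_real pi)) (integrand q l)"
    using contour_integral_linepath_Reals_eq[of "- of_real pi" "of_real pi" "integrand q l"] by simp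
  finally show ?thesis .
qed

text \<open>Two integrations by parts: \<open>V \<cdot> (x2', -x1') - i v' = - i g' W\<close> and \<open>- i W g' e\<^bsup>l g\<^esup>\<close> is again a
  derivative up to lower order.\<close>

lemma boundary_term_derivative:
  assumes "q > 0" "l \<ge> 1" "t \<in> T"
  shows "(boundary_term q l has_field_derivative
     integrand q l t - exp (of_real l * g t) * amplitude q (of_real (lam_tilde k q l)) t / of_real l) (at t)"
proof -
  define m where "m = complex_of_real (lam_tilde k q l)"
  define L where "L = complex_of_real l"
  have L0: "L \<noteq> 0" using assms by (simp add: L_def)
  have "L * m = of_real (l * lam_tilde k q l)" by (simp add: L_def m_def)
  also have "\<dots> = of_real ((k\<^sup>2 * q - (lam_tilde k q l)\<^sup>2) / 2)"
    by (simp only: lam_tilde_props(1)[OF assms(1,2)])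
  finally have Lm: "(of_real (k\<^sup>2 * q) - m\<^sup>2) / 2 = L * m" by (simp add: m_def)
  let ?E = "exp (L * g t + \<i> * m * x2 t)"
  note dx = holomorphic_derivI[OF hol_x(1) open_T assms(3)] holomorphic_derivI[OF hol_x(2) open_T assms(3)]
  note dg = holomorphic_derivI[OF hol_g open_T assms(3)]
  have "(boundary_term q l has_field_derivative
      (\<i> * (along (d1 F) t * deriv x1 t + along (d2 F) t * deriv x2 t) - \<i> / L * W' t) * ?E
      + (\<i> * along F t - \<i> / L * W t) * (?E * (L * deriv g t + \<i> * m * deriv x2 t))) (at t)"
    unfolding boundary_term_def L_def[symmetric] m_def[symmetric]
    by (auto intro!: derivative_eq_intros along_derivative[OF analytic_F assms(3)] W_derivative[OF assms(3)] dx dg simp: L0 mult_ac)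
  also have "(\<i> * (along (d1 F) t * deriv x1 t + along (d2 F) t * deriv x2 t) - \<i> / L * W' t) * ?E
      + (\<i> * along F t - \<i> / L * W t) * (?E * (L * deriv g t + \<i> * m * deriv x2 t))
     = integrand q l t - exp (L * g t) * amplitude q m t / L"
  proof -
    have eA: "exp (L * g t) * amplitude q m t / L = ?E * (\<i> * W' t / L + m * ((\<i> * deriv x1 t + deriv x2 t) * along F t) - m * W t * deriv x2 t / L)"
    proof -
      have "a * (b * (p + L * m * r - s)) / L = (a * b) * (p / L + m * r - s / L)" for a b p r s
        using L0 by (simp add: field_simps)
      then show ?thesis unfolding amplitude_def Lm exp_add .
    qed
    \<comment> \<open>With derivatives and exponential as free variables, \<open>X1 + i X2\<close>
      for \<open>g'\<close> and \<open>a - i b\<close> for \<open>W\<close>, the claim is an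
      identity of rational expressions.\<close>
    have "(\<i> * (a * X1 + b * X2) - \<i> / L * w') * E + (\<i> * v - \<i> / L * (a - \<i> * b)) * (E * (L * (X1 + \<i> * X2) + \<i> * m * X2))
      = ((X2 * a - X1 * b) + \<i> * L * (X1 + \<i> * X2) * v + \<i> * m * X1 * v) * E
        - E * (\<i> * w' / L + m * ((\<i> * X1 + X2) * v) - m * (a - \<i> * b) * X2 / L)" for a b v X1 X2 w' E
      using L0 by (simp add: field_simps)
    from this[of "along (d1 F) t" "deriv x1 t" "along (d2 F) t" "deriv x2 t" "W' t" ?E "along F t"]
    show ?thesis
      unfolding eA unfolding integrand_def L_def[symmetric] m_def[symmetric] deriv_g[OF assms(3)] W_def .
  qed
  finally show ?thesis by (simp add: L_def m_def)
qed

text \<open>\<open>T\<close> need not be simply connected, so moving the real segment to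
  \<open>c\<close> rests on the homotopy. Along \<open>c\<close> the exact part contributes its end
  values and the amplitude the rest.\<close>

lemma contour_integral_integrand:
  assumes "q > 0" "l \<ge> 1" and c: "valid_path c" "path_image c \<subseteq> T"
    "pathstart c = - of_real pi" "pathfinish c = of_real pi"
    "homotopic_paths T (linepath (- of_real pi) (of_real pi)) c"
  shows "bdry_integral k q uin x1 x2 l = boundary_term q l (of_real pi) - boundary_term q l (- of_real pi)
    + contour_integral c (\<lambda>t. exp (of_real l * g t) * amplitude q (of_real (lam_tilde k q l)) t) / of_real l"
proof -
  let ?A = "\<lambda>t. exp (of_real l * g t) * amplitude q (of_real (lam_tilde k q l)) t"
  have hA: "?A holomorphic_on T" by (intro holomorphic_intros hol_g hol_amplitude)
  have iA: "?A contour_integrable_on c" and iI: "integrand q l contour_integrable_on c"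
    using contour_integrable_holomorphic_simple[OF hA open_T c(1,2)]
      contour_integrable_holomorphic_simple[OF hol_integrand open_T c(1,2)] by auto
  have "((\<lambda>t. integrand q l t - ?A t / of_real l) has_contour_integral boundary_term q l (of_real pi) - boundary_term q l (- of_real pi)) c"
    using contour_integral_primitive[OF has_field_derivative_at_within[OF boundary_term_derivative[OF assms(1,2)]] c(1,2)]
    by (simp add: c(3,4))
  then have "contour_integral c (\<lambda>t. integrand q l t - ?A t / of_real l) = boundary_term q l (of_real pi) - boundary_term q l (- of_real pi)"
    by (rule contour_integral_unique)
  moreover have "contour_integral c (\<lambda>t. integrand q l t - ?A t / of_real l) = contour_integral c (integrand q l) - contour_integral c ?A / of_real l"
    by (subst contour_integral_diff[OF iI contour_integrable_div[OF iA]]) (simp add: contour_integral_div[OF iA])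
  moreover have "bdry_integral k q uin x1 x2 l = contour_integral c (integrand q l)"
    unfolding bdry_integral_eq
    by (rule Cauchy_theorem_homotopic_paths[OF c(5) open_T hol_integrand valid_path_linepath c(1)])
  ultimately show ?thesis by (simp add: algebra_simps)
qed

end

text \<open>Half of the exponent beats the factor \<open>l * sqrt l\<close>, the other half supplies
  \<open>1 / l\<close>. Using \<open>\<delta> / 2\<close> in \<open>exp_le_inverse_3_2\<close> is
  the origin of the 8.\<close>

lemma exp_decay:
  assumes "\<delta> > 0" "l \<ge> 1"
  shows "l * sqrt l * exp (- l * \<delta>) \<le> (8 / \<delta>\<^sup>2)\<^sup>2 / l"
proof -
  let ?c = "8 / \<delta>\<^sup>2" and ?s = "l * sqrt l"
  have s: "?s > 0" "l \<le> ?s" using assms by auto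
  have "exp (- l * (\<delta> / 2)) \<le> ?c / ?s"
    using exp_le_inverse_3_2[of "\<delta> / 2" l] assms by (simp add: power_divide)
  then have "exp (- l * (\<delta> / 2)) * exp (- l * (\<delta> / 2)) \<le> ?c / ?s * (?c / ?s)"
    using s(1) by (intro mult_mono) (auto intro: divide_nonneg_pos)
  then have "exp (- l * \<delta>) \<le> ?c / ?s * (?c / ?s)" by (simp add: exp_add[symmetric] mult.commute)
  then have "?s * exp (- l * \<delta>) \<le> ?s * (?c / ?s * (?c / ?s))" using s by (intro mult_left_mono) auto
  also have "\<dots> = ?c\<^sup>2 / ?s" using s by (simp add: power2_eq_square)
  also have "\<dots> \<le> ?c\<^sup>2 / l" using s assms by (intro divide_left_mono) auto
  finally show ?thesis .
qed

section \<open>Error terms and the asymptotic expansion\<close>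

context wave_on_curve
begin

lemma amplitude_bounded:
  assumes K: "compact K" "K \<subseteq> T"
  obtains M where "\<And>\<epsilon> t. \<epsilon> \<in> {0..C} \<Longrightarrow> t \<in> K \<Longrightarrow> norm (amplitude q (of_real \<epsilon>) t) \<le> M"
proof -
  have c: "continuous_on ({0..C} \<times> K) (\<lambda>p. f (snd p))" if "f holomorphic_on T" for f
    by (rule continuous_on_compose2[OF holomorphic_on_imp_continuous_on[OF that] continuous_on_snd[OF continuous_on_id]])
       (use K(2) in auto)
  have "continuous_on ({0..C} \<times> K) (\<lambda>p. amplitude q (of_real (fst p)) (snd p))"
    unfolding amplitude_def
    by (intro continuous_intros c hol_x hol_W hol_W' along_holomorphic analytic_F holomorphic_deriv open_T) auto
  then have "compact ((\<lambda>p. amplitude q (of_real (fst p)) (snd p)) ` ({0..C} \<times> K))"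
    by (intro compact_continuous_image compact_Times K) auto
  from compact_imp_bounded[OF this] obtain M
    where M: "\<And>p. p \<in> {0..C} \<times> K \<Longrightarrow> norm (amplitude q (of_real (fst p)) (snd p)) \<le> M"
    unfolding bounded_iff by blast
  have "norm (amplitude q (of_real \<epsilon>) t) \<le> M" if "\<epsilon> \<in> {0..C}" "t \<in> K" for \<epsilon> t
    using M[of "(\<epsilon>, t)"] that by simp
  then show ?thesis by (rule that)
qed

text \<open>For fixed \<open>t\<close> the amplitude is entire in \<open>\<epsilon>\<close>. Since
  \<open>lam_tilde\<close> is of order \<open>1 / l\<close>, this is the cost of passing to
  \<open>\<epsilon> = 0\<close> at the saddle.\<close>

lemma amplitude_Lipschitz:
  assumes "C \<ge> 0"
  obtains M where "\<And>\<epsilon>. 0 \<le> \<epsilon> \<Longrightarrow> \<epsilon> \<le> C \<Longrightarrow> norm (amplitude q (of_real \<epsilon>) t - amplitude q 0 t) \<le> M * \<epsilon>"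
proof -
  let ?\<Phi> = "\<lambda>\<epsilon>. amplitude q \<epsilon> t"
  have h: "?\<Phi> holomorphic_on UNIV" unfolding amplitude_def by (intro holomorphic_intros) auto
  have "compact (deriv ?\<Phi> ` cball 0 C)"
    using holomorphic_deriv[OF h open_UNIV]
    by (intro compact_continuous_image compact_cball holomorphic_on_imp_continuous_on) (auto intro: holomorphic_on_subset)
  from compact_imp_bounded[OF this] obtain M where M: "\<And>\<epsilon>. \<epsilon> \<in> cball 0 C \<Longrightarrow> norm (deriv ?\<Phi> \<epsilon>) \<le> M"
    unfolding bounded_iff by blast
  show ?thesis
  proof (rule that[of M])
    fix \<epsilon> :: real assume e: "0 \<le> \<epsilon>" "\<epsilon> \<le> C"
    have "norm (?\<Phi> (of_real \<epsilon>) - ?\<Phi> 0) \<le> M * norm (of_real \<epsilon> - 0 :: complex)"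
      by (rule field_differentiable_bound[OF convex_cball[of 0 C] has_field_derivative_at_within[OF holomorphic_derivI[OF h open_UNIV UNIV_I]] M])
         (use e assms in auto)
    then show "norm (?\<Phi> (of_real \<epsilon>) - ?\<Phi> 0) \<le> M * \<epsilon>" using e by simp
  qed
qed

text \<open>At a real parameter \<open>x2\<close> is real, so the factor with
  \<open>lam_tilde\<close> has modulus one, and the gap between \<open>Re b\<close> and
  \<open>Re g\<close> makes the rest exponentially small.\<close>

lemma boundary_term_bound:
  assumes l: "l \<ge> 1" and x: "x \<in> {-pi..pi}" and below: "Re (g (of_real x)) < Re b"
  shows "l * sqrt l * norm (exp (- of_real l * b) * boundary_term q l (of_real x)) \<le>
    (norm (along F (of_real x)) + norm (W (of_real x))) * (8 / (Re b - Re (g (of_real x)))\<^sup>2)\<^sup>2 / l"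
proof -
  let ?t = "complex_of_real x" and ?\<delta> = "Re b - Re (g (of_real x))"
  have "Im (x2 ?t) = 0" using real_x x by (simp add: complex_is_Real_iff)
  then have n: "norm (exp (- of_real l * b)) * norm (exp (of_real l * g ?t + \<i> * of_real (lam_tilde k q l) * x2 ?t)) = exp (- l * ?\<delta>)"
    by (simp add: exp_add[symmetric] algebra_simps)
  have "norm (\<i> * along F ?t - \<i> / of_real l * W ?t) \<le> norm (along F ?t) + norm (W ?t) / l"
    by (rule order_trans[OF norm_triangle_ineq4]) (use l in \<open>simp add: norm_mult norm_divide\<close>)
  also have "\<dots> \<le> norm (along F ?t) + norm (W ?t)"
    using l mult_left_mono[of 1 l "norm (W ?t)"] by (simp add: divide_le_eq)
  finally have c: "norm (\<i> * along F ?t - \<i> / of_real l * W ?t) \<le> norm (along F ?t) + norm (W ?t)" .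
  have "l * sqrt l * norm (exp (- of_real l * b) * boundary_term q l ?t)
      = norm (\<i> * along F ?t - \<i> / of_real l * W ?t) * (l * sqrt l * exp (- l * ?\<delta>))"
    unfolding boundary_term_def norm_mult n[symmetric] by (simp only: mult_ac)
  also have "\<dots> \<le> (norm (along F ?t) + norm (W ?t)) * ((8 / ?\<delta>\<^sup>2)\<^sup>2 / l)"
    by (intro mult_mono c exp_decay) (use l below in auto)
  finally show ?thesis by simp
qed

text \<open>At the critical point \<open>i x1' = x2'\<close>. The \<open>W'\<close> part contributes
  \<open>- k^2\<close>, and the coefficient \<open>k^2 q / 2\<close> multiplies a doubled
  \<open>x2'\<close>; together they give \<open>k^2 (q - 1)\<close>.\<close>

lemma amplitude_at_saddle:
  assumes "connected C" "C \<subseteq> T" "- of_real pi \<in> C" "t0 \<in> C" "deriv g t0 = 0"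
  shows "amplitude q 0 t0 = of_real (k\<^sup>2 * (q - 1)) * F (x1 t0, x2 t0) * deriv x2 t0"
proof -
  have t0: "t0 \<in> T" using assms by blast
  have "deriv x1 t0 = - (\<i> * deriv x2 t0)"
    using deriv_g[OF t0] assms(5) by (simp add: eq_neg_iff_add_eq_0)
  then have x: "\<i> * deriv x1 t0 = deriv x2 t0" by simp
  show ?thesis
    unfolding amplitude_def W'_critical[OF assms] x by (simp add: along_def algebra_simps)
qed

lemma bdry_integral_asymptotics:
  assumes q: "q > 0" and t0: "t0 \<in> T" "deriv g t0 = 0" "deriv (deriv g) t0 \<noteq> 0" "t0 \<noteq> of_real pi" "t0 \<noteq> - of_real pi"
    and c: "valid_path c" "path_image c \<subseteq> T"
    "pathstart c = - of_real pi" "pathfinish c = of_real pi"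
    "homotopic_paths T (linepath (- of_real pi) (of_real pi)) c"
    and pass: "passes_through c t0 (deriv (deriv g) t0) \<omega> \<omega>0"
    and below: "\<forall>t \<in> path_image c - {t0}. Re (g t) < Re (g t0)"
  obtains M where "\<And>l. l \<ge> 1 \<Longrightarrow>
    norm (of_real (l * sqrt l) * exp (- of_real l * g t0) * bdry_integral k q uin x1 x2 l
      - of_real (k\<^sup>2 * (q - 1)) * branch_sqrt (deriv (deriv g) t0) \<omega>0 * F (x1 t0, x2 t0) * deriv x2 t0) \<le> M / l"
proof -
  \<comment> \<open>An upper bound for \<open>lam_tilde\<close> when \<open>l \<ge> 1\<close>, so
    that all amplitudes that occur lie in one family with parameter in
    \<open>{0..C}\<close>.\<close>
  define C where "C = k\<^sup>2 * q / 2"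
  let ?S = "branch_sqrt (deriv (deriv g) t0) \<omega>0"
  have C: "C \<ge> 0" using q by (simp add: C_def)
  let ?\<H> = "(\<lambda>\<epsilon>. amplitude q (of_real \<epsilon>)) ` {0..C}"
  obtain C0 where C0: "\<forall>h\<in>?\<H>. \<forall>l\<ge>1.
    norm (contour_integral c (\<lambda>t. exp (of_real l * (g t - g t0)) * h t) - ?S * h t0 / of_real (sqrt l)) \<le> C0 / (l * sqrt l)"
  proof (rule saddle_point_asymptotics[OF open_T hol_g t0(1-3) c(1,2) pass below])
    show "\<forall>h\<in>?\<H>. h holomorphic_on T" using hol_amplitude by auto
    show "\<forall>K. compact K \<longrightarrow> K \<subseteq> T \<longrightarrow> (\<exists>M. \<forall>h\<in>?\<H>. \<forall>t\<in>K. norm (h t) \<le> M)"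
    proof (intro allI impI)
      fix K assume "compact K" "K \<subseteq> T"
      then obtain M where "\<And>\<epsilon> t. \<epsilon> \<in> {0..C} \<Longrightarrow> t \<in> K \<Longrightarrow> norm (amplitude q (of_real \<epsilon>) t) \<le> M"
        by (rule amplitude_bounded) (rule that)
      then show "\<exists>M. \<forall>h\<in>?\<H>. \<forall>t\<in>K. norm (h t) \<le> M" by blast
    qed
  qed (rule that)
  obtain M1 where M1: "\<And>\<epsilon>. 0 \<le> \<epsilon> \<Longrightarrow> \<epsilon> \<le> C \<Longrightarrow> norm (amplitude q (of_real \<epsilon>) t0 - amplitude q 0 t0) \<le> M1 * \<epsilon>"
    by (rule amplitude_Lipschitz[OF C]) (rule that)
  have ends: "- of_real pi \<in> path_image c" "of_real pi \<in> path_image c"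
    using c(3,4) pathstart_in_path_image pathfinish_in_path_image by metis+
  have t0c: "t0 \<in> path_image c"
    using pass unfolding passes_through_def path_image_def by force
  have amp0: "amplitude q 0 t0 = of_real (k\<^sup>2 * (q - 1)) * F (x1 t0, x2 t0) * deriv x2 t0"
    by (rule amplitude_at_saddle[OF connected_path_image[OF valid_path_imp_path[OF c(1)]] c(2) ends(1) t0c t0(2)])
  have below_pi: "Re (g (of_real pi)) < Re (g t0)" "Re (g (of_real (- pi))) < Re (g t0)"
    using below ends t0(4,5) by auto
  define B where "B x = (norm (along F (of_real x)) + norm (W (of_real x))) * (8 / (Re (g t0) - Re (g (of_real x)))\<^sup>2)\<^sup>2" for x
  show ?thesis
  \<comment> \<open>One constant per source of error: the two end points, the Laplace remainder, and
    the shift of the amplitude parameter from \<open>lam_tilde\<close> to 0.\<close>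
  proof (rule that[of "B pi + B (- pi) + C0 + norm ?S * (\<bar>M1\<bar> * C)"])
    fix l :: real assume l: "l \<ge> 1"
    define m where "m = lam_tilde k q l"
    have m: "0 \<le> m" "m \<le> C / l" "m \<le> C"
      using lam_tilde_props(2-4)[OF q l, of k] by (simp_all add: m_def C_def)
    let ?h = "amplitude q (of_real m)"
    let ?s = "complex_of_real (l * sqrt l)" and ?e = "exp (- of_real l * g t0)"
    let ?J = "contour_integral c (\<lambda>t. exp (of_real l * (g t - g t0)) * ?h t)"
    let ?b1 = "boundary_term q l (of_real pi)" and ?b2 = "boundary_term q l (of_real (- pi))"
    have l0: "complex_of_real l \<noteq> 0" "complex_of_real (sqrt l) \<noteq> 0" using l by auto
    have ci: "(\<lambda>t. exp (of_real l * g t) * ?h t) contour_integrable_on c"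
      by (rule contour_integrable_holomorphic_simple[OF _ open_T c(1,2)]) (intro holomorphic_intros hol_g hol_amplitude)
    have eJ: "?e * contour_integral c (\<lambda>t. exp (of_real l * g t) * ?h t) = ?J"
    proof -
      have "(\<lambda>t. exp (of_real l * (g t - g t0)) * ?h t) = (\<lambda>t. ?e * (exp (of_real l * g t) * ?h t))"
        by (auto simp: right_diff_distrib exp_diff exp_minus field_simps)
      then show ?thesis using contour_integral_lmul[OF ci, of ?e] by simp
    qed
    have "?s * ?e * bdry_integral k q uin x1 x2 l
        = ?s * (?e * ?b1) - ?s * (?e * ?b2) + ?s * (?e * contour_integral c (\<lambda>t. exp (of_real l * g t) * ?h t)) / of_real l"
      unfolding contour_integral_integrand[OF q l c] m_def by (simp add: algebra_simps)
    also have "\<dots> = ?s * (?e * ?b1) - ?s * (?e * ?b2) + of_real (sqrt l) * ?J"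
      unfolding eJ using l0 by simp
    finally have eq: "?s * ?e * bdry_integral k q uin x1 x2 l - ?S * amplitude q 0 t0
       = (?s * (?e * ?b1) - ?s * (?e * ?b2)) + (of_real (sqrt l) * (?J - ?S * ?h t0 / of_real (sqrt l)) + ?S * (?h t0 - amplitude q 0 t0))"
      using l0 by (simp add: algebra_simps)
    have n1: "norm (?s * (?e * ?b1)) \<le> B pi / l"
      using boundary_term_bound[OF l _ below_pi(1), of q] l by (simp add: norm_mult B_def)
    have n2: "norm (?s * (?e * ?b2)) \<le> B (- pi) / l"
      using boundary_term_bound[OF l _ below_pi(2), of q] l by (simp add: norm_mult B_def)
    have n3: "norm (of_real (sqrt l) * (?J - ?S * ?h t0 / of_real (sqrt l))) \<le> C0 / l"
    proof -
      have "norm (of_real (sqrt l) * (?J - ?S * ?h t0 / of_real (sqrt l))) = sqrt l * norm (?J - ?S * ?h t0 / of_real (sqrt l))"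
        using l by (simp add: norm_mult)
      also have "\<dots> \<le> sqrt l * (C0 / (l * sqrt l))"
        using m l by (intro mult_left_mono C0[rule_format]) auto
      also have "\<dots> = C0 / l" using l by simp
      finally show ?thesis .
    qed
    have n4: "norm (?S * (?h t0 - amplitude q 0 t0)) \<le> norm ?S * (\<bar>M1\<bar> * C) / l"
    proof -
      have "norm (?h t0 - amplitude q 0 t0) \<le> M1 * m" using m by (intro M1)
      also have "\<dots> \<le> \<bar>M1\<bar> * (C / l)" using m by (intro mult_mono) auto
      finally have "norm ?S * norm (?h t0 - amplitude q 0 t0) \<le> norm ?S * (\<bar>M1\<bar> * (C / l))" by (intro mult_left_mono) auto
      then show ?thesis by (simp add: norm_mult)
    qed
    have "norm (?s * ?e * bdry_integral k q uin x1 x2 l - ?S * amplitude q 0 t0) \<le>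
        (B pi / l + B (- pi) / l) + (C0 / l + norm ?S * (\<bar>M1\<bar> * C) / l)"
      unfolding eq
      by (rule norm_triangle_le[OF add_mono[OF order_trans[OF norm_triangle_ineq4 add_mono[OF n1 n2]] norm_triangle_le[OF add_mono[OF n3 n4]]]])
    also have "\<dots> = (B pi + B (- pi) + C0 + norm ?S * (\<bar>M1\<bar> * C)) / l" by (simp add: add_divide_distrib)
    finally show "norm (?s * ?e * bdry_integral k q uin x1 x2 l
      - of_real (k\<^sup>2 * (q - 1)) * branch_sqrt (deriv (deriv g) t0) \<omega>0 * F (x1 t0, x2 t0) * deriv x2 t0) \<le>
        (B pi + B (- pi) + C0 + norm ?S * (\<bar>M1\<bar> * C)) / l"
      unfolding amp0 by (simp only: mult_ac)
  qed
qed

end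

section \<open>Vanishing of the boundary integral for a nonscattering wave\<close>

context wave_on_curve
begin

text \<open>Green's second identity for \<open>uin\<close> and the exponential solution
  \<open>\<phi>\<close>: the two wave numbers differ, so the area integrand is
  \<open>k^2 (q - 1) uin \<phi>\<close>, whose integral vanishes by orthogonality.\<close>

lemma nonscattering_imp_bdry_integral_0:
  assumes k: "k > 0" "q > 0" "q \<noteq> 1"
    and curve: "simple_path (curve_path x1 x2)" "pathfinish (curve_path x1 x2) = pathstart (curve_path x1 x2)"
      "counterclockwise (curve_path x1 x2)"
    and ns: "nonscattering k q (inside (path_image (curve_path x1 x2))) uin"
  shows "bdry_integral k q uin x1 x2 l = 0"
proof -
  let ?p = "curve_path x1 x2" and ?D = "inside (path_image (curve_path x1 x2))"
  define m where "m = lam_tilde k q l"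
  have lm: "(l + m)\<^sup>2 = l\<^sup>2 + k\<^sup>2 * q" using k by (simp add: m_def lam_tilde_def)
  \<comment> \<open>The exponents satisfy \<open>c1^2 + c2^2 = l^2 - (l + m)^2 = - k^2 q\<close>,
    which is what the definition of \<open>lam_tilde\<close> is made for.\<close>
  define c1 where "c1 = complex_of_real l"
  define c2 where "c2 = \<i> * complex_of_real (l + m)"
  have "c2\<^sup>2 = - of_real ((l + m)\<^sup>2)" by (simp add: c2_def power_mult_distrib)
  then have c12: "c1\<^sup>2 + c2\<^sup>2 = - of_real (k\<^sup>2 * q)" unfolding lm by (simp add: c1_def)
  define \<phi> where "\<phi> z = exp (c1 * of_real (fst z) + c2 * of_real (snd z))" for z :: "real \<times> real"
  have d\<phi>: "(\<phi> has_derivative (\<lambda>b. \<phi> z * (c1 * of_real (fst b) + c2 * of_real (snd b)))) (at z)" for z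
    unfolding \<phi>_def by (rule has_derivative_exp_linear)
  have C\<phi>: "Ck n \<phi>" for n unfolding \<phi>_def by (rule Ck_exp_linear)
  have p\<phi>: "partial (1, 0) \<phi> = (\<lambda>z. c1 * \<phi> z)" "partial (0, 1) \<phi> = (\<lambda>z. c2 * \<phi> z)"
    using partial_eq[OF d\<phi>] by (auto simp: fun_eq_iff)
  have pc: "partial b (\<lambda>z. c * \<phi> z) z = c * partial b \<phi> z" for b c z
    by (rule trans[OF partial_eq[OF has_derivative_mult_right[OF d\<phi>]]]) (simp add: partial_eq[OF d\<phi>])
  have lap: "laplacian \<phi> z + of_real (k\<^sup>2 * q) * \<phi> z = 0" for z
  proof -
    have "laplacian \<phi> z + of_real (k\<^sup>2 * q) * \<phi> z = (c1\<^sup>2 + c2\<^sup>2 + of_real (k\<^sup>2 * q)) * \<phi> z"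
      unfolding laplacian_plane p\<phi> pc by (simp add: p\<phi> power2_eq_square algebra_simps)
    then show ?thesis by (simp add: c12)
  qed
  have cp: "compact (path_image ?p)" using curve(1) by (simp add: compact_path_image simple_path_imp_path)
  have D: "open ?D" "bounded ?D"
    using cp by (simp_all add: open_inside compact_imp_closed bounded_inside compact_imp_bounded)
  note u = Ck_2_differentiable[OF Ck_uin]
  have cu: "continuous_on UNIV uin" by (rule Ck_1_partials(1)[OF u(4)])
  have orth: "(LINT z:?D|lebesgue. uin z * \<phi> z) = 0"
    by (rule nonscattering_orthogonality[OF ns D k(1,3) cu C\<phi> lap])
  \<comment> \<open>\<open>P dx + Q dy\<close> is the flux form of Green's second identity,
    \<open>\<phi>\<close> times the normal derivative of \<open>uin\<close> minus \<open>uin\<close>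
    times that of \<open>\<phi>\<close>, with outward normal element
    \<open>(dy, -dx)\<close>.\<close>
  define P where "P z = \<phi> z * (c2 * uin z - partial (0, 1) uin z)" for z
  define Q where "Q z = \<phi> z * (partial (1, 0) uin z - c1 * uin z)" for z
  have CP: "Ck 1 P" "Ck 1 Q"
    unfolding P_def Q_def by (intro Ck_mult Ck_diff Ck_const C\<phi> u)+
  have du: "(uin has_derivative (\<lambda>b. partial b uin z)) (at z)"
    "(partial (1, 0) uin has_derivative (\<lambda>b. partial b (partial (1, 0) uin) z)) (at z)"
    "(partial (0, 1) uin has_derivative (\<lambda>b. partial b (partial (0, 1) uin) z)) (at z)" for z
    by (intro has_derivative_frechet u)+
  have dP: "partial (0, 1) P z = \<phi> z * (c2 * partial (0, 1) uin z - partial (0, 1) (partial (0, 1) uin) z)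
        + \<phi> z * c2 * (c2 * uin z - partial (0, 1) uin z)" for z
    unfolding P_def
    by (rule trans[OF partial_eq[OF has_derivative_mult[OF d\<phi> has_derivative_diff[OF has_derivative_mult_right[OF du(1)] du(3)]]]]) simp
  have dQ: "partial (1, 0) Q z = \<phi> z * (partial (1, 0) (partial (1, 0) uin) z - c1 * partial (1, 0) uin z)
        + \<phi> z * c1 * (partial (1, 0) uin z - c1 * uin z)" for z
    unfolding Q_def
    by (rule trans[OF partial_eq[OF has_derivative_mult[OF d\<phi> has_derivative_diff[OF du(2) has_derivative_mult_right[OF du(1)]]]]]) simp
  have "partial (1, 0) Q z - partial (0, 1) P z = \<phi> z * (laplacian uin z - (c1\<^sup>2 + c2\<^sup>2) * uin z)" for z
    unfolding laplacian_plane dP dQ by (simp add: power2_eq_square algebra_simps)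
  moreover have "laplacian uin z = - of_real (k\<^sup>2) * uin z" for z
    using helmholtz by (simp only: eq_neg_iff_add_eq_0 mult_minus_left)
  ultimately have green: "partial (1, 0) Q z - partial (0, 1) P z = of_real (k\<^sup>2 * (q - 1)) * (uin z * \<phi> z)" for z
    unfolding c12 by (simp add: algebra_simps)
  define d where "d s = 2 * of_real pi * deriv g (of_real (2 * pi * s - pi))" for s
  have par: "2 * pi * s - pi \<in> {-pi..pi}" if "s \<in> {0..1}" for s
    using that mult_left_mono[of s 1 pi] by auto
  have inT: "of_real (2 * pi * s - pi) \<in> T" if "s \<in> {0..1}" for s
    using real_T par[OF that] by blast
  have cptg: "cpt (?p s) = g (of_real (2 * pi * s - pi))" if "s \<in> {0..1}" for s
    using real_point(1,2)[OF par[OF that]] by (simp add: cpt_eq curve_path_def gfun_def)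
  have dp: "((\<lambda>s. cpt (?p s)) has_vector_derivative d s) (at s within {0..1})" if s: "s \<in> {0..1}" for s
  proof -
    have "((\<lambda>w. g (2 * of_real pi * w - of_real pi)) has_field_derivative deriv g (2 * of_real pi * of_real s - of_real pi) * (2 * of_real pi)) (at (of_real s))"
      using inT[OF s] by (intro DERIV_chain2[OF holomorphic_derivI[OF hol_g open_T]]) (auto intro!: derivative_eq_intros)
    from has_vector_derivative_real_field[OF this]
    have "((\<lambda>s. g (of_real (2 * pi * s - pi))) has_vector_derivative d s) (at s)"
      by (simp add: d_def mult_ac)
    from has_vector_derivative_at_within[OF this]
    show ?thesis by (rule has_vector_derivative_transform[OF s, rotated]) (simp add: cptg)
  qed
  have cd: "continuous_on {0..1} d"
    unfolding d_def
    by (intro continuous_intros continuous_on_compose2[OF holomorphic_on_imp_continuous_on[OF holomorphic_deriv[OF hol_g open_T]]])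
       (use inT in auto)
  define f where "f t = P (curve_pt x1 x2 t) * deriv x1 (of_real t) + Q (curve_pt x1 x2 t) * deriv x2 (of_real t)" for t
  have fint: "bdry_integral k q uin x1 x2 l = integral {-pi..pi} f"
    unfolding bdry_integral_def Let_def
  proof (intro Henstock_Kurzweil_Integration.integral_cong)
    fix t assume t: "t \<in> {-pi..pi}"
    define z where "z = curve_pt x1 x2 t"
    define X1 X2 V1 V2 v where "X1 = deriv x1 (of_real t)" and "X2 = deriv x2 (of_real t)"
      and "V1 = partial (1, 0) uin z" and "V2 = partial (0, 1) uin z" and "v = uin z"
    have tT: "of_real t \<in> T" using real_T t by blast
    \<comment> \<open>On the curve \<open>l x1 + i (l + m) x2 = l g + i m x2\<close>, so the test
      solution restricts to the exponential of the boundary integral.\<close>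
    have \<phi>z: "\<phi> z = exp (of_real l * g (of_real t) + \<i> * of_real m * x2 (of_real t))"
      unfolding \<phi>_def z_def c1_def c2_def gfun_def real_point(1,2)[OF t] by (simp add: algebra_simps)
    have "((X2 * V1 - X1 * V2) + \<i> * of_real l * (X1 + \<i> * X2) * v + \<i> * of_real m * X1 * v) * \<phi> z
        = \<phi> z * (c2 * v - V2) * X1 + \<phi> z * (V1 - c1 * v) * X2"
      by (simp add: c1_def c2_def algebra_simps)
    then show "(deriv x2 (of_real t) * partial (1, 0) uin (curve_pt x1 x2 t) - deriv x1 (of_real t) * partial (0, 1) uin (curve_pt x1 x2 t)
        + \<i> * of_real l * deriv g (of_real t) * uin (curve_pt x1 x2 t)
        + \<i> * of_real (lam_tilde k q l) * deriv x1 (of_real t) * uin (curve_pt x1 x2 t))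
        * exp (of_real l * g (of_real t) + \<i> * of_real (lam_tilde k q l) * x2 (of_real t)) = f t"
      unfolding f_def P_def Q_def deriv_g[OF tT]
      unfolding z_def[symmetric] m_def[symmetric] \<phi>z
      unfolding X1_def[symmetric] X2_def[symmetric] V1_def[symmetric] V2_def[symmetric] v_def[symmetric] .
  qed
  have cf: "continuous_on {-pi..pi} f"
  proof -
    have x: "continuous_on {-pi..pi} (\<lambda>t. h (of_real t))" if "h holomorphic_on T" for h
      by (rule continuous_on_compose2[OF holomorphic_on_imp_continuous_on[OF that]]) (use real_T in \<open>auto intro!: continuous_intros\<close>)
    have "continuous_on {-pi..pi} (curve_pt x1 x2)"
      unfolding curve_pt_def by (intro continuous_intros x hol_x)
    then show ?thesis
      unfolding f_def
      by (intro continuous_intros x holomorphic_deriv hol_x open_T continuous_on_compose2[OF Ck_1_partials(1)[OF CP(1)]]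
          continuous_on_compose2[OF Ck_1_partials(1)[OF CP(2)]]) auto
  qed
  have "((\<lambda>s. (2 * pi) *\<^sub>R f (2 * pi * s - pi)) has_integral (integral {2 * pi * 0 - pi..2 * pi * 1 - pi} f)) {0..1}"
    by (rule has_integral_substitution[where c = "-pi" and d = pi and g = "\<lambda>s. 2 * pi * s - pi"])
       (use par cf in \<open>auto intro!: derivative_eq_intros\<close>)
  then have "((\<lambda>s. (2 * pi) *\<^sub>R f (2 * pi * s - pi)) has_integral integral {-pi..pi} f) {0..1}"
    by (simp only: mult_zero_right mult_1_right diff_0) simp
  from integral_unique[OF this]
  have "integral {-pi..pi} f = integral {0..1} (\<lambda>s. (2 * pi) *\<^sub>R f (2 * pi * s - pi))" by (rule sym)
  also have "\<dots> = integral {0..1} (\<lambda>s. P (?p s) * of_real (Re (d s)) + Q (?p s) * of_real (Im (d s)))"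
  proof (intro Henstock_Kurzweil_Integration.integral_cong)
    fix s :: real assume s: "s \<in> {0..1}"
    let ?t = "2 * pi * s - pi"
    obtain a b where ab: "deriv x1 (of_real ?t) = of_real a" "deriv x2 (of_real ?t) = of_real b"
      using real_derivs[OF par[OF s]] by blast
    have "d s = of_real (2 * pi * a) + \<i> * of_real (2 * pi * b)"
      unfolding d_def deriv_g[OF inT[OF s]] ab by (simp add: algebra_simps)
    then have "Re (d s) = 2 * pi * a" "Im (d s) = 2 * pi * b" by simp_all
    then show "(2 * pi) *\<^sub>R f ?t = P (?p s) * of_real (Re (d s)) + Q (?p s) * of_real (Im (d s))"
      unfolding f_def ab by (simp add: curve_path_def scaleR_conv_of_real algebra_simps)
  qed
  also have "\<dots> = (LINT z:?D|lborel. partial (1, 0) Q z - partial (0, 1) P z)"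
    by (rule green_curve[OF curve dp cd CP])
  also have "\<dots> = of_real (k\<^sup>2 * (q - 1)) * (LINT z:?D|lborel. uin z * \<phi> z)"
    unfolding green by (rule set_integral_mult_right)
  also have "(LINT z:?D|lborel. uin z * \<phi> z) = (LINT z:?D|lebesgue. uin z * \<phi> z)"
  proof -
    have [measurable]: "uin \<in> borel_measurable borel" "\<phi> \<in> borel_measurable borel" "?D \<in> sets borel"
      using cu C\<phi>[of 0] D(1) by (auto intro: borel_measurable_continuous_onI)
    have "(\<lambda>z. indicator ?D z *\<^sub>R (uin z * \<phi> z)) \<in> borel_measurable lborel" by measurable
    from integral_completion[OF this] show ?thesis by (simp add: set_lebesgue_integral_def)
  qed
  finally show ?thesis unfolding fint orth by simp
qed

end

theorem theorem3p1:
  fixes k q :: real and uin :: "real \<times> real \<Rightarrow> complex"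
    and x1 x2 :: "complex \<Rightarrow> complex" and T :: "complex set" and D :: "(real \<times> real) set"
    and t0 :: complex and c :: "real \<Rightarrow> complex" and \<omega> \<omega>0 :: real
    and F :: "complex \<times> complex \<Rightarrow> complex" and \<Omega> :: "(complex \<times> complex) set"
    and g :: "complex \<Rightarrow> complex" and I :: "real \<Rightarrow> complex" and C1 :: complex
  defines "g \<equiv> gfun x1 x2"
    and "I \<equiv> bdry_integral k q uin x1 x2"
    and "C1 \<equiv> of_real (k\<^sup>2 * (q - 1)) * branch_sqrt (deriv (deriv g) t0) \<omega>0
                * F (x1 t0, x2 t0) * deriv x2 t0"
  assumes "k > 0" and "incident_wave k uin"
    \<comment> \<open>the boundary curve\<close>
    and "open T" and "of_real ` {-pi..pi} \<subseteq> T"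
    and "x1 holomorphic_on T" and "x2 holomorphic_on T"
    and "\<forall>t\<in>{-pi..pi}. x1 (of_real t) \<in> \<real> \<and> x2 (of_real t) \<in> \<real>"
    and "simple_path (curve_path x1 x2)"
    and "pathfinish (curve_path x1 x2) = pathstart (curve_path x1 x2)"
    and "counterclockwise (curve_path x1 x2)"
    and "finite {t\<in>{-pi..pi}. deriv x1 (of_real t) = 0 \<and> deriv x2 (of_real t) = 0}"
    \<comment> \<open>the scatterer\<close>
    and "D = inside (path_image (curve_path x1 x2))" and "q > 0" and "q \<noteq> 1"
    \<comment> \<open>the simple critical point\<close>
    and "t0 \<in> T" and "deriv g t0 = 0" and "deriv (deriv g) t0 \<noteq> 0"
    and "t0 \<noteq> of_real pi" and "t0 \<noteq> - of_real pi"
    \<comment> \<open>the contour\<close>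
    and "valid_path c" and "path_image c \<subseteq> T"
    and "pathstart c = - of_real pi" and "pathfinish c = of_real pi"
    and "homotopic_paths T (linepath (- of_real pi) (of_real pi)) c"
    and "passes_through c t0 (deriv (deriv g) t0) \<omega> \<omega>0"
    and "\<forall>t \<in> path_image c - {t0}. Re (g t) < Re (g t0)"
    \<comment> \<open>the analytic extension of the incident wave\<close>
    and "open \<Omega>" and "(\<lambda>t. (x1 t, x2 t)) ` T \<subseteq> \<Omega>" and "analytic2_on F \<Omega>"
    and "\<forall>a b. (of_real a, of_real b) \<in> \<Omega> \<longrightarrow> F (of_real a, of_real b) = uin (a, b)"
  shows "(\<exists>E. E \<in> O[at_top](\<lambda>l::real. complex_of_real (1 / l)) \<and>
            (\<forall>\<^sub>F l in at_top. I l = of_real (1 / l powr (3 / 2)) * exp (of_real l * g t0) * (C1 + E l)))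
       \<and> (of_real (q - 1) * F (x1 t0, x2 t0) * deriv x2 t0 \<noteq> 0 \<longrightarrow> scattered k q D uin)"
proof -
  interpret wave_on_curve k uin x1 x2 T F \<Omega>
    using assms(4-) by unfold_locales (simp_all add: incident_wave_def)
  note as = assms(4-)[unfolded g_def]
  obtain M where M: "\<And>l. l \<ge> 1 \<Longrightarrow>
    norm (of_real (l * sqrt l) * exp (- of_real l * gfun x1 x2 t0) * bdry_integral k q uin x1 x2 l
      - of_real (k\<^sup>2 * (q - 1)) * branch_sqrt (deriv (deriv (gfun x1 x2)) t0) \<omega>0 * F (x1 t0, x2 t0) * deriv x2 t0) \<le> M / l"
    by (rule bdry_integral_asymptotics[of q t0 c \<omega> \<omega>0]) (use as that in blast)+
  \<comment> \<open>The remainder is obtained by solving the expansion for it, so the expansion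
    holds by algebra and only the decay of \<open>E\<close> carries content.\<close>
  define E where "E l = of_real (l * sqrt l) * exp (- of_real l * g t0) * I l - C1" for l
  have E: "norm (E l) \<le> M / l" if "l \<ge> 1" for l
    using M[OF that] unfolding E_def g_def I_def C1_def .
  have O: "E \<in> O[at_top](\<lambda>l::real. complex_of_real (1 / l))"
  proof (rule bigoI[of _ M])
    show "\<forall>\<^sub>F l in at_top. norm (E l) \<le> M * norm (complex_of_real (1 / l))"
      using eventually_ge_at_top[of 1] by eventually_elim (use E in \<open>simp add: norm_divide\<close>)
  qed
  have eq: "I l = of_real (1 / l powr (3 / 2)) * exp (of_real l * g t0) * (C1 + E l)" if "l \<ge> 1" for l
  proof -
    have "l powr (3 / 2) = l powr (1 + 1 / 2)" by simp
    also have "\<dots> = l * sqrt l" using that by (subst powr_add) (simp add: powr_half_sqrt)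
    finally have p: "l powr (3 / 2) = l * sqrt l" .
    show ?thesis using that unfolding p E_def by (simp add: exp_minus)
  qed
  have "scattered k q D uin" if nd: "of_real (q - 1) * F (x1 t0, x2 t0) * deriv x2 t0 \<noteq> 0"
  proof
    assume ns: "nonscattering k q D uin"
    have "I l = 0" for l
      unfolding I_def by (rule nonscattering_imp_bdry_integral_0) (use as ns in blast)+
    \<comment> \<open>If the integral vanishes identically, the remainder is constant. Being of
      order \<open>1 / l\<close> it must be 0, whereas \<open>k\<close>, the branch factor and the
      nondegeneracy condition make \<open>C1\<close> nonzero.\<close>
    then have "E = (\<lambda>l. - C1)" by (auto simp: E_def fun_eq_iff)
    then have "norm C1 \<le> M / l" if "l \<ge> 1" for l using E[OF that] by simp
    then have "norm C1 \<le> 0"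
      by (intro tendsto_lowerbound[of "\<lambda>l. M / l" 0 at_top])
         (auto intro!: tendsto_divide_0[OF tendsto_const] filterlim_at_top_imp_at_infinity filterlim_ident eventually_mono[OF eventually_ge_at_top[of 1]])
    moreover have "branch_sqrt (deriv (deriv g) t0) \<omega>0 \<noteq> 0"
      using as by (simp add: branch_sqrt_def g_def)
    ultimately show False using nd as by (simp add: C1_def)
  qed
  moreover have "\<forall>\<^sub>F l in at_top. I l = of_real (1 / l powr (3 / 2)) * exp (of_real l * g t0) * (C1 + E l)"
    using eventually_ge_at_top[of 1] by eventually_elim (rule eq)
  ultimately show ?thesis using O by (intro conjI exI[of _ E] impI)
qed

end
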